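(* Let $A$ be a connected $G$-graded associative algebra with unit over a principal ideal domain $\mathbf{k}$. Suppose that the $\mathbf{k}$-modules $\operatorname{Tor}^A_1(\mathbf{k},\mathbf{k})_n$ and $\operatorname{Tor}^A_2(\mathbf{k},\mathbf{k})_n$ are finitely generated for all $n\in G$. Then: (1) If $A$ is a free $\mathbf{k}$-module, it admits a homogeneous presentation that contains, for every $n\in G$, precisely $\operatorname{gen}\operatorname{Tor}^A_1(\mathbf{k},\mathbf{k})_n$ generators and $\operatorname{gen}\operatorname{Tor}^A_2(\mathbf{k},\mathbf{k})_n+\operatorname{rel}\operatorname{Tor}^A_1(\mathbf{k},\mathbf{k})_n$ relations of degree $n$. (2) If $A$ admits a homogeneous presentation that contains $N_n$ generators and $M_n$ relations of degree $n$, then $$N_n\geq\operatorname{gen}\operatorname{Tor}^A_1(\mathbf{k},\mathbf{k})_n,\qquad M_n\geq\operatorname{gen}\operatorname{Tor}^A_2(\mathbf{k},\mathbf{k})_n+\operatorname{rel}\operatorname{Tor}^A_1(\mathbf{k},\mathbf{k})_n.$$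
   Context: $G$ is a commutative monoid with a homomorphism $G\to\mathbb{Z}$, which induces a $\mathbb{Z}$-grading on every $G$-graded algebra; $A$ is connected if, for this $\mathbb{Z}$-grading, $A_{<0}=0$ and $A_0=\mathbf{k}\cdot 1$. The augmentation $A\to A_0\cong\mathbf{k}$ makes $\mathbf{k}$ a left and a right $A$-module; $\operatorname{Tor}^A_i(\mathbf{k},\mathbf{k})_n$ is the component of homological degree $i$ and internal degree $n\in G$. A homogeneous presentation of $A$ is an isomorphism $A\cong T(x_1,\dots,x_N)/(r_1,\dots,r_M)$ (tensor algebra modulo a two-sided ideal), with $G$-homogeneous generators $x_i$ and relations $r_j$ of positive $\mathbb{Z}$-degree; $N$, $M$ (and $N_n,M_n$ in (2)) may be infinite. For a finitely generated module $M$ over the PID $\mathbf{k}$ write $M\simeq\mathbf{k}/(d_1)\oplus\dots\oplus\mathbf{k}/(d_r)$ with all $d_i$ non-invertible and $d_i\mid d_{i+1}$; then $\operatorname{gen}M:=r$ and $\operatorname{rel}M:=\max\{s: d_s\neq0\}$ (equal to $0$ if there is no such $s$). *)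

theory Defs
  imports Complex_Main "HOL-Library.Poly_Mapping"
begin

section \<open>Principal ideal domains and invariant factors\<close>

class pid = idom +
  assumes principal_ideal:
    "0 \<in> I \<Longrightarrow> (\<forall>x\<in>I. \<forall>y\<in>I. x + y \<in> I) \<Longrightarrow> (\<forall>c. \<forall>x\<in>I. c * x \<in> I) \<Longrightarrow> \<exists>a. I = {b. a dvd b}"

text \<open>A subquotient \<open>Z / B\<close> of an ambient \<open>k\<close>-module (with scalar multiplication \<open>sc\<close>)
  is represented by the pair \<open>(Z, B)\<close> of submodules \<open>B \<subseteq> Z\<close>.\<close>

definition fin_gen :: "('k::comm_ring_1 \<Rightarrow> 'm::ab_group_add \<Rightarrow> 'm) \<Rightarrow> 'm set \<times> 'm set \<Rightarrow> bool" where
  "fin_gen sc Q \<longleftrightarrow>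
     (\<exists>S. finite S \<and> S \<subseteq> fst Q \<and> (\<forall>z\<in>fst Q. \<exists>s\<in>module.span sc S. z - s \<in> snd Q))"

text \<open>The elements \<open>zs\<close> define a \<open>k\<close>-linear map from \<open>k ^ r\<close> to \<open>Z / B\<close>. The second and third
  line say that it is onto and that its kernel is \<open>(d1) \<times> \<dots> \<times> (dr)\<close>, i.e. that it induces an
  isomorphism from \<open>k/(d1) \<oplus> \<dots> \<oplus> k/(dr)\<close> to \<open>Z / B\<close>.\<close>

definition invariant_factors ::
    "('k::comm_ring_1 \<Rightarrow> 'm::ab_group_add \<Rightarrow> 'm) \<Rightarrow> 'm set \<times> 'm set \<Rightarrow> 'k list \<Rightarrow> bool" where
  "invariant_factors sc Q ds \<longleftrightarrow>
     (\<exists>zs. length zs = length ds \<and> set zs \<subseteq> fst Q \<and>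
        (\<forall>z\<in>fst Q. \<exists>c. z - (\<Sum>i<length ds. sc (c i) (zs ! i)) \<in> snd Q) \<and>
        (\<forall>c. (\<Sum>i<length ds. sc (c i) (zs ! i)) \<in> snd Q \<longleftrightarrow> (\<forall>i<length ds. ds ! i dvd c i))) \<and>
     (\<forall>i<length ds. \<not> ds ! i dvd 1) \<and>
     (\<forall>i. Suc i < length ds \<longrightarrow> ds ! i dvd ds ! Suc i)"

text \<open>The list of invariant factors of a finitely generated module over a PID exists and is unique
  up to units, so the choice is immaterial.\<close>

definition gen :: "('k::comm_ring_1 \<Rightarrow> 'm::ab_group_add \<Rightarrow> 'm) \<Rightarrow> 'm set \<times> 'm set \<Rightarrow> nat" where
  "gen sc Q = length (SOME ds. invariant_factors sc Q ds)"

definition rel :: "('k::comm_ring_1 \<Rightarrow> 'm::ab_group_add \<Rightarrow> 'm) \<Rightarrow> 'm set \<times> 'm set \<Rightarrow> nat" where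
  "rel sc Q =
     (let ds = (SOME ds. invariant_factors sc Q ds)
      in Max (insert 0 {s. 1 \<le> s \<and> s \<le> length ds \<and> ds ! (s - 1) \<noteq> 0}))"


section \<open>Connected graded algebras\<close>

locale graded_algebra = module scale
  for scale :: "'k::comm_ring_1 \<Rightarrow> 'a::ring_1 \<Rightarrow> 'a" +
  fixes gr :: "'g::comm_monoid_add \<Rightarrow> 'a set"
  assumes scale_mult_left: "scale c x * y = scale c (x * y)"
    and scale_mult_right: "x * scale c y = scale c (x * y)"
    and subspace_gr: "subspace (gr n)"
    and one_gr: "1 \<in> gr 0"
    and mult_gr: "x \<in> gr m \<Longrightarrow> y \<in> gr n \<Longrightarrow> x * y \<in> gr (m + n)"
    and gr_sum: "\<exists>S f. finite S \<and> (\<forall>n\<in>S. f n \<in> gr n) \<and> x = (\<Sum>n\<in>S. f n)"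
    and gr_direct: "finite S \<Longrightarrow> (\<forall>n\<in>S. f n \<in> gr n) \<Longrightarrow> (\<Sum>n\<in>S. f n) = 0 \<Longrightarrow> n \<in> S \<Longrightarrow> f n = 0"

definition zgr :: "('k::comm_ring_1 \<Rightarrow> 'a::ring_1 \<Rightarrow> 'a) \<Rightarrow> ('g::comm_monoid_add \<Rightarrow> 'a set)
    \<Rightarrow> ('g \<Rightarrow> int) \<Rightarrow> int \<Rightarrow> 'a set" where
  "zgr scale gr deg j = module.span scale (\<Union>n\<in>{n. deg n = j}. gr n)"

text \<open>The last axiom makes \<open>A_0 = k \<cdot> 1\<close> isomorphic to \<open>k\<close>.\<close>

locale connected_graded_algebra = graded_algebra scale gr
  for scale :: "'k::comm_ring_1 \<Rightarrow> 'a::ring_1 \<Rightarrow> 'a"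
    and gr :: "'g::comm_monoid_add \<Rightarrow> 'a set" +
  fixes deg :: "'g \<Rightarrow> int"
  assumes deg_zero: "deg 0 = 0"
    and deg_add: "deg (m + n) = deg m + deg n"
    and zgr_neg: "j < 0 \<Longrightarrow> zgr scale gr deg j = {0}"
    and zgr_zero: "zgr scale gr deg 0 = range (\<lambda>c. scale c 1)"
    and scale_one_eq_zero: "scale c 1 = 0 \<Longrightarrow> c = 0"

definition aug :: "('k::comm_ring_1 \<Rightarrow> 'a::ring_1 \<Rightarrow> 'a) \<Rightarrow> ('g::comm_monoid_add \<Rightarrow> 'a set)
    \<Rightarrow> ('g \<Rightarrow> int) \<Rightarrow> 'a \<Rightarrow> 'k" where
  "aug scale gr deg a =
     (THE c. a - scale c 1 \<in> module.span scale (\<Union>j\<in>{j. j \<noteq> 0}. zgr scale gr deg j))"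


section \<open>Free modules and graded free resolutions\<close>

text \<open>For a ring \<open>R\<close>, the type \<open>'e \<Rightarrow>\<^sub>0 R\<close> is the free left \<open>R\<close>-module on \<open>'e\<close>.\<close>

definition smul :: "'r::ring_1 \<Rightarrow> ('e \<Rightarrow>\<^sub>0 'r) \<Rightarrow> ('e \<Rightarrow>\<^sub>0 'r)" where
  "smul a f = Poly_Mapping.map ((*) a) f"

lemma lookup_smul: "Poly_Mapping.lookup (smul a f) e = a * Poly_Mapping.lookup f e"
  by (simp add: smul_def Poly_Mapping.map.rep_eq when_def)

lemma module_smul: "module (smul :: 'k::comm_ring_1 \<Rightarrow> ('e \<Rightarrow>\<^sub>0 'k) \<Rightarrow> ('e \<Rightarrow>\<^sub>0 'k))"
  by unfold_locales
    (auto intro!: poly_mapping_eqI simp: lookup_smul lookup_add algebra_simps)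

definition free_mod :: "'e set \<Rightarrow> ('e \<Rightarrow>\<^sub>0 'a::ring_1) set" where
  "free_mod E = {f. Poly_Mapping.keys f \<subseteq> E}"

text \<open>The degree \<open>n\<close> component when the basis element \<open>e\<close> has degree \<open>ge e\<close>. As \<open>G\<close> need not be
  cancellative, there may be several \<open>m\<close> with \<open>m + ge e = n\<close>.\<close>

definition free_mod_gr :: "('k::comm_ring_1 \<Rightarrow> 'a::ring_1 \<Rightarrow> 'a) \<Rightarrow> ('g::comm_monoid_add \<Rightarrow> 'a set)
    \<Rightarrow> 'e set \<Rightarrow> ('e \<Rightarrow> 'g) \<Rightarrow> 'g \<Rightarrow> ('e \<Rightarrow>\<^sub>0 'a) set" where
  "free_mod_gr scale gr E ge n =
     {f \<in> free_mod E. \<forall>e\<in>E. Poly_Mapping.lookup f e \<in> module.span scale (\<Union>m\<in>{m. m + ge e = n}. gr m)}"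

definition left_linear :: "('a \<Rightarrow> 'm \<Rightarrow> 'm) \<Rightarrow> ('a \<Rightarrow> 'n \<Rightarrow> 'n) \<Rightarrow> 'm::ab_group_add set
    \<Rightarrow> ('m \<Rightarrow> 'n::ab_group_add) \<Rightarrow> bool" where
  "left_linear act act' M h \<longleftrightarrow>
     (\<forall>x\<in>M. \<forall>y\<in>M. h (x + y) = h x + h y) \<and> (\<forall>a. \<forall>x\<in>M. h (act a x) = act' a (h x))"

text \<open>\<open>\<dots> \<rightarrow> F 2 \<rightarrow> F 1 \<rightarrow> F 0 \<rightarrow> k \<rightarrow> 0\<close> is an exact sequence of graded left \<open>A\<close>-modules, where
  \<open>F i\<close> is the free module on the homogeneous basis \<open>E i\<close>, the differential \<open>d i\<close> goes from
  \<open>F (i + 1)\<close> to \<open>F i\<close>, and \<open>k\<close> is a left \<open>A\<close>-module via the augmentation, concentrated in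
  degree \<open>0\<close>.\<close>

definition graded_free_resolution :: "('k::comm_ring_1 \<Rightarrow> 'a::ring_1 \<Rightarrow> 'a)
    \<Rightarrow> ('g::comm_monoid_add \<Rightarrow> 'a set) \<Rightarrow> ('g \<Rightarrow> int)
    \<Rightarrow> (nat \<Rightarrow> 'e set) \<Rightarrow> (nat \<Rightarrow> 'e \<Rightarrow> 'g) \<Rightarrow> (nat \<Rightarrow> ('e \<Rightarrow>\<^sub>0 'a) \<Rightarrow> ('e \<Rightarrow>\<^sub>0 'a))
    \<Rightarrow> (('e \<Rightarrow>\<^sub>0 'a) \<Rightarrow> 'k) \<Rightarrow> bool" where
  "graded_free_resolution scale gr deg E ge d \<eta> \<longleftrightarrow>
     (\<forall>i. left_linear smul smul (free_mod (E (Suc i))) (d i)) \<and>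
     (\<forall>i n. d i ` free_mod_gr scale gr (E (Suc i)) (ge (Suc i)) n
              \<subseteq> free_mod_gr scale gr (E i) (ge i) n) \<and>
     left_linear smul (\<lambda>a c. aug scale gr deg a * c) (free_mod (E 0)) \<eta> \<and>
     (\<forall>n. n \<noteq> 0 \<longrightarrow> \<eta> ` free_mod_gr scale gr (E 0) (ge 0) n \<subseteq> {0}) \<and>
     \<eta> ` free_mod (E 0) = UNIV \<and>
     d 0 ` free_mod (E 1) = {f \<in> free_mod (E 0). \<eta> f = 0} \<and>
     (\<forall>i. d (Suc i) ` free_mod (E (Suc (Suc i))) = {f \<in> free_mod (E (Suc i)). d i f = 0})"


section \<open>Tensor products and Tor\<close>

text \<open>For a right \<open>A\<close>-module \<open>M\<close> (the whole type \<open>'m\<close>, with \<open>k\<close>-action \<open>sc\<close> and \<open>A\<close>-action \<open>ract\<close>)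
  and a left \<open>A\<close>-module \<open>N\<close> with action \<open>lact\<close>, the tensor product of \<open>M\<close> and \<open>N\<close> over \<open>A\<close> is the
  quotient of the free \<open>k\<close>-module on \<open>M \<times> N\<close> by \<open>tensor_rel sc ract lact N\<close>.\<close>

definition tens :: "'m \<Rightarrow> 'n \<Rightarrow> ('m \<times> 'n) \<Rightarrow>\<^sub>0 'k::comm_ring_1" where
  "tens x y = Poly_Mapping.single (x, y) 1"

definition tensor_rel :: "('k::comm_ring_1 \<Rightarrow> 'm::ab_group_add \<Rightarrow> 'm) \<Rightarrow> ('m \<Rightarrow> 'a \<Rightarrow> 'm)
    \<Rightarrow> ('a \<Rightarrow> 'n::ab_group_add \<Rightarrow> 'n) \<Rightarrow> 'n set \<Rightarrow> (('m \<times> 'n) \<Rightarrow>\<^sub>0 'k) set" where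
  "tensor_rel sc ract lact N = module.span smul
     ({tens (x + x') y - tens x y - tens x' y | x x' y. y \<in> N} \<union>
      {tens x (y + y') - tens x y - tens x y' | x y y'. y \<in> N \<and> y' \<in> N} \<union>
      {tens (sc c x) y - smul c (tens x y) | c x y. y \<in> N} \<union>
      {tens (ract x a) y - tens x (lact a y) | x a y. y \<in> N})"

text \<open>The map \<open>id \<otimes> h\<close> on the level of free \<open>k\<close>-modules.\<close>

definition tensor_map :: "('n \<Rightarrow> 'n') \<Rightarrow> (('m \<times> 'n) \<Rightarrow>\<^sub>0 'k::comm_ring_1) \<Rightarrow> (('m \<times> 'n') \<Rightarrow>\<^sub>0 'k)" where
  "tensor_map h p =
     (\<Sum>(x, y)\<in>Poly_Mapping.keys p. Poly_Mapping.single (x, h y) (Poly_Mapping.lookup p (x, y)))"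

text \<open>\<open>Tor scale gr deg E ge d i n\<close> is the homology of the tensor product over \<open>A\<close> of the right module
  \<open>k\<close> and the resolution \<open>F\<close>, in homological degree \<open>i\<close> and internal degree \<open>n\<close>. An element of
  \<open>tor_chains\<close> represents its class modulo \<open>tor_rel\<close>; since \<open>k\<close> sits in degree \<open>0\<close>, the
  component of degree \<open>n\<close> consists of the combinations of \<open>c \<otimes> f\<close> with \<open>f\<close> of degree \<open>n\<close>. The
  cycles are the chains whose differential vanishes modulo \<open>tor_rel\<close>, and the boundaries
  the chains that agree modulo \<open>tor_rel\<close> with a differential.\<close>

definition tor_rel :: "('k::comm_ring_1 \<Rightarrow> 'a::ring_1 \<Rightarrow> 'a) \<Rightarrow> ('g::comm_monoid_add \<Rightarrow> 'a set)
    \<Rightarrow> ('g \<Rightarrow> int) \<Rightarrow> (nat \<Rightarrow> 'e set) \<Rightarrow> nat \<Rightarrow> (('k \<times> ('e \<Rightarrow>\<^sub>0 'a)) \<Rightarrow>\<^sub>0 'k) set" where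
  "tor_rel scale gr deg E i =
     tensor_rel (*) (\<lambda>c a. c * aug scale gr deg a) smul (free_mod (E i))"

definition tor_chains :: "('k::comm_ring_1 \<Rightarrow> 'a::ring_1 \<Rightarrow> 'a) \<Rightarrow> ('g::comm_monoid_add \<Rightarrow> 'a set)
    \<Rightarrow> (nat \<Rightarrow> 'e set) \<Rightarrow> (nat \<Rightarrow> 'e \<Rightarrow> 'g) \<Rightarrow> nat \<Rightarrow> 'g \<Rightarrow> (('k \<times> ('e \<Rightarrow>\<^sub>0 'a)) \<Rightarrow>\<^sub>0 'k) set" where
  "tor_chains scale gr E ge i n =
     {p. Poly_Mapping.keys p \<subseteq> UNIV \<times> free_mod_gr scale gr (E i) (ge i) n}"

definition Tor :: "('k::comm_ring_1 \<Rightarrow> 'a::ring_1 \<Rightarrow> 'a) \<Rightarrow> ('g::comm_monoid_add \<Rightarrow> 'a set)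
    \<Rightarrow> ('g \<Rightarrow> int) \<Rightarrow> (nat \<Rightarrow> 'e set) \<Rightarrow> (nat \<Rightarrow> 'e \<Rightarrow> 'g) \<Rightarrow> (nat \<Rightarrow> ('e \<Rightarrow>\<^sub>0 'a) \<Rightarrow> ('e \<Rightarrow>\<^sub>0 'a))
    \<Rightarrow> nat \<Rightarrow> 'g
    \<Rightarrow> (('k \<times> ('e \<Rightarrow>\<^sub>0 'a)) \<Rightarrow>\<^sub>0 'k) set \<times> (('k \<times> ('e \<Rightarrow>\<^sub>0 'a)) \<Rightarrow>\<^sub>0 'k) set" where
  "Tor scale gr deg E ge d i n =
     ({p \<in> tor_chains scale gr E ge i n.
         case i of 0 \<Rightarrow> True | Suc j \<Rightarrow> tensor_map (d j) p \<in> tor_rel scale gr deg E j},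
      {p \<in> tor_chains scale gr E ge i n.
         \<exists>q\<in>tor_chains scale gr E ge (Suc i) n. p - tensor_map (d i) q \<in> tor_rel scale gr deg E i})"


section \<open>Free algebras and homogeneous presentations\<close>

text \<open>The tensor algebra on generators indexed by \<open>'x\<close> is the monoid algebra \<open>'x word \<Rightarrow>\<^sub>0 'k\<close> of
  the free monoid, with the convolution product provided by \<open>Poly_Mapping\<close>.\<close>

datatype 'x word = Word (letters: "'x list")

instantiation word :: (type) monoid_add
begin

definition zero_word :: "'a word" where "0 = Word []"

definition plus_word :: "'a word \<Rightarrow> 'a word \<Rightarrow> 'a word" where
  "u + v = Word (letters u @ letters v)"

instance
  by standard (simp_all add: zero_word_def plus_word_def)

end

definition free_alg :: "'x set \<Rightarrow> ('x word \<Rightarrow>\<^sub>0 'k::comm_ring_1) set" where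
  "free_alg X = {p. \<forall>w\<in>Poly_Mapping.keys p. set (letters w) \<subseteq> X}"

definition free_alg_gr :: "'x set \<Rightarrow> ('x \<Rightarrow> 'g::comm_monoid_add) \<Rightarrow> 'g
    \<Rightarrow> ('x word \<Rightarrow>\<^sub>0 'k::comm_ring_1) set" where
  "free_alg_gr X gx n =
     {p \<in> free_alg X. \<forall>w\<in>Poly_Mapping.keys p. sum_list (map gx (letters w)) = n}"

definition ideal_in :: "'t::ring_1 set \<Rightarrow> 't set \<Rightarrow> bool" where
  "ideal_in T I \<longleftrightarrow> I \<subseteq> T \<and> 0 \<in> I \<and> (\<forall>x\<in>I. \<forall>y\<in>I. x - y \<in> I) \<and>
     (\<forall>t\<in>T. \<forall>x\<in>I. t * x \<in> I \<and> x * t \<in> I)"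

definition ideal_gen :: "'t::ring_1 set \<Rightarrow> 't set \<Rightarrow> 't set" where
  "ideal_gen T R = \<Inter>{I. ideal_in T I \<and> R \<subseteq> I}"

text \<open>Generators and relations are families (indexed by \<open>X\<close> and \<open>J\<close>) with assigned degrees \<open>gx\<close>
  and \<open>gj\<close>. The map \<open>\<phi>\<close> induces the isomorphism of graded algebras from \<open>T(X)/(r)\<close> to \<open>A\<close>.\<close>

definition homogeneous_presentation :: "('k::comm_ring_1 \<Rightarrow> 'a::ring_1 \<Rightarrow> 'a)
    \<Rightarrow> ('g::comm_monoid_add \<Rightarrow> 'a set) \<Rightarrow> ('g \<Rightarrow> int) \<Rightarrow> 'x set \<Rightarrow> ('x \<Rightarrow> 'g)
    \<Rightarrow> 'j set \<Rightarrow> ('j \<Rightarrow> 'g) \<Rightarrow> ('j \<Rightarrow> ('x word \<Rightarrow>\<^sub>0 'k)) \<Rightarrow> bool" where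
  "homogeneous_presentation scale gr deg X gx J gj r \<longleftrightarrow>
     (\<forall>x\<in>X. deg (gx x) > 0) \<and>
     (\<forall>j\<in>J. deg (gj j) > 0 \<and> r j \<in> free_alg_gr X gx (gj j)) \<and>
     (\<exists>\<phi>. (\<forall>p\<in>free_alg X. \<forall>q\<in>free_alg X. \<phi> (p + q) = \<phi> p + \<phi> q \<and> \<phi> (p * q) = \<phi> p * \<phi> q) \<and>
          (\<forall>c. \<forall>p\<in>free_alg X. \<phi> (smul c p) = scale c (\<phi> p)) \<and>
          \<phi> 1 = 1 \<and>
          (\<forall>n. \<phi> ` free_alg_gr X gx n \<subseteq> gr n) \<and>
          \<phi> ` free_alg X = UNIV \<and>
          {p \<in> free_alg X. \<phi> p = 0} = ideal_gen (free_alg X) (r ` J))"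

end

(* Any two graded free resolutions of k are homotopy equivalent, so Tor can be computed from a
   resolution that begins with a presentation, namely A^J -> A^X -> A -> k, where the relation
   r = sum_x p_x x is sent to sum_x p_x e_x (Fox calculus). After tensoring with k, this becomes
   k^J -> k^X -> k, the first map being the linear part f of the relations and the second one
   zero. Hence Tor_1 is the cokernel of f and Tor_2 is a quotient of its kernel.

   For the lower bounds, lifts of the generators of a module k/(d1) + ... + k/(dr) with d1 | d2 | ...
   and d1 not invertible to a free module are linearly independent. Such lifts z1, ..., zr of the
   generators of Tor_1 give the bound for X; lifts of the generators of Tor_2, together with
   preimages under f of those di * zi with di nonzero, give the bound for J.

   For the existence, lifts to A of the generators of Tor_1, which is the module of indecomposables
   of A, generate A by the graded Nakayama lemma. Starting from all relations between them, the
   relations that correspond to the elements of the second independent family generate the ideal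
   of relations, again by a Nakayama argument, since an element of it with vanishing Fox derivative
   is a sum of products of smaller relations with generators. *)

theory Submission
  imports Defs
begin

text \<open>\<open>gen\<close> and \<open>rel\<close> are read off one list of invariant factors
  chosen for each Tor. What is transported between Tor, the reduced complexes and the
  indecomposables is therefore this list itself, along maps that induce isomorphisms of the
  quotients. Boundaries are described as reductions of elements of the kernel of a differential. By
  exactness these are the images from the next term; so Tor_1 and Tor_2 are determined by F2 -> F1
  -> F0 -> k, and the Fox complex can stop at A^J. The sum gen Tor_2 + rel Tor_1 comes from ker f ->
  k^J -> im f: the kernel has Tor_2 as a quotient, and im f, the module of relations between the
  generators of Tor_1, contributes one independent element for every nonzero d_i. As
  \<open>G\<close> may fail to be cancellative, the coefficients of a homogeneous element of a free
  module lie in sums of several components of A. Projections are therefore taken onto sets of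
  degrees. Inductions run over the integer degree, which is positive on generators and
  relations.\<close>

section \<open>Modules over a principal ideal domain\<close>

text \<open>The ascending chain condition: along a chain of proper divisors the ideals
  \<open>(f i)\<close> increase, and their union is generated by some \<open>a\<close>. This
  \<open>a\<close> lies in one \<open>(f i)\<close> and divides \<open>f (Suc i)\<close>, so the
  chain is not strict there.\<close>

lemma pid_maximal_divisor:
  fixes S :: "'k::pid set"
  assumes "S \<noteq> {}"
  obtains a where "a \<in> S" "\<And>b. b \<in> S \<Longrightarrow> b dvd a \<Longrightarrow> a dvd b"
proof -
  have "wf {(x::'k, y). x dvd y \<and> \<not> y dvd x}"
    unfolding wf_iff_no_infinite_down_chain
  proof (rule notI, elim exE)
    fix f :: "nat \<Rightarrow> 'k"
    assume "\<forall>i. (f (Suc i), f i) \<in> {(x, y). x dvd y \<and> \<not> y dvd x}"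
    then have f: "f (Suc i) dvd f i" "\<not> f i dvd f (Suc i)" for i
      by auto
    have mono: "i \<le> j \<Longrightarrow> f j dvd f i" for i j
      by (induction rule: dec_induct) (auto intro: dvd_trans f)
    have "\<exists>a. {b. \<exists>i. f i dvd b} = {b. a dvd b}"
    proof (rule principal_ideal)
      show "\<forall>x\<in>{b. \<exists>i. f i dvd b}. \<forall>y\<in>{b. \<exists>i. f i dvd b}. x + y \<in> {b. \<exists>i. f i dvd b}"
      proof clarify
        fix x y i j assume "f i dvd x" "f j dvd y"
        then have "f (max i j) dvd x" "f (max i j) dvd y"
          using mono[of i "max i j"] mono[of j "max i j"] by (auto intro: dvd_trans)
        then show "\<exists>i. f i dvd x + y"
          using dvd_add by blast
      qed
    qed (auto intro: dvd_mult)
    then obtain a where a: "{b. \<exists>i. f i dvd b} = {b. a dvd b}" ..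
    then have "a \<in> {b. \<exists>i. f i dvd b}"
      by simp
    then obtain i where i: "f i dvd a"
      by blast
    moreover have "f (Suc i) \<in> {b. a dvd b}"
      unfolding a[symmetric] by (auto intro: exI[of _ "Suc i"])
    then have "a dvd f (Suc i)"
      by simp
    ultimately show False
      using f(2) dvd_trans by blast
  qed
  moreover obtain x where "x \<in> S"
    using assms by blast
  ultimately obtain a where "a \<in> S" "\<And>y. (y, a) \<in> {(x::'k, y). x dvd y \<and> \<not> y dvd x} \<Longrightarrow> y \<notin> S"
    by (rule wfE_min) blast
  then show ?thesis
    by (intro that) auto
qed

lemma pid_bezout:
  fixes a :: "'i \<Rightarrow> 'k::pid"
  assumes "finite S"
  obtains g u where "g = (\<Sum>i\<in>S. u i * a i)" "\<And>i. i \<in> S \<Longrightarrow> g dvd a i"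
proof -
  let ?I = "range (\<lambda>u. \<Sum>i\<in>S. u i * a i)"
  have "\<exists>g. ?I = {b. g dvd b}"
  proof (rule principal_ideal)
    show "0 \<in> ?I"
      by (rule range_eqI[of _ _ "\<lambda>_. 0"]) simp
    show "\<forall>x\<in>?I. \<forall>y\<in>?I. x + y \<in> ?I"
    proof clarify
      fix u v :: "'i \<Rightarrow> 'k"
      show "(\<Sum>i\<in>S. u i * a i) + (\<Sum>i\<in>S. v i * a i) \<in> ?I"
        by (rule range_eqI[of _ _ "\<lambda>i. u i + v i"]) (simp add: algebra_simps sum.distrib)
    qed
    show "\<forall>c. \<forall>x\<in>?I. c * x \<in> ?I"
    proof clarify
      fix c :: 'k and u :: "'i \<Rightarrow> 'k"
      show "c * (\<Sum>i\<in>S. u i * a i) \<in> ?I"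
        by (rule range_eqI[of _ _ "\<lambda>i. c * u i"]) (simp add: algebra_simps sum_distrib_left)
    qed
  qed
  then obtain g where g: "?I = {b. g dvd b}" ..
  have "g \<in> ?I"
    unfolding g by simp
  then obtain u where "g = (\<Sum>i\<in>S. u i * a i)"
    by blast
  moreover have "g dvd a i" if "i \<in> S" for i
  proof -
    have "a i \<in> ?I"
      using assms that by (intro range_eqI[of _ _ "\<lambda>j. if j = i then 1 else 0"])
        (simp add: if_distrib[of "\<lambda>x. x * _"] sum.delta' cong: if_cong)
    then show ?thesis
      unfolding g by simp
  qed
  ultimately show ?thesis
    using that by blast
qed

section \<open>Finitely generated modules as sums of cyclic modules\<close>

locale pid_module = module scale
  for scale :: "'k::pid \<Rightarrow> 'b::ab_group_add \<Rightarrow> 'b" (infixr "*s" 75)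
begin

text \<open>The classes of \<open>z 0, ..., z (r - 1)\<close> generate the quotient
  \<open>Z / B\<close>. With tuples as functions, elementary changes of generators become function
  updates.\<close>

definition generates :: "'b set \<Rightarrow> 'b set \<Rightarrow> nat \<Rightarrow> (nat \<Rightarrow> 'b) \<Rightarrow> bool" where
  "generates Z B r z \<longleftrightarrow> z ` {..<r} \<subseteq> Z \<and> Z \<subseteq> span (B \<union> z ` {..<r})"

lemma span_Un_image:
  assumes "subspace B"
  shows "x \<in> span (B \<union> z ` {..<r::nat}) \<longleftrightarrow> (\<exists>c. x - (\<Sum>i<r. c i *s z i) \<in> B)"
proof
  assume "x \<in> span (B \<union> z ` {..<r})"
  then show "\<exists>c. x - (\<Sum>i<r. c i *s z i) \<in> B"
  proof (induction rule: span_induct_alt)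
    case base
    show ?case
      using assms by (intro exI[of _ "\<lambda>_. 0"]) (simp add: subspace_0)
  next
    case (step a x y)
    then obtain c where c: "y - (\<Sum>i<r. c i *s z i) \<in> B"
      by blast
    from step(1) consider "x \<in> B" | j where "j < r" "x = z j"
      by auto
    then show ?case
    proof cases
      case 1
      then have "a *s x + (y - (\<Sum>i<r. c i *s z i)) \<in> B"
        using c assms by (intro subspace_add subspace_scale)
      then show ?thesis
        by (auto simp: algebra_simps)
    next
      case 2
      have "(\<Sum>i<r. (if i = j then a else 0) *s z i) = a *s x"
        using 2 by (simp add: if_distrib[of "\<lambda>c. c *s _"] cong: if_cong)
      then have "a *s x + y - (\<Sum>i<r. (c i + (if i = j then a else 0)) *s z i) = y - (\<Sum>i<r. c i *s z i)"
        by (simp add: scale_left_distrib sum.distrib)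
      then show ?thesis
        using c by (intro exI[of _ "\<lambda>i. c i + (if i = j then a else 0)"]) (simp only:)
    qed
  qed
next
  assume "\<exists>c. x - (\<Sum>i<r. c i *s z i) \<in> B"
  then obtain c where "x - (\<Sum>i<r. c i *s z i) \<in> B" ..
  then have "x - (\<Sum>i<r. c i *s z i) \<in> span (B \<union> z ` {..<r})"
    by (simp add: span_base)
  moreover have "(\<Sum>i<r. c i *s z i) \<in> span (B \<union> z ` {..<r})"
    by (intro span_sum span_scale span_base) auto
  ultimately show "x \<in> span (B \<union> z ` {..<r})"
    using span_add by fastforce
qed

lemma generates_change:
  fixes z z' :: "nat \<Rightarrow> 'b"
  assumes "generates Z B r z" "z' ` {..<r'} \<subseteq> Z" "z ` {..<r} \<subseteq> span (B \<union> z' ` {..<r'})"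
  shows "generates Z B r' z'"
proof -
  have "span (B \<union> z ` {..<r}) \<subseteq> span (B \<union> z' ` {..<r'})"
    using assms(3) by (intro span_minimal) (auto intro: span_base)
  with assms show ?thesis
    by (auto simp: generates_def)
qed

text \<open>An invertible change of the two generators \<open>z 0\<close> and \<open>z i\<close>
  concentrates both coefficients of the relation in one of them, as their gcd.\<close>

lemma gcd_coefficient:
  assumes Z: "subspace Z" and gen: "generates Z B r z" and rel: "(\<Sum>i<r. c i *s z i) \<in> B"
    and i: "i < r" "i \<noteq> 0"
  obtains z' c' g where "generates Z B r z'" "(\<Sum>i<r. c' i *s z' i) \<in> B"
    "c' 0 = g" "g dvd c 0" "g dvd c i"
proof -
  obtain g w where g: "g = (\<Sum>j\<in>{0, i}. w j * c j)" "\<And>j. j \<in> {0, i} \<Longrightarrow> g dvd c j"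
    using pid_bezout[of "{0, i}" c] by blast
  show ?thesis
  proof (cases "g = 0")
    case True
    then have "c 0 = 0" "c i = 0"
      using g(2)[of 0] g(2)[of i] by auto
    with that[OF gen rel] True show ?thesis
      by auto
  next
    case False
    obtain a b where ab: "c 0 = g * a" "c i = g * b"
      using g(2) by (meson dvdE insertCI)
    define u v where "u = w 0" and "v = w i"
    have "g = u * c 0 + v * c i"
      using g(1) i by (simp add: u_def v_def)
    then have "g * (u * a + v * b) = g * 1"
      by (simp add: ab algebra_simps)
    then have one: "u * a + v * b = 1"
      using False by (simp only: mult_cancel_left) simp
    \<comment> \<open>The matrix with rows \<open>(a, b)\<close> and \<open>(-v, u)\<close> has
      determinant \<open>u * a + v * b = 1\<close>. Since the two coefficients are
      \<open>g * a\<close> and \<open>g * b\<close>, their part of the relation becomes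
      \<open>g\<close> times the new \<open>z' 0\<close>.\<close>
    define z' where "z' = z(0 := scale a (z 0) + scale b (z i), i := scale u (z i) - scale v (z 0))"
    define c' where "c' = c(0 := g, i := 0)"
    have zZ: "z j \<in> Z" if "j < r" for j
      using gen that by (auto simp: generates_def)
    have z'0: "z' 0 = scale a (z 0) + scale b (z i)" and z'i: "z' i = scale u (z i) - scale v (z 0)"
      using i by (auto simp: z'_def)
    have "scale u (z' 0) - scale b (z' i) = scale (u * a + v * b) (z 0)"
      by (simp add: z'0 z'i algebra_simps)
    then have z0: "z 0 = scale u (z' 0) - scale b (z' i)"
      by (simp add: one)
    have "scale v (z' 0) + scale a (z' i) = scale (u * a + v * b) (z i)"
      by (simp add: z'0 z'i algebra_simps)
    then have zi: "z i = scale v (z' 0) + scale a (z' i)"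
      by (simp add: one)
    have "generates Z B r z'"
    proof (rule generates_change[OF gen])
      show "z' ` {..<r} \<subseteq> Z"
        using zZ i by (auto simp: z'_def intro!: subspace_add[OF Z] subspace_diff[OF Z] subspace_scale[OF Z])
      have base: "z' j \<in> span (B \<union> z' ` {..<r})" if "j < r" for j
        using that by (intro span_base) auto
      show "z ` {..<r} \<subseteq> span (B \<union> z' ` {..<r})"
      proof (rule image_subsetI)
        fix j assume j: "j \<in> {..<r}"
        have "0 < r"
          using i by simp
        consider "j = 0" | "j = i" | "z' j = z j"
          using i by (cases "j = i"; cases "j = 0") (auto simp: z'_def)
        then show "z j \<in> span (B \<union> z' ` {..<r})"
        proof cases
          case 1
          then show ?thesis
            using z0 base[OF \<open>0 < r\<close>] base[OF i(1)] by (auto intro: span_diff span_scale)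
        next
          case 2
          then show ?thesis
            using zi base[OF \<open>0 < r\<close>] base[OF i(1)] by (auto intro: span_add span_scale)
        next
          case 3
          then show ?thesis
            using base[of j] j by simp
        qed
      qed
    qed
    moreover have "(\<Sum>j<r. scale (c' j) (z' j)) = (\<Sum>j<r. scale (c j) (z j))"
    proof -
      have S: "finite {..<r}" "0 \<in> {..<r}" "finite ({..<r} - {0})" "i \<in> {..<r} - {0}"
        using i by auto
      have split: "(\<Sum>j<r. f j) = f 0 + (f i + (\<Sum>j\<in>{..<r} - {0} - {i}. f j))" for f :: "nat \<Rightarrow> 'b"
        by (simp add: sum.remove[OF S(1,2), of f] sum.remove[OF S(3,4), of f])
      have "(\<Sum>j\<in>{..<r} - {0} - {i}. scale (c' j) (z' j)) = (\<Sum>j\<in>{..<r} - {0} - {i}. scale (c j) (z j))"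
        by (rule sum.cong) (auto simp: c'_def z'_def)
      moreover have "scale (c' 0) (z' 0) + c' i *s z' i = scale (c 0) (z 0) + c i *s z i"
        using i by (simp add: z'0 c'_def ab algebra_simps)
      ultimately show ?thesis
        by (simp add: split add.assoc[symmetric])
    qed
    ultimately show ?thesis
      using that[of z' c' g] rel g(2) i by (auto simp: c'_def)
  qed
qed


text \<open>A gcd of \<open>d\<close> and \<open>c i\<close> occurs as a first coefficient by
  \<open>gcd_coefficient\<close>. It divides \<open>d\<close>, so by maximality \<open>d\<close>
  divides it.\<close>

lemma maximal_coefficient_dvd:
  assumes Z: "subspace Z" and B: "subspace B" and gen: "generates Z B r z"
    and d: "(\<Sum>i<r. c i *s z i) \<in> B" "c 0 = d"
    and max: "\<forall>z' c'. generates Z B r z' \<longrightarrow> (\<Sum>i<r. c' i *s z' i) \<in> B \<longrightarrow> c' 0 dvd d \<longrightarrow> d dvd c' 0"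
    and i: "i < r"
  shows "d dvd c i"
proof (cases "i = 0")
  case False
  obtain z' c' g where "generates Z B r z'" "(\<Sum>i<r. c' i *s z' i) \<in> B" "c' 0 = g" "g dvd c 0" "g dvd c i"
    using gcd_coefficient[OF Z gen d(1) i False] .
  with max d(2) show ?thesis
    by (metis dvd_trans)
qed (use d in simp)

text \<open>Consider the coefficients of the first generator in all relations between the elements of
  generating tuples of the given length. Among the ideals that they generate, \<open>(d)\<close> is maximal.\<close>

lemma split_off_cyclic:
  assumes Z: "subspace Z" and B: "subspace B" "B \<subseteq> Z" and gen: "generates Z B (Suc r) z"
  shows "\<exists>d z1. z1 \<in> Z \<and> d *s z1 \<in> B \<and>
    (\<forall>z c i. generates Z B (Suc r) z \<longrightarrow> z 0 = z1 \<longrightarrow> (\<Sum>i<Suc r. c i *s z i) \<in> B \<longrightarrow> i < Suc r \<longrightarrow> d dvd c i) \<and>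
    (\<exists>z. generates Z B (Suc r) z \<and> z 0 = z1)"
proof -
  let ?S = "{c 0 | z c. generates Z B (Suc r) z \<and> (\<Sum>i<Suc r. c i *s z i) \<in> B}"
  have "(\<Sum>i<Suc r. 0 *s z i) \<in> B"
    using B by (simp add: subspace_0)
  then have "0 \<in> ?S"
    using gen by (intro CollectI exI[of _ z] exI[of _ "\<lambda>_. 0"]) auto
  then have "?S \<noteq> {}"
    by blast
  then obtain d where d: "d \<in> ?S" "\<And>b. b \<in> ?S \<Longrightarrow> b dvd d \<Longrightarrow> d dvd b"
    by (rule pid_maximal_divisor) blast
  then obtain y c where y: "generates Z B (Suc r) y" "(\<Sum>i<Suc r. c i *s y i) \<in> B" "c 0 = d"
    by blast
  have max: "\<forall>z' c'. generates Z B (Suc r) z' \<longrightarrow> (\<Sum>i<Suc r. c' i *s z' i) \<in> B \<longrightarrow> c' 0 dvd d \<longrightarrow> d dvd c' 0"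
    using d(2) by blast
  have "d dvd c i" if "i < Suc r" for i
    by (rule maximal_coefficient_dvd[where z = y and c = c, OF Z B(1) y max that])
  then have "\<exists>e. \<forall>i<Suc r. c i = d * e i"
    by (intro choice) (auto simp: dvd_def)
  then obtain e where e: "\<And>i. i < Suc r \<Longrightarrow> c i = d * e i"
    by blast
  \<comment> \<open>All coefficients of the maximal relation are divisible by \<open>d\<close>, so
    the relation says that \<open>d\<close> annihilates the class of this element. As
    \<open>c 0 = d\<close>, it can replace \<open>y 0\<close>.\<close>
  define z1 where "z1 = y 0 + (\<Sum>i<r. e (Suc i) *s y (Suc i))"
  have yZ: "y i \<in> Z" if "i < Suc r" for i
    using y(1) that by (auto simp: generates_def)
  have rel: "d *s z1 \<in> B"
  proof -
    have "d *s z1 = c 0 *s y 0 + (\<Sum>i<r. c (Suc i) *s y (Suc i))"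
      using y(3) by (simp add: z1_def scale_right_distrib scale_sum_right e[of "Suc _"])
    then show ?thesis
      using y(2) by (simp add: sum.lessThan_Suc_shift del: sum.lessThan_Suc)
  qed
  have "generates Z B (Suc r) (y(0 := z1))"
  proof (rule generates_change[OF y(1)])
    have "z1 \<in> Z"
      unfolding z1_def by (intro subspace_add[OF Z] subspace_sum[OF Z] subspace_scale[OF Z] yZ) auto
    then show "y(0 := z1) ` {..<Suc r} \<subseteq> Z"
      using yZ by auto
    have base: "(y(0 := z1)) i \<in> span (B \<union> y(0 := z1) ` {..<Suc r})" if "i < Suc r" for i
      using that by (intro span_base) auto
    show "y ` {..<Suc r} \<subseteq> span (B \<union> y(0 := z1) ` {..<Suc r})"
    proof (rule image_subsetI)
      fix i assume i: "i \<in> {..<Suc r}"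
      show "y i \<in> span (B \<union> y(0 := z1) ` {..<Suc r})"
      proof (cases "i = 0")
        case True
        have "z1 - (\<Sum>i<r. e (Suc i) *s y (Suc i)) \<in> span (B \<union> y(0 := z1) ` {..<Suc r})"
        proof (intro span_diff span_sum span_scale)
          show "z1 \<in> span (B \<union> y(0 := z1) ` {..<Suc r})"
            using base[of 0] by simp
          show "y (Suc i) \<in> span (B \<union> y(0 := z1) ` {..<Suc r})" if "i \<in> {..<r}" for i
            using base[of "Suc i"] that by simp
        qed
        then show ?thesis
          using True by (simp add: z1_def)
      qed (use i base[of i] in auto)
    qed
  qed
  then have ex: "\<exists>z. generates Z B (Suc r) z \<and> z 0 = z1"
    by (intro exI[of _ "y(0 := z1)"]) auto
  show ?thesis
  proof (intro exI[of _ d] exI[of _ z1] conjI allI impI)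
    show "z1 \<in> Z" "d *s z1 \<in> B" "\<exists>z. generates Z B (Suc r) z \<and> z 0 = z1"
      using ex rel by (auto simp: generates_def)
    \<comment> \<open>The tuple \<open>z\<close> is arbitrary apart from its first entry, because
      the other generators will be exchanged in the induction of the structure theorem.\<close>
    fix z f i
    assume z: "generates Z B (Suc r) z" "z 0 = z1" "(\<Sum>i<Suc r. f i *s z i) \<in> B" and i: "i < Suc r"
    \<comment> \<open>Combining the given relation with \<open>d *s z1\<close> yields a relation
      with first coefficient a gcd of \<open>d\<close> and \<open>f 0\<close>; maximality applies to
      it.\<close>
    have first: "d dvd f 0"
    proof -
      obtain g u where g: "g = (\<Sum>j\<in>{True, False}. u j * (if j then d else f 0))"
          "\<And>j. j \<in> {True, False} \<Longrightarrow> g dvd (if j then d else f 0)"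
        using pid_bezout[of "{True, False}" "\<lambda>j. if j then d else f 0"] by blast
      let ?c = "\<lambda>i. u False * f i + (if i = 0 then u True * d else 0)"
      have "(\<Sum>i<Suc r. ?c i *s z i) = u False *s (\<Sum>i<Suc r. f i *s z i) + u True *s (d *s z1)"
        using z(2) by (simp add: scale_left_distrib sum.distrib scale_sum_right if_distrib[of "\<lambda>c. c *s _"]
            scale_right_distrib sum.lessThan_Suc_shift del: sum.lessThan_Suc cong: if_cong)
      also have "\<dots> \<in> B"
        by (intro subspace_add[OF B(1)] subspace_scale[OF B(1)] z(3) rel)
      finally have "?c 0 dvd d \<Longrightarrow> d dvd ?c 0"
        using max[rule_format, of z ?c] z(1) by blast
      moreover have c0: "?c 0 = g"
        using g(1) by (simp add: add.commute)
      ultimately have "d dvd g"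
        using g(2)[of True] unfolding c0 by simp
      then show ?thesis
        using g(2)[of False] by (auto intro: dvd_trans)
    qed
    \<comment> \<open>Since \<open>d\<close> divides \<open>f 0\<close>, a multiple of
      \<open>d *s z1\<close> corrects the first coefficient to \<open>d\<close> without affecting
      the others, and the relation becomes a maximal one.\<close>
    let ?c = "\<lambda>i. f i + (if i = 0 then d - f 0 else 0)"
    have "(\<Sum>i<Suc r. ?c i *s z i) = (\<Sum>i<Suc r. f i *s z i) + (d - f 0) *s z1"
      using z(2) by (simp add: scale_left_distrib sum.distrib if_distrib[of "\<lambda>c. c *s _"] cong: if_cong)
    moreover obtain h where "f 0 = d * h"
      using first by blast
    then have "(d - f 0) *s z1 = (1 - h) *s (d *s z1)"
      by (simp add: algebra_simps)
    ultimately have "(\<Sum>i<Suc r. ?c i *s z i) \<in> B"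
      using z(3) rel by (simp only: subspace_add[OF B(1)] subspace_scale[OF B(1)])
    from maximal_coefficient_dvd[where z = z and c = ?c, OF Z B(1) z(1) this _ max i]
    have "d dvd ?c i"
      by simp
    then show "d dvd f i"
      using first by (cases "i = 0") auto
  qed
qed

text \<open>Induction on the least number of generators: the cyclic summand with the largest
  annihilator ideal is split off, and the submodule generated by \<open>B\<close> and the remaining
  generators is treated next. Its number of generators is again least, since any shorter tuple could
  be extended by \<open>z1\<close>.\<close>

lemma structure_theorem_aux:
  assumes "subspace Z" "subspace B" "B \<subseteq> Z" "generates Z B r z" "\<And>r' z'. generates Z B r' z' \<Longrightarrow> r \<le> r'"
  shows "\<exists>ds zs. length ds = r \<and> generates Z B r zs \<and>
    (\<forall>c. (\<Sum>i<r. c i *s zs i) \<in> B \<longleftrightarrow> (\<forall>i<r. ds ! i dvd c i)) \<and>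
    (\<forall>i<r. \<not> ds ! i dvd 1) \<and> (\<forall>i. Suc i < r \<longrightarrow> ds ! i dvd ds ! Suc i)"
  using assms
proof (induction r arbitrary: Z z)
  case 0
  then show ?case
    by (auto simp: subspace_0)
next
  case (Suc r)
  obtain d z1 where z1: "z1 \<in> Z" "d *s z1 \<in> B"
    "\<forall>z c i. generates Z B (Suc r) z \<longrightarrow> z 0 = z1 \<longrightarrow> (\<Sum>i<Suc r. c i *s z i) \<in> B \<longrightarrow> i < Suc r \<longrightarrow> d dvd c i"
    "\<exists>z. generates Z B (Suc r) z \<and> z 0 = z1"
    using split_off_cyclic[OF Suc.prems(1-4)] by (elim exE conjE) blast
  then obtain y where y: "generates Z B (Suc r) y" "y 0 = z1"
    by blast
  let ?Z = "span (B \<union> (y \<circ> Suc) ` {..<r})"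
  have ZZ: "?Z \<subseteq> Z"
    using y(1) Suc.prems(3) by (intro span_minimal Suc.prems(1)) (auto simp: generates_def)
  have join: "generates Z B (Suc r') (case_nat z1 z')" if "generates ?Z B r' z'" for r' z'
  proof (rule generates_change[OF y(1)])
    have "z' i \<in> Z" if "i < r'" for i
      using \<open>generates ?Z B r' z'\<close> that ZZ by (auto simp: generates_def)
    then show "case_nat z1 z' ` {..<Suc r'} \<subseteq> Z"
      using z1(1) by (auto split: nat.splits)
    let ?S = "span (B \<union> case_nat z1 z' ` {..<Suc r'})"
    have "(\<lambda>i. z' i) ` {..<r'} \<subseteq> case_nat z1 z' ` {..<Suc r'}"
      by (auto intro!: image_eqI[of _ _ "Suc _"])
    then have "span (B \<union> z' ` {..<r'}) \<subseteq> ?S"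
      by (intro span_mono) auto
    then have Z: "?Z \<subseteq> ?S"
      using that by (auto simp: generates_def)
    show "y ` {..<Suc r} \<subseteq> ?S"
    proof (rule image_subsetI)
      fix i assume "i \<in> {..<Suc r}"
      show "y i \<in> ?S"
      proof (cases i)
        case 0
        then show ?thesis
          using y(2) by (auto intro!: span_base image_eqI[of _ _ "0::nat"])
      next
        case (Suc j)
        then have "y i \<in> ?Z"
          using \<open>i \<in> {..<Suc r}\<close> by (intro span_base) auto
        then show ?thesis
          using Z by blast
      qed
    qed
  qed
  have "\<exists>ds zs. length ds = r \<and> generates ?Z B r zs \<and>
    (\<forall>c. (\<Sum>i<r. c i *s zs i) \<in> B \<longleftrightarrow> (\<forall>i<r. ds ! i dvd c i)) \<and>
    (\<forall>i<r. \<not> ds ! i dvd 1) \<and> (\<forall>i. Suc i < r \<longrightarrow> ds ! i dvd ds ! Suc i)"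
  proof (rule Suc.IH)
    show "generates ?Z B r (y \<circ> Suc)"
      by (auto simp: generates_def intro: span_base)
    show "r \<le> r'" if "generates ?Z B r' z'" for r' z'
      using Suc.prems(5)[OF join[OF that]] by simp
  qed (auto intro: span_base Suc.prems)
  then obtain ds zs where ds: "length ds = r" "generates ?Z B r zs"
    "\<And>c. (\<Sum>i<r. c i *s zs i) \<in> B \<longleftrightarrow> (\<forall>i<r. ds ! i dvd c i)"
    "\<And>i. i < r \<Longrightarrow> \<not> ds ! i dvd 1" "\<And>i. Suc i < r \<Longrightarrow> ds ! i dvd ds ! Suc i"
    by blast
  have gen: "generates Z B (Suc r) (case_nat z1 zs)"
    by (rule join[OF ds(2)])
  have rel: "(\<Sum>i<Suc r. c i *s case_nat z1 zs i) \<in> B \<longleftrightarrow> (\<forall>i<Suc r. (d # ds) ! i dvd c i)" for c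
  proof -
    have sum: "(\<Sum>i<Suc r. c i *s case_nat z1 zs i) = c 0 *s z1 + (\<Sum>i<r. c (Suc i) *s zs i)"
      by (simp add: sum.lessThan_Suc_shift del: sum.lessThan_Suc)
    have z1B: "c 0 *s z1 \<in> B" if "d dvd c 0"
    proof -
      from that obtain e where "c 0 = d * e"
        by (elim dvdE)
      then have "c 0 *s z1 = e *s (d *s z1)"
        by (simp add: mult.commute)
      then show ?thesis
        using z1(2) Suc.prems(2) by (metis subspace_scale)
    qed
    show ?thesis
    proof
      assume *: "(\<Sum>i<Suc r. c i *s case_nat z1 zs i) \<in> B"
      have "d dvd c 0"
        using z1(3)[rule_format, OF gen _ *, of 0] by simp
      moreover have "(\<Sum>i<r. c (Suc i) *s zs i) \<in> B"
        using subspace_diff[OF Suc.prems(2) *[unfolded sum] z1B[OF calculation]] by simp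
      ultimately show "\<forall>i<Suc r. (d # ds) ! i dvd c i"
        using ds(3)[of "\<lambda>i. c (Suc i)"] by (auto simp: nth_Cons split: nat.splits)
    next
      assume *: "\<forall>i<Suc r. (d # ds) ! i dvd c i"
      then have "d dvd c 0"
        by auto
      moreover have "\<forall>i<r. ds ! i dvd c (Suc i)"
        using * by auto
      then have "(\<Sum>i<r. c (Suc i) *s zs i) \<in> B"
        using ds(3)[of "\<lambda>i. c (Suc i)"] by simp
      ultimately show "(\<Sum>i<Suc r. c i *s case_nat z1 zs i) \<in> B"
        unfolding sum using z1B Suc.prems(2) by (intro subspace_add)
    qed
  qed
  \<comment> \<open>If \<open>d\<close> were invertible, \<open>z1\<close> would lie in
    \<open>B\<close> and the other \<open>r\<close> elements would generate, against
    minimality.\<close>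
  have unit: "\<not> d dvd 1"
  proof
    assume "d dvd 1"
    then obtain e where "1 = d * e"
      by (elim dvdE)
    then have "1 = e * d"
      by (simp add: mult.commute)
    then have "z1 = e *s (d *s z1)"
      by (metis scale_one scale_scale)
    then have "z1 \<in> B"
      using z1(2) Suc.prems(2) by (metis subspace_scale)
    have "generates Z B r (y \<circ> Suc)"
    proof (rule generates_change[OF y(1)])
      show "(y \<circ> Suc) ` {..<r} \<subseteq> Z"
        using y(1) by (auto simp: generates_def)
      show "y ` {..<Suc r} \<subseteq> ?Z"
      proof (rule image_subsetI)
        fix i assume "i \<in> {..<Suc r}"
        then show "y i \<in> ?Z"
          using y(2) \<open>z1 \<in> B\<close> by (cases i) (auto intro!: span_base)
      qed
    qed
    then show False
      using Suc.prems(5) by fastforce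
  qed
  \<comment> \<open>The relation with the single coefficient \<open>ds ! 0\<close> at the first
    generator of the remaining summands is a relation of the whole tuple, and \<open>d\<close>
    divides all coefficients of such relations. The shift by \<open>z1\<close> puts this coefficient
    at index \<open>1\<close>.\<close>
  have dvd: "d dvd ds ! 0" if "0 < r"
  proof -
    let ?c = "\<lambda>i. if i = 1 then ds ! 0 else 0"
    have "\<forall>i<Suc r. (0 # ds) ! i dvd ?c i"
      by (auto simp: nth_Cons split: nat.splits)
    then have "(\<Sum>i<r. ?c (Suc i) *s zs i) \<in> B"
      unfolding ds(3) by (auto simp: nth_Cons split: nat.splits)
    then have "(\<Sum>i<Suc r. ?c i *s case_nat z1 zs i) \<in> B"
      by (simp add: sum.lessThan_Suc_shift del: sum.lessThan_Suc)
    from z1(3)[rule_format, OF gen _ this, of 1] that show ?thesis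
      by simp
  qed
  have "(d # ds) ! i dvd (d # ds) ! Suc i" if "Suc i < Suc r" for i
    using that ds(5) dvd by (cases i) auto
  moreover have "\<not> (d # ds) ! i dvd 1" if "i < Suc r" for i
    using that ds(4) unit by (cases i) auto
  ultimately show ?case
    using ds(1) gen rel by (intro exI[of _ "d # ds"] exI[of _ "case_nat z1 zs"]) auto
qed

theorem invariant_factors_exist:
  assumes "subspace Z" "subspace B" "B \<subseteq> Z" "fin_gen scale (Z, B)"
  shows "\<exists>ds. invariant_factors scale (Z, B) ds"
proof -
  obtain S where S: "finite S" "S \<subseteq> Z" "\<And>z. z \<in> Z \<Longrightarrow> \<exists>s\<in>span S. z - s \<in> B"
    using assms(4) by (auto simp: fin_gen_def)
  obtain f where f: "f ` {..<card S} = S"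
    using ex_bij_betw_nat_finite[OF S(1)] by (auto simp: bij_betw_def atLeast0LessThan)
  have "z \<in> span (B \<union> S)" if z: "z \<in> Z" for z
  proof -
    obtain s where s: "s \<in> span S" "z - s \<in> B"
      using S(3)[OF z] by blast
    have "(z - s) + s \<in> span (B \<union> S)"
      using s span_mono[of S "B \<union> S"] by (intro span_add) (auto intro: span_base)
    then show ?thesis
      by simp
  qed
  then have ex: "\<exists>r z. generates Z B r z"
    using S(2) f by (intro exI[of _ "card S"] exI[of _ f]) (auto simp: generates_def)
  \<comment> \<open>Minimality of the number of generators is what makes the resulting factors
    non-invertible.\<close>
  define r where "r = (LEAST r. \<exists>z. generates Z B r z)"
  from LeastI_ex[OF ex] obtain z where z: "generates Z B r z"
    by (auto simp: r_def)
  have least: "r \<le> r'" if "generates Z B r' z'" for r' z'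
    unfolding r_def using that by (intro Least_le) blast
  have "\<exists>ds zs. length ds = r \<and> generates Z B r zs \<and>
    (\<forall>c. (\<Sum>i<r. c i *s zs i) \<in> B \<longleftrightarrow> (\<forall>i<r. ds ! i dvd c i)) \<and>
    (\<forall>i<r. \<not> ds ! i dvd 1) \<and> (\<forall>i. Suc i < r \<longrightarrow> ds ! i dvd ds ! Suc i)"
    by (rule structure_theorem_aux[OF assms(1-3) z]) (rule least)
  then obtain ds zs where ds: "length ds = r" "generates Z B r zs"
    "\<forall>c. (\<Sum>i<r. c i *s zs i) \<in> B \<longleftrightarrow> (\<forall>i<r. ds ! i dvd c i)"
    "\<forall>i<r. \<not> ds ! i dvd 1" "\<forall>i. Suc i < r \<longrightarrow> ds ! i dvd ds ! Suc i"
    by blast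
  have sum: "(\<Sum>i<r. c i *s map zs [0..<r] ! i) = (\<Sum>i<r. c i *s zs i)" for c
    by simp
  have "\<exists>c. z - (\<Sum>i<r. c i *s zs i) \<in> B" if "z \<in> Z" for z
    using ds(2) span_Un_image[OF assms(2)] that by (auto simp: generates_def)
  then have "invariant_factors scale (Z, B) ds"
    unfolding invariant_factors_def using ds
    by (intro conjI exI[of _ "map zs [0..<r]"]) (auto simp: sum generates_def)
  then show ?thesis ..
qed

end

text \<open>A linear relation between the \<open>zs\<close> can be divided by the gcd of its coefficients; after that, the
  invariant factors would have to divide coefficients that generate the unit ideal.\<close>

lemma invariant_factors_independent:
  fixes zs :: "('e \<Rightarrow>\<^sub>0 'k::pid) list"
  assumes rel: "\<forall>c. (\<Sum>i<length ds. smul (c i) (zs ! i)) \<in> B \<longleftrightarrow> (\<forall>i<length ds. ds ! i dvd c i)"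
    and unit: "\<forall>i<length ds. \<not> ds ! i dvd 1"
    and chain: "\<forall>i. Suc i < length ds \<longrightarrow> ds ! i dvd ds ! Suc i"
    and "0 \<in> B" and c: "(\<Sum>i<length ds. smul (c i) (zs ! i)) = 0" and j: "j < length ds"
  shows "c j = 0"
proof (rule ccontr)
  assume "c j \<noteq> 0"
  obtain g u where g: "g = (\<Sum>i<length ds. u i * c i)" "\<And>i. i < length ds \<Longrightarrow> g dvd c i"
    using pid_bezout[of "{..<length ds}" c] by auto
  have "g \<noteq> 0"
    using g(2)[OF j] \<open>c j \<noteq> 0\<close> by auto
  have "\<exists>b. \<forall>i<length ds. c i = g * b i"
    using g(2) by (intro choice) (auto simp: dvd_def)
  then obtain b where b: "\<And>i. i < length ds \<Longrightarrow> c i = g * b i"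
    by blast
  have "g * (\<Sum>i<length ds. u i * b i) = g * 1"
    using g(1) by (simp add: b sum_distrib_left algebra_simps)
  then have one: "(\<Sum>i<length ds. u i * b i) = 1"
    using \<open>g \<noteq> 0\<close> by (simp only: mult_cancel_left) simp
  \<comment> \<open>Cancelling \<open>g\<close> is possible because a free module over a domain is
    torsion free.\<close>
  have "(\<Sum>i<length ds. smul (b i) (zs ! i)) = 0"
  proof (rule poly_mapping_eqI)
    fix e
    have "g * Poly_Mapping.lookup (\<Sum>i<length ds. smul (b i) (zs ! i)) e
        = Poly_Mapping.lookup (\<Sum>i<length ds. smul (c i) (zs ! i)) e"
      by (simp add: lookup_sum lookup_smul sum_distrib_left b mult.assoc)
    then show "Poly_Mapping.lookup (\<Sum>i<length ds. smul (b i) (zs ! i)) e = Poly_Mapping.lookup 0 e"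
      using c \<open>g \<noteq> 0\<close> by simp
  qed
  then have db: "\<forall>i<length ds. ds ! i dvd b i"
    using rel \<open>0 \<in> B\<close> by metis
  have "ds ! 0 dvd ds ! i" if "i < length ds" for i
    using that
  proof (induction i)
    case (Suc i)
    then show ?case
      using chain by (auto intro: dvd_trans)
  qed simp
  then have "ds ! 0 dvd (\<Sum>i<length ds. u i * b i)"
    using db by (intro dvd_sum dvd_mult) (auto intro: dvd_trans)
  then show False
    using unit j one by (metis gr_zeroI not_less0)
qed

text \<open>Gaussian elimination without division, by induction on the coordinates: cross
  multiplication with a pivot vector \<open>v k\<close> kills the coordinate \<open>s\<close> of all
  others. It costs one vector and one coordinate.\<close>

lemma too_many_vectors_dependent:
  fixes v :: "'i \<Rightarrow> ('e \<Rightarrow>\<^sub>0 'k::idom)"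
  assumes "finite S" "finite I" "\<forall>i\<in>I. Poly_Mapping.keys (v i) \<subseteq> S" "card S < card I"
  shows "\<exists>c. (\<exists>i\<in>I. c i \<noteq> 0) \<and> (\<Sum>i\<in>I. smul (c i) (v i)) = 0"
  using assms
proof (induction S arbitrary: I v rule: finite_induct)
  case empty
  then have "I \<noteq> {}" "\<forall>i\<in>I. v i = 0"
    by (auto simp flip: lookup_eq_zero_in_keys_contradict intro!: poly_mapping_eqI simp: in_keys_iff)
  then show ?case
    by (intro exI[of _ "\<lambda>_. 1"]) (auto simp: lookup_smul lookup_sum intro!: poly_mapping_eqI)
next
  case (insert s S)
  show ?case
  proof (cases "\<exists>i\<in>I. Poly_Mapping.lookup (v i) s \<noteq> 0")
    case False
    then have "\<forall>i\<in>I. s \<notin> Poly_Mapping.keys (v i)"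
      by (simp add: in_keys_iff)
    then have "\<forall>i\<in>I. Poly_Mapping.keys (v i) \<subseteq> S"
      using insert.prems(2) by blast
    then show ?thesis
      using insert.prems insert.hyps insert.IH[of I v] by simp
  next
    case True
    then obtain k where k: "k \<in> I" "Poly_Mapping.lookup (v k) s \<noteq> 0"
      by blast
    define w where "w i = smul (Poly_Mapping.lookup (v k) s) (v i) - smul (Poly_Mapping.lookup (v i) s) (v k)" for i
    have "\<forall>i\<in>I - {k}. Poly_Mapping.keys (w i) \<subseteq> S"
    proof (intro ballI subsetI)
      fix i e
      assume i: "i \<in> I - {k}" and e: "e \<in> Poly_Mapping.keys (w i)"
      have "e \<noteq> s"
        using e by (auto simp: w_def in_keys_iff lookup_minus lookup_smul mult.commute)
      moreover have "e \<in> Poly_Mapping.keys (v i) \<union> Poly_Mapping.keys (v k)"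
        using e by (auto simp: w_def in_keys_iff lookup_minus lookup_smul)
      ultimately show "e \<in> S"
        using insert.prems(2) i k(1) by blast
    qed
    moreover have "card S < card (I - {k})"
      using insert.prems insert.hyps k(1) by simp
    ultimately obtain c where c: "\<exists>i\<in>I - {k}. c i \<noteq> 0" "(\<Sum>i\<in>I - {k}. smul (c i) (w i)) = 0"
      using insert.IH[of "I - {k}" w] insert.prems(1) by auto
    \<comment> \<open>These are the coefficients after inserting the definition of \<open>w\<close>.
      Those with \<open>i \<noteq> k\<close> are multiplied by the pivot entry, so a nonzero one
      stays nonzero in a domain.\<close>
    let ?c = "\<lambda>i. if i = k then - (\<Sum>i\<in>I - {k}. c i * Poly_Mapping.lookup (v i) s)
      else c i * Poly_Mapping.lookup (v k) s"
    have "(\<Sum>i\<in>I. smul (?c i) (v i)) = (\<Sum>i\<in>I - {k}. smul (c i) (w i))"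
    proof (rule poly_mapping_eqI)
      fix e
      show "Poly_Mapping.lookup (\<Sum>i\<in>I. smul (?c i) (v i)) e = Poly_Mapping.lookup (\<Sum>i\<in>I - {k}. smul (c i) (w i)) e"
        using sum.remove[OF insert.prems(1) k(1), of "\<lambda>i. ?c i * Poly_Mapping.lookup (v i) e"]
        by (simp add: lookup_sum lookup_smul w_def lookup_minus algebra_simps sum_subtractf sum_distrib_left)
    qed
    then show ?thesis
      using c k by (intro exI[of _ ?c]) auto
  qed
qed

section \<open>Transport and zero entries of lists of invariant factors\<close>

lemma invariant_factorsE:
  assumes "invariant_factors sc (Z, B) ds"
  obtains zs where "length zs = length ds" "set zs \<subseteq> Z"
    "\<forall>z\<in>Z. \<exists>c. z - (\<Sum>i<length ds. sc (c i) (zs ! i)) \<in> B"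
    "\<forall>c. (\<Sum>i<length ds. sc (c i) (zs ! i)) \<in> B \<longleftrightarrow> (\<forall>i<length ds. ds ! i dvd c i)"
    "\<forall>i<length ds. \<not> ds ! i dvd 1" "\<forall>i. Suc i < length ds \<longrightarrow> ds ! i dvd ds ! Suc i"
  using assms unfolding invariant_factors_def fst_conv snd_conv by blast

text \<open>The hypotheses make \<open>f\<close> induce an isomorphism from \<open>Z / B\<close>
  onto \<open>Z' / B'\<close>, so the images of the cyclic generators have the same annihilators.
  The list is preserved literally and not only up to units, which suits a list fixed by a
  choice.\<close>

lemma invariant_factors_transfer:
  fixes sc :: "'k::comm_ring_1 \<Rightarrow> 'm::ab_group_add \<Rightarrow> 'm" and sc' :: "'k \<Rightarrow> 'n::ab_group_add \<Rightarrow> 'n"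
  assumes inv: "invariant_factors sc (Z, B) ds" and m: "module sc" "module.subspace sc Z" "module_hom sc sc' f"
    and Z': "\<And>z. z \<in> Z \<Longrightarrow> f z \<in> Z'"
    and B': "\<And>z. z \<in> Z \<Longrightarrow> f z \<in> B' \<longleftrightarrow> z \<in> B" "module.subspace sc' B'"
    and surj: "\<And>z'. z' \<in> Z' \<Longrightarrow> \<exists>z\<in>Z. z' - f z \<in> B'"
    and BZ: "B \<subseteq> Z"
  shows "invariant_factors sc' (Z', B') ds"
proof -
  interpret module_hom sc sc' f by fact
  from inv obtain zs where zs: "length zs = length ds" "set zs \<subseteq> Z"
    "\<forall>z\<in>Z. \<exists>c. z - (\<Sum>i<length ds. sc (c i) (zs ! i)) \<in> B"
    "\<forall>c. (\<Sum>i<length ds. sc (c i) (zs ! i)) \<in> B \<longleftrightarrow> (\<forall>i<length ds. ds ! i dvd c i)"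
    and ds: "\<forall>i<length ds. \<not> ds ! i dvd 1" "\<forall>i. Suc i < length ds \<longrightarrow> ds ! i dvd ds ! Suc i"
    by (rule invariant_factorsE)
  have hom: "(\<Sum>i<length ds. sc' (c i) (map f zs ! i)) = f (\<Sum>i<length ds. sc (c i) (zs ! i))" for c
    using zs(1) by (simp add: sum scale)
  have Z: "(\<Sum>i<length ds. sc (c i) (zs ! i)) \<in> Z" for c
    using zs(1,2) by (intro m1.subspace_sum[OF m(2)] m1.subspace_scale[OF m(2)]) auto
  have "\<exists>c. z' - f (\<Sum>i<length ds. sc (c i) (zs ! i)) \<in> B'" if z': "z' \<in> Z'" for z'
  proof -
    obtain z where z: "z \<in> Z" "z' - f z \<in> B'"
      using surj[OF z'] by blast
    obtain c where c: "z - (\<Sum>i<length ds. sc (c i) (zs ! i)) \<in> B"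
      using zs(3) z(1) by blast
    then have "f (z - (\<Sum>i<length ds. sc (c i) (zs ! i))) \<in> B'"
      using B'(1) BZ by blast
    from m2.subspace_add[OF B'(2) z(2) this] show ?thesis
      by (auto simp: diff)
  qed
  then have "\<forall>z'\<in>Z'. \<exists>c. z' - (\<Sum>i<length ds. sc' (c i) (map f zs ! i)) \<in> B'"
    unfolding hom by blast
  moreover have "\<forall>c. (\<Sum>i<length ds. sc' (c i) (map f zs ! i)) \<in> B' \<longleftrightarrow> (\<forall>i<length ds. ds ! i dvd c i)"
    by (simp add: hom B'(1)[OF Z] zs(4) del: nth_map)
  moreover have "length (map f zs) = length ds" "set (map f zs) \<subseteq> Z'"
    using zs(1,2) Z' by auto
  ultimately show ?thesis
    using ds unfolding invariant_factors_def fst_conv snd_conv by blast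
qed

text \<open>The number that \<open>rel\<close> computes from its chosen list, made available for an
  arbitrary list. Positions count from 1, whence the \<open>s - 1\<close>.\<close>

definition nonzero_length :: "'k::zero list \<Rightarrow> nat" where
  "nonzero_length ds = Max (insert 0 {s. 1 \<le> s \<and> s \<le> length ds \<and> ds ! (s - 1) \<noteq> 0})"

text \<open>Zero divides only zero, so in a divisibility chain the zeros form a final segment. The
  1-based maximum is thus the number of nonzero entries.\<close>

lemma invariant_factor_nonzero_iff:
  fixes ds :: "'k::comm_ring_1 list"
  assumes chain: "\<forall>i. Suc i < length ds \<longrightarrow> ds ! i dvd ds ! Suc i" and i: "i < length ds"
  shows "ds ! i \<noteq> 0 \<longleftrightarrow> i < nonzero_length ds"
proof -
  let ?S = "insert 0 {s. 1 \<le> s \<and> s \<le> length ds \<and> ds ! (s - 1) \<noteq> 0}"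
  have "finite ?S"
    by (rule finite_subset[of _ "{..length ds}"]) auto
  have mono: "j < length ds \<Longrightarrow> i \<le> j \<Longrightarrow> ds ! i dvd ds ! j" for i j
  proof (induction j)
    case (Suc j)
    then show ?case
      using chain by (cases "i = Suc j") (auto intro: dvd_trans)
  qed simp
  show ?thesis
    unfolding nonzero_length_def
  proof
    assume "ds ! i \<noteq> 0"
    then have "Suc i \<in> ?S"
      using i by auto
    from Max_ge[OF \<open>finite ?S\<close> this] show "i < Max ?S"
      by simp
  next
    assume less: "i < Max ?S"
    have "Max ?S \<in> ?S"
      by (rule Max_in[OF \<open>finite ?S\<close>]) simp
    then have "Max ?S \<le> length ds" "ds ! (Max ?S - 1) \<noteq> 0"
      using less by auto
    moreover have "i \<le> Max ?S - 1" "Max ?S - 1 < length ds"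
      using less calculation(1) i by linarith+
    then have "ds ! i dvd ds ! (Max ?S - 1)"
      by (intro mono)
    ultimately show "ds ! i \<noteq> 0"
      by auto
  qed
qed

lemma nonzero_length_le: "nonzero_length ds \<le> length ds"
  unfolding nonzero_length_def by (rule Max.boundedI) (auto intro: finite_subset[of _ "{..length ds}"])

section \<open>Graded algebras\<close>

context graded_algebra
begin

text \<open>The component of degree \<open>n\<close>. The choice does not involve \<open>n\<close>,
  so that all components of \<open>a\<close> come from one and the same decomposition; by
  \<open>cmp_unique\<close> it is the only one.\<close>

definition cmp :: "'g \<Rightarrow> 'a \<Rightarrow> 'a" where
  "cmp n a = (SOME f. (\<forall>n. f n \<in> gr n) \<and> finite {n. f n \<noteq> 0} \<and> a = (\<Sum>n | f n \<noteq> 0. f n)) n"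

text \<open>Projections onto sets of degrees are required since the equation
  \<open>m + l = n\<close> may have several solutions \<open>m\<close> in \<open>G\<close>.\<close>

definition pr :: "'g set \<Rightarrow> 'a \<Rightarrow> 'a" where
  "pr S a = (\<Sum>n\<in>{n. cmp n a \<noteq> 0} \<inter> S. cmp n a)"

definition grS :: "'g set \<Rightarrow> 'a set" where
  "grS S = {a. \<forall>n. n \<notin> S \<longrightarrow> cmp n a = 0}"

lemma zero_in_gr: "0 \<in> gr n"
  using subspace_gr by (rule subspace_0)

lemma cmp_ex: "\<exists>f. (\<forall>n. f n \<in> gr n) \<and> finite {n. f n \<noteq> 0} \<and> a = (\<Sum>n | f n \<noteq> 0. f n)"
proof -
  obtain S f where S: "finite S" "\<forall>n\<in>S. f n \<in> gr n" "a = (\<Sum>n\<in>S. f n)"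
    using gr_sum by blast
  let ?f = "\<lambda>n. if n \<in> S then f n else 0"
  have "finite {n. ?f n \<noteq> 0}"
    by (rule finite_subset[OF _ S(1)]) auto
  moreover have "(\<Sum>n | ?f n \<noteq> 0. ?f n) = (\<Sum>n\<in>S. f n)"
    using S(1) by (intro sum.mono_neutral_cong_left) auto
  ultimately show ?thesis
    using S zero_in_gr by (intro exI[of _ ?f]) simp
qed

lemma cmp_props: "cmp n a \<in> gr n" "finite {n. cmp n a \<noteq> 0}" "(\<Sum>n | cmp n a \<noteq> 0. cmp n a) = a"
proof -
  have *: "(\<forall>n. cmp n a \<in> gr n) \<and> finite {n. cmp n a \<noteq> 0} \<and> a = (\<Sum>n | cmp n a \<noteq> 0. cmp n a)"
    unfolding cmp_def by (rule someI_ex[OF cmp_ex])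
  from * show "cmp n a \<in> gr n" "finite {n. cmp n a \<noteq> 0}"
    by blast+
  from * show "(\<Sum>n | cmp n a \<noteq> 0. cmp n a) = a"
    by (elim conjE) (rule sym)
qed

lemma sum_cmp: "finite S \<Longrightarrow> {n. cmp n a \<noteq> 0} \<subseteq> S \<Longrightarrow> (\<Sum>n\<in>S. cmp n a) = a"
  by (rule trans[OF sum.mono_neutral_right cmp_props(3)]) auto

lemma cmp_unique:
  assumes "\<And>n. f n \<in> gr n" "finite S" "\<And>n. n \<notin> S \<Longrightarrow> f n = 0" "a = (\<Sum>n\<in>S. f n)"
  shows "cmp n a = f n"
proof -
  let ?S = "insert n ({n. cmp n a \<noteq> 0} \<union> S)"
  have fin: "finite ?S"
    using assms(2) cmp_props(2) by blast
  have "(\<Sum>n\<in>?S. f n) = a"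
    by (subst assms(4), rule sum.mono_neutral_right[OF fin]) (use assms(3) in auto)
  moreover have "(\<Sum>n\<in>?S. cmp n a) = a"
    by (rule sum_cmp[OF fin]) blast
  ultimately have "(\<Sum>n\<in>?S. cmp n a - f n) = 0"
    by (simp add: sum_subtractf)
  from gr_direct[OF fin _ this, of n] have "cmp n a - f n = 0"
    using assms(1) cmp_props(1) by (auto intro: subspace_diff[OF subspace_gr])
  then show ?thesis
    by simp
qed

lemma cmp_add: "cmp n (a + b) = cmp n a + cmp n b"
proof (rule cmp_unique[where S = "{n. cmp n a \<noteq> 0} \<union> {n. cmp n b \<noteq> 0}"])
  show "a + b = (\<Sum>n\<in>{n. cmp n a \<noteq> 0} \<union> {n. cmp n b \<noteq> 0}. cmp n a + cmp n b)"
    by (simp add: sum.distrib sum_cmp cmp_props(2))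
qed (auto intro: subspace_add[OF subspace_gr] cmp_props)

lemma cmp_scale: "cmp n (scale c a) = scale c (cmp n a)"
proof (rule cmp_unique[where S = "{n. cmp n a \<noteq> 0}"])
  show "scale c a = (\<Sum>n\<in>{n. cmp n a \<noteq> 0}. scale c (cmp n a))"
    by (simp add: scale_sum_right[symmetric] sum_cmp cmp_props(2))
qed (auto intro: subspace_scale[OF subspace_gr] cmp_props)

lemma cmp_gr: "a \<in> gr m \<Longrightarrow> cmp n a = (if n = m then a else 0)"
  by (rule cmp_unique[where S = "{m}" and f = "\<lambda>n. if n = m then a else 0"]) (auto simp: zero_in_gr)

lemma cmp_zero [simp]: "cmp n 0 = 0"
  using cmp_gr[OF zero_in_gr] by simp

lemma cmp_uminus: "cmp n (- a) = - cmp n a"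
  using cmp_add[of n a "- a"] by (simp add: eq_neg_iff_add_eq_0 add.commute)

lemma cmp_diff: "cmp n (a - b) = cmp n a - cmp n b"
  using cmp_add[of n a "- b"] by (simp add: cmp_uminus)

lemma cmp_sum: "cmp n (\<Sum>i\<in>S. f i) = (\<Sum>i\<in>S. cmp n (f i))"
  by (induction S rule: infinite_finite_induct) (auto simp: cmp_add)

lemma cmp_eqI: "(\<And>n. cmp n a = cmp n b) \<Longrightarrow> a = b"
  by (rule trans[OF cmp_props(3)[symmetric] trans[OF _ cmp_props(3)]]) simp

lemma homogeneous_induct [case_names homogeneous add]:
  assumes "\<And>n x. x \<in> gr n \<Longrightarrow> P x" "\<And>x y. P x \<Longrightarrow> P y \<Longrightarrow> P (x + y)"
  shows "P a"
proof -
  have "P (\<Sum>n\<in>S. cmp n a)" if "finite S" for S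
    using that by (induction S) (auto intro: assms cmp_props zero_in_gr)
  from this[OF cmp_props(2)[of a]] show ?thesis
    by (simp add: cmp_props(3))
qed

lemma cmp_pr: "cmp n (pr S a) = (if n \<in> S then cmp n a else 0)"
proof -
  have "cmp n (pr S a) = (\<Sum>m\<in>{n. cmp n a \<noteq> 0} \<inter> S. if n = m then cmp m a else 0)"
    unfolding pr_def cmp_sum by (intro sum.cong refl cmp_gr cmp_props)
  then show ?thesis
    using cmp_props(2)[of a] by (auto simp: sum.delta)
qed

lemma pr_add: "pr S (a + b) = pr S a + pr S b"
  by (rule cmp_eqI) (simp add: cmp_pr cmp_add)

lemma pr_zero [simp]: "pr S 0 = 0"
  by (rule cmp_eqI) (simp add: cmp_pr)

lemma pr_sum: "pr S (\<Sum>i\<in>I. f i) = (\<Sum>i\<in>I. pr S (f i))"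
  by (induction I rule: infinite_finite_induct) (auto simp: pr_add)

lemma pr_scale: "pr S (scale c a) = scale c (pr S a)"
  by (rule cmp_eqI) (simp add: cmp_pr cmp_scale)

lemma pr_gr: "a \<in> gr n \<Longrightarrow> pr S a = (if n \<in> S then a else 0)"
  by (rule cmp_eqI) (simp add: cmp_pr cmp_gr)

lemma pr_in_grS: "pr S a \<in> grS S"
  by (simp add: grS_def cmp_pr)

lemma pr_grS: "a \<in> grS S \<Longrightarrow> pr S a = a"
  by (rule cmp_eqI) (auto simp: grS_def cmp_pr)

lemma gr_grS: "a \<in> gr n \<Longrightarrow> n \<in> S \<Longrightarrow> a \<in> grS S"
  by (auto simp: grS_def cmp_gr)

lemma grS_singleton: "grS {n} = gr n"
proof (intro equalityI subsetI)
  fix a assume "a \<in> grS {n}"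
  then have "a = cmp n a"
    by - (rule cmp_eqI, auto simp: grS_def cmp_gr[OF cmp_props(1)])
  then show "a \<in> gr n"
    by (metis cmp_props(1))
qed (simp add: gr_grS)

lemma subspace_grS: "subspace (grS S)"
  by (rule subspaceI) (auto simp: grS_def cmp_add cmp_scale)

lemma span_gr: "span (\<Union>n\<in>S. gr n) = grS S"
proof
  show "span (\<Union>n\<in>S. gr n) \<subseteq> grS S"
    by (rule span_minimal) (auto simp: subspace_grS gr_grS)
  show "grS S \<subseteq> span (\<Union>n\<in>S. gr n)"
  proof
    fix a assume "a \<in> grS S"
    then have "(\<Sum>n | cmp n a \<noteq> 0. cmp n a) \<in> span (\<Union>n\<in>S. gr n)"
      by (intro span_sum span_base) (auto simp: grS_def intro: cmp_props)
    then show "a \<in> span (\<Union>n\<in>S. gr n)"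
      by (simp add: cmp_props)
  qed
qed

lemma grS_mult:
  assumes "a \<in> grS S" "b \<in> grS S'" "\<And>m l. m \<in> S \<Longrightarrow> l \<in> S' \<Longrightarrow> m + l \<in> U"
  shows "a * b \<in> grS U"
proof -
  have "(\<Sum>m | cmp m a \<noteq> 0. cmp m a) * (\<Sum>l | cmp l b \<noteq> 0. cmp l b) \<in> grS U"
    unfolding sum_product
  proof (intro subspace_sum[OF subspace_grS])
    fix m l assume "m \<in> {m. cmp m a \<noteq> 0}" "l \<in> {l. cmp l b \<noteq> 0}"
    then have "m + l \<in> U"
      using assms by (auto simp: grS_def)
    then show "cmp m a * cmp l b \<in> grS U"
      by (rule gr_grS[OF mult_gr[OF cmp_props(1) cmp_props(1)]])
  qed
  then show ?thesis
    by (simp add: cmp_props)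
qed

text \<open>For \<open>l\<close> in \<open>S\<close>, whether \<open>m + l\<close> lies in
  \<open>U\<close> depends on \<open>m\<close> only. This is the situation of a coefficient of a
  homogeneous element of a free module, where \<open>S\<close> and \<open>U\<close> consist of the
  degrees that add up with the degree of a basis element to given values.\<close>

lemma pr_mult_right:
  assumes b: "b \<in> grS S" and U: "\<And>m l. l \<in> S \<Longrightarrow> m + l \<in> U \<longleftrightarrow> m \<in> V"
  shows "pr U (a * b) = pr V a * b"
proof (induction a rule: homogeneous_induct)
  case (homogeneous m a)
  have a: "a \<in> grS {m}"
    by (simp add: grS_singleton homogeneous)
  have ab: "a * b \<in> grS {m + l |l. l \<in> S}"
    by (rule grS_mult[OF a b]) auto
  show ?case
  proof (cases "m \<in> V")
    case True
    then have "a * b \<in> grS U"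
      using U by (intro grS_mult[OF a b]) auto
    then show ?thesis
      using True by (simp add: pr_grS pr_gr[OF homogeneous])
  next
    case False
    have "cmp n (a * b) = 0" if "n \<in> U" for n
    proof (rule ccontr)
      assume "cmp n (a * b) \<noteq> 0"
      then have "n \<in> {m + l |l. l \<in> S}"
        using ab unfolding grS_def by blast
      then show False
        using that False U by blast
    qed
    then have "pr U (a * b) = 0"
      by - (rule cmp_eqI, simp add: cmp_pr)
    then show ?thesis
      using False by (simp add: pr_gr[OF homogeneous])
  qed
next
  case (add x y)
  then show ?case
    by (simp add: distrib_right pr_add)
qed

end

section \<open>Connected algebras and the augmentation\<close>

context connected_graded_algebra
begin

abbreviation \<epsilon> :: "'a \<Rightarrow> 'k" where
  "\<epsilon> \<equiv> aug scale gr deg"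

lemma zgr_eq: "zgr scale gr deg j = grS {n. deg n = j}"
  by (simp add: zgr_def span_gr)

text \<open>In the case \<open>deg n = 0\<close> an element of \<open>gr n\<close> is a multiple of
  \<open>1\<close> and hence also in \<open>gr 0\<close>; as the sum of the components is direct, it
  vanishes for \<open>n \<noteq> 0\<close>.\<close>

lemma gr_nonpos:
  assumes "a \<in> gr n" "deg n \<le> 0" "n \<noteq> 0"
  shows "a = 0"
proof (cases "deg n < 0")
  case True
  have "a \<in> zgr scale gr deg (deg n)"
    using assms(1) by (auto simp: zgr_eq intro: gr_grS)
  then show ?thesis
    by (simp add: zgr_neg[OF True])
next
  case False
  then have "a \<in> zgr scale gr deg 0"
    using assms by (auto simp: zgr_eq intro: gr_grS)
  then obtain c where "a = scale c 1"
    by (auto simp: zgr_zero)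
  then have "a \<in> gr 0"
    using one_gr subspace_scale[OF subspace_gr] by simp
  then show ?thesis
    using cmp_gr[of a 0 n] cmp_gr[OF assms(1), of n] assms(3) by simp
qed

lemma cmp_nonpos: "deg n \<le> 0 \<Longrightarrow> n \<noteq> 0 \<Longrightarrow> cmp n a = 0"
  by (rule gr_nonpos[OF cmp_props(1)])

lemma scale_one_inject: "scale c 1 = scale c' 1 \<longleftrightarrow> c = c'"
  using scale_one_eq_zero[of "c - c'"] by (auto simp: scale_left_diff_distrib)

lemma scale_one_gr: "scale c 1 \<in> gr 0"
  using one_gr subspace_scale[OF subspace_gr] by blast

text \<open>Components with \<open>n \<noteq> 0\<close> and \<open>deg n = 0\<close> are zero, so
  omitting the integer degree \<open>0\<close> is the same as omitting the degree \<open>0\<close>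
  of \<open>G\<close>. This ties the augmentation to the component \<open>cmp 0\<close>.\<close>

lemma aug_span: "span (\<Union>j\<in>{j. j \<noteq> 0}. zgr scale gr deg j) = grS {n. n \<noteq> 0}"
proof
  show "span (\<Union>j\<in>{j. j \<noteq> 0}. zgr scale gr deg j) \<subseteq> grS {n. n \<noteq> 0}"
    by (rule span_minimal) (auto simp: subspace_grS zgr_eq, auto simp: grS_def deg_zero)
  show "grS {n. n \<noteq> 0} \<subseteq> span (\<Union>j\<in>{j. j \<noteq> 0}. zgr scale gr deg j)"
  proof
    fix a assume a: "a \<in> grS {n. n \<noteq> 0}"
    have "(\<Sum>n | cmp n a \<noteq> 0. cmp n a) \<in> span (\<Union>j\<in>{j. j \<noteq> 0}. zgr scale gr deg j)"
    proof (intro span_sum span_base)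
      fix n assume n: "n \<in> {n. cmp n a \<noteq> 0}"
      with a have "n \<noteq> 0"
        by (auto simp: grS_def)
      with n have "deg n \<noteq> 0"
        using cmp_nonpos[of n a] by auto
      then show "cmp n a \<in> (\<Union>j\<in>{j. j \<noteq> 0}. zgr scale gr deg j)"
        using gr_grS[OF cmp_props(1)] by (auto simp: zgr_eq)
    qed
    then show "a \<in> span (\<Union>j\<in>{j. j \<noteq> 0}. zgr scale gr deg j)"
      by (simp add: cmp_props)
  qed
qed

lemma cmp_zero_eq: "cmp 0 a = scale (\<epsilon> a) 1"
proof -
  have "cmp 0 a \<in> zgr scale gr deg 0"
    unfolding zgr_eq by (rule gr_grS[OF cmp_props(1)]) (simp add: deg_zero)
  then obtain c where c: "cmp 0 a = scale c 1"
    by (auto simp: zgr_zero)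
  have "a - scale c' 1 \<in> grS {n. n \<noteq> 0} \<longleftrightarrow> c' = c" for c'
    by (auto simp: grS_def cmp_diff cmp_gr[OF scale_one_gr] c scale_one_inject)
  then have "\<epsilon> a = c"
    unfolding aug_def aug_span by simp
  then show ?thesis
    by (simp add: c)
qed

lemma aug_eqI: "cmp 0 a = scale c 1 \<Longrightarrow> \<epsilon> a = c"
  by (simp add: cmp_zero_eq scale_one_inject)

lemma aug_add: "\<epsilon> (a + b) = \<epsilon> a + \<epsilon> b"
  by (rule aug_eqI) (simp add: cmp_add cmp_zero_eq scale_left_distrib)

lemma aug_scale: "\<epsilon> (scale c a) = c * \<epsilon> a"
  by (rule aug_eqI) (simp add: cmp_scale cmp_zero_eq)

lemma aug_zero [simp]: "\<epsilon> 0 = 0"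
  by (rule aug_eqI) simp

lemma aug_one [simp]: "\<epsilon> 1 = 1"
  by (rule aug_eqI) (simp add: cmp_gr[OF one_gr])

lemma aug_uminus: "\<epsilon> (- a) = - \<epsilon> a"
  using aug_add[of a "- a"] by (simp add: eq_neg_iff_add_eq_0 add.commute)

lemma aug_diff: "\<epsilon> (a - b) = \<epsilon> a - \<epsilon> b"
  using aug_add[of a "- b"] by (simp add: aug_uminus)

lemma aug_sum: "\<epsilon> (\<Sum>i\<in>S. f i) = (\<Sum>i\<in>S. \<epsilon> (f i))"
  by (induction S rule: infinite_finite_induct) (auto simp: aug_add)

lemma aug_gr: "a \<in> gr n \<Longrightarrow> n \<noteq> 0 \<Longrightarrow> \<epsilon> a = 0"
  by (rule aug_eqI) (simp add: cmp_gr)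

lemma aug_pr: "\<epsilon> (pr S a) = (if 0 \<in> S then \<epsilon> a else 0)"
  by (rule aug_eqI) (simp add: cmp_pr cmp_zero_eq)

lemma aug_mult: "\<epsilon> (a * b) = \<epsilon> a * \<epsilon> b"
proof (induction a rule: homogeneous_induct)
  case (homogeneous m a)
  show ?case
  proof (induction b rule: homogeneous_induct)
    case (homogeneous l b)
    note a = \<open>a \<in> gr m\<close> and b = homogeneous
    show ?case
    proof (cases "m = 0")
      case True
      then have "a = scale (\<epsilon> a) 1"
        using a cmp_zero_eq[of a] by (simp add: cmp_gr)
      then have "a * b = scale (\<epsilon> a) b"
        by (metis scale_mult_left mult_1)
      then show ?thesis
        by (simp add: aug_scale)
    next
      case False
      \<comment> \<open>\<open>G\<close> may contain invertible elements, so
        \<open>m + l = 0\<close> can occur with \<open>m \<noteq> 0\<close>. Then one of the two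
        nonzero degrees has nonpositive integer degree, and its factor vanishes.\<close>
      have "\<epsilon> (a * b) = 0"
      proof (cases "m + l = 0")
        case True
        then have "deg m + deg l = 0"
          using deg_add[of m l] by (simp add: deg_zero)
        then have "a = 0 \<or> b = 0"
          using False True gr_nonpos[OF a] gr_nonpos[OF b] by (cases "deg m \<le> 0"; cases "l = 0") auto
        then show ?thesis
          by auto
      qed (rule aug_gr[OF mult_gr[OF a b]])
      then show ?thesis
        using False by (simp add: aug_gr[OF a])
    qed
  qed (simp add: distrib_left aug_add)
qed (simp add: distrib_right aug_add)

end

section \<open>Free modules\<close>

abbreviation lookup :: "('b \<Rightarrow>\<^sub>0 'c::zero) \<Rightarrow> 'b \<Rightarrow> 'c" where
  "lookup \<equiv> Poly_Mapping.lookup"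

abbreviation keys :: "('b \<Rightarrow>\<^sub>0 'c::zero) \<Rightarrow> 'b set" where
  "keys \<equiv> Poly_Mapping.keys"

abbreviation single :: "'b \<Rightarrow> 'c \<Rightarrow> ('b \<Rightarrow>\<^sub>0 'c::zero)" where
  "single \<equiv> Poly_Mapping.single"

interpretation sm: module "smul :: 'k::comm_ring_1 \<Rightarrow> ('e \<Rightarrow>\<^sub>0 'k) \<Rightarrow> ('e \<Rightarrow>\<^sub>0 'k)"
  by (rule module_smul)

lemma pm_expand:
  assumes "finite S" "keys f \<subseteq> S"
  shows "f = (\<Sum>e\<in>S. single e (lookup f e))"
proof (rule poly_mapping_eqI)
  fix e
  have "(\<Sum>i\<in>S. (lookup f i when i = e)) = (if e \<in> S then lookup f e else 0)"
    using assms(1) by (simp add: when_def)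
  then show "lookup f e = lookup (\<Sum>e\<in>S. single e (lookup f e)) e"
    using assms(2) by (auto simp: lookup_sum lookup_single in_keys_iff)
qed

lemma smul_add: "smul a (f + g) = smul a f + smul a (g :: 'e \<Rightarrow>\<^sub>0 'a::ring_1)"
  by (rule poly_mapping_eqI) (simp add: lookup_smul lookup_add distrib_left)

lemma smul_add_left: "smul (a + b) f = smul a f + smul b (f :: 'e \<Rightarrow>\<^sub>0 'a::ring_1)"
  by (rule poly_mapping_eqI) (simp add: lookup_smul lookup_add distrib_right)

lemma smul_diff: "smul a (f - g) = smul a f - smul a (g :: 'e \<Rightarrow>\<^sub>0 'a::ring_1)"
  by (rule poly_mapping_eqI) (simp add: lookup_smul lookup_minus right_diff_distrib)

lemma smul_smul: "smul a (smul b f) = smul (a * b) (f :: 'e \<Rightarrow>\<^sub>0 'a::ring_1)"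
  by (rule poly_mapping_eqI) (simp add: lookup_smul mult.assoc)

lemma smul_one [simp]: "smul 1 f = (f :: 'e \<Rightarrow>\<^sub>0 'a::ring_1)"
  by (rule poly_mapping_eqI) (simp add: lookup_smul)

lemma smul_zero [simp]: "smul a 0 = (0 :: 'e \<Rightarrow>\<^sub>0 'a::ring_1)"
  by (rule poly_mapping_eqI) (simp add: lookup_smul)

lemma smul_zero_left [simp]: "smul 0 f = (0 :: 'e \<Rightarrow>\<^sub>0 'a::ring_1)"
  by (rule poly_mapping_eqI) (simp add: lookup_smul)

lemma smul_sum: "smul a (\<Sum>i\<in>S. f i) = (\<Sum>i\<in>S. smul a (f i :: 'e \<Rightarrow>\<^sub>0 'a::ring_1))"
  by (induction S rule: infinite_finite_induct) (auto simp: smul_add)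

lemma smul_single: "smul a (single e b) = single e (a * b :: 'a::ring_1)"
  by (rule poly_mapping_eqI) (simp add: lookup_smul lookup_single when_def)

lemma keys_sum_subset:
  assumes "\<And>i. i \<in> I \<Longrightarrow> keys (f i) \<subseteq> S"
  shows "keys (\<Sum>i\<in>I. f i) \<subseteq> S"
  using assms
proof (induction I rule: infinite_finite_induct)
  case (insert i I)
  then show ?case
    using keys_add[of "f i" "\<Sum>i\<in>I. f i"] by auto
qed auto

lemma free_mod_iff: "f \<in> free_mod E \<longleftrightarrow> (\<forall>e. e \<notin> E \<longrightarrow> lookup f e = 0)"
  by (auto simp: free_mod_def in_keys_iff)

lemma free_mod_add: "f \<in> free_mod E \<Longrightarrow> g \<in> free_mod E \<Longrightarrow> f + g \<in> free_mod E"
  using keys_add[of f g] by (auto simp: free_mod_def)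

lemma free_mod_zero [simp]: "0 \<in> free_mod E"
  by (simp add: free_mod_def)

lemma free_mod_smul: "f \<in> free_mod E \<Longrightarrow> smul a f \<in> free_mod E"
  by (simp add: free_mod_iff lookup_smul)

lemma free_mod_diff: "f \<in> free_mod E \<Longrightarrow> g \<in> free_mod E \<Longrightarrow> f - g \<in> free_mod E"
  by (simp add: free_mod_iff lookup_minus)

lemma free_mod_sum: "(\<And>i. i \<in> I \<Longrightarrow> f i \<in> free_mod E) \<Longrightarrow> (\<Sum>i\<in>I. f i) \<in> free_mod E"
  by (induction I rule: infinite_finite_induct) (auto simp: free_mod_add)

lemma free_mod_single [simp]: "e \<in> E \<Longrightarrow> single e a \<in> free_mod E"
  by (auto simp: free_mod_def)

text \<open>The linear extension of \<open>h\<close> from the basis. Being defined on the whole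
  type, it is linear without membership conditions, unlike the differentials of a given
  resolution.\<close>

definition ext :: "('e \<Rightarrow> ('b \<Rightarrow>\<^sub>0 'a::ring_1)) \<Rightarrow> ('e \<Rightarrow>\<^sub>0 'a) \<Rightarrow> ('b \<Rightarrow>\<^sub>0 'a)" where
  "ext h f = (\<Sum>e\<in>keys f. smul (lookup f e) (h e))"

lemma ext_superset:
  assumes "finite S" "keys f \<subseteq> S"
  shows "ext h f = (\<Sum>e\<in>S. smul (lookup f e) (h e))"
  unfolding ext_def using assms by (intro sum.mono_neutral_left) (auto simp: in_keys_iff)

lemma ext_add: "ext h (f + g) = ext h f + ext h g"
proof -
  let ?S = "keys f \<union> keys g"
  have "ext h (f + g) = (\<Sum>e\<in>?S. smul (lookup (f + g) e) (h e))"
    using keys_add[of f g] by (intro ext_superset) auto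
  also have "\<dots> = ext h f + ext h g"
    by (simp add: ext_superset[of ?S] lookup_add smul_add_left sum.distrib)
  finally show ?thesis .
qed

lemma ext_smul: "ext h (smul a f) = smul a (ext h f)"
proof -
  have "ext h (smul a f) = (\<Sum>e\<in>keys f. smul (lookup (smul a f) e) (h e))"
    by (rule ext_superset) (auto simp: in_keys_iff lookup_smul)
  then show ?thesis
    by (simp add: ext_def lookup_smul smul_smul smul_sum)
qed

lemma ext_single [simp]: "ext h (single e a) = smul a (h e)"
  by (simp add: ext_def)

lemma ext_zero [simp]: "ext h 0 = 0"
  by (simp add: ext_def)

lemma ext_diff: "ext h (f - g) = ext h f - ext h g"
  using ext_add[of h "f - g" g] by simp

lemma ext_sum: "ext h (\<Sum>i\<in>S. f i) = (\<Sum>i\<in>S. ext h (f i))"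
  by (induction S rule: infinite_finite_induct) (auto simp: ext_add)

lemma left_linear_ext: "left_linear smul smul M (ext h)"
  by (simp add: left_linear_def ext_add ext_smul)

lemma module_hom_ext: "module_hom (smul :: 'k::comm_ring_1 \<Rightarrow> _) smul (ext h)"
  by unfold_locales (simp_all add: ext_add ext_smul)

lemma left_linear_add: "left_linear act act' M h \<Longrightarrow> x \<in> M \<Longrightarrow> y \<in> M \<Longrightarrow> h (x + y) = h x + h y"
  by (simp add: left_linear_def)

lemma left_linear_act: "left_linear act act' M h \<Longrightarrow> x \<in> M \<Longrightarrow> h (act a x) = act' a (h x)"
  by (simp add: left_linear_def)

lemma left_linear_zero: "left_linear act act' (free_mod E) h \<Longrightarrow> h 0 = 0"
  using left_linear_add[of act act' "free_mod E" h 0 0] by simp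

lemma left_linear_sum:
  assumes "left_linear act act' (free_mod E) h" "\<And>i. i \<in> S \<Longrightarrow> f i \<in> free_mod E"
  shows "h (\<Sum>i\<in>S. f i) = (\<Sum>i\<in>S. h (f i))"
  using assms(2)
proof (induction S rule: infinite_finite_induct)
  case (insert i S)
  then show ?case
    by (simp add: left_linear_add[OF assms(1)] free_mod_sum)
qed (simp_all add: left_linear_zero[OF assms(1)])

lemma left_linear_diff:
  assumes "left_linear act act' (free_mod E) h" "x \<in> free_mod E" "y \<in> free_mod E"
  shows "h (x - y) = h x - h y"
  using left_linear_add[OF assms(1) free_mod_diff[OF assms(2,3)] assms(3)] by simp

lemma left_linear_expand:
  fixes h :: "('e \<Rightarrow>\<^sub>0 'a::ring_1) \<Rightarrow> 'n::ab_group_add"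
  assumes "left_linear smul act' (free_mod E) h" "f \<in> free_mod E"
  shows "h f = (\<Sum>e\<in>keys f. act' (lookup f e) (h (single e 1)))"
proof -
  have E: "e \<in> E" if "e \<in> keys f" for e
    using assms(2) that by (auto simp: free_mod_def)
  have "h f = h (\<Sum>e\<in>keys f. single e (lookup f e))"
    using pm_expand[of "keys f" f] by simp
  also have "\<dots> = (\<Sum>e\<in>keys f. h (single e (lookup f e)))"
    using E by (intro left_linear_sum[OF assms(1)]) simp
  also have "\<dots> = (\<Sum>e\<in>keys f. act' (lookup f e) (h (single e 1)))"
  proof (rule sum.cong)
    fix e assume "e \<in> keys f"
    then show "h (single e (lookup f e)) = act' (lookup f e) (h (single e 1))"
      using left_linear_act[OF assms(1), of "single e 1" "lookup f e"] E by (simp add: smul_single)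
  qed simp
  finally show ?thesis .
qed

lemma left_linear_eqI:
  fixes h h' :: "('e \<Rightarrow>\<^sub>0 'a::ring_1) \<Rightarrow> 'n::ab_group_add"
  assumes "left_linear smul act' (free_mod E) h" "left_linear smul act' (free_mod E) h'"
    "\<And>e. e \<in> E \<Longrightarrow> h (single e 1) = h' (single e 1)" "f \<in> free_mod E"
  shows "h f = h' f"
  unfolding left_linear_expand[OF assms(1,4)] left_linear_expand[OF assms(2,4)]
  using assms(3,4) by (intro sum.cong) (auto simp: free_mod_def)

lemma left_linear_comp:
  assumes "left_linear act act' M h" "left_linear act' act'' M' h'" "\<And>x. x \<in> M \<Longrightarrow> h x \<in> M'"
  shows "left_linear act act'' M (\<lambda>x. h' (h x))"
  using assms by (simp add: left_linear_def)

section \<open>Graded free modules and their reduction to \<open>k\<close>\<close>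

context connected_graded_algebra
begin

lemma free_mod_gr_iff:
  "f \<in> free_mod_gr scale gr E ge n \<longleftrightarrow>
    f \<in> free_mod E \<and> (\<forall>e\<in>E. lookup f e \<in> grS {m. m + ge e = n})"
  by (simp add: free_mod_gr_def span_gr)

abbreviation Fgr :: "'e set \<Rightarrow> ('e \<Rightarrow> 'g) \<Rightarrow> 'g \<Rightarrow> ('e \<Rightarrow>\<^sub>0 'a) set" where
  "Fgr \<equiv> free_mod_gr scale gr"

lemma Fgr_free_mod: "f \<in> Fgr E ge n \<Longrightarrow> f \<in> free_mod E"
  by (simp add: free_mod_gr_iff)

lemma Fgr_lookup: "f \<in> Fgr E ge n \<Longrightarrow> lookup f e \<in> grS {m. m + ge e = n}"
  using subspace_0[OF subspace_grS]
  by (cases "e \<in> E") (auto simp: free_mod_gr_iff free_mod_iff)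

lemma FgrI: "f \<in> free_mod E \<Longrightarrow> (\<And>e. e \<in> E \<Longrightarrow> lookup f e \<in> grS {m. m + ge e = n}) \<Longrightarrow> f \<in> Fgr E ge n"
  by (simp add: free_mod_gr_iff)

lemma Fgr_add: "f \<in> Fgr E ge n \<Longrightarrow> g \<in> Fgr E ge n \<Longrightarrow> f + g \<in> Fgr E ge n"
  by (auto simp: free_mod_gr_iff free_mod_add lookup_add intro: subspace_add[OF subspace_grS])

lemma Fgr_diff: "f \<in> Fgr E ge n \<Longrightarrow> g \<in> Fgr E ge n \<Longrightarrow> f - g \<in> Fgr E ge n"
  by (auto simp: free_mod_gr_iff free_mod_diff lookup_minus intro: subspace_diff[OF subspace_grS])

lemma Fgr_zero [simp]: "0 \<in> Fgr E ge n"
  by (auto simp: free_mod_gr_iff intro: subspace_0[OF subspace_grS])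

lemma Fgr_sum: "(\<And>i. i \<in> I \<Longrightarrow> f i \<in> Fgr E ge n) \<Longrightarrow> (\<Sum>i\<in>I. f i) \<in> Fgr E ge n"
  by (induction I rule: infinite_finite_induct) (auto simp: Fgr_add)

lemma Fgr_single:
  assumes "e \<in> E" "a \<in> gr m" "m + ge e = n"
  shows "single e a \<in> Fgr E ge n"
  using assms by (intro FgrI) (auto simp: lookup_single when_def subspace_0[OF subspace_grS] intro: gr_grS)

lemma Fgr_single_one: "e \<in> E \<Longrightarrow> single e 1 \<in> Fgr E ge (ge e)"
  by (rule Fgr_single[OF _ one_gr]) simp_all

lemma Fgr_smul:
  assumes "a \<in> grS S" "f \<in> Fgr E ge l" "\<And>m. m \<in> S \<Longrightarrow> m + l = n"
  shows "smul a f \<in> Fgr E ge n"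
proof (rule FgrI)
  show "smul a f \<in> free_mod E"
    by (rule free_mod_smul[OF Fgr_free_mod[OF assms(2)]])
  fix e
  show "lookup (smul a f) e \<in> grS {m. m + ge e = n}"
    unfolding lookup_smul using assms(3) by (intro grS_mult[OF assms(1) Fgr_lookup[OF assms(2)]]) (auto simp: add.assoc)
qed

lemma ext_Fgr:
  assumes "\<And>e. e \<in> E \<Longrightarrow> h e \<in> Fgr E' ge' (ge e)" "f \<in> Fgr E ge n"
  shows "ext h f \<in> Fgr E' ge' n"
  unfolding ext_def using assms(2)
  by (intro Fgr_sum Fgr_smul[OF Fgr_lookup[OF assms(2)] assms(1)]) (auto dest!: Fgr_free_mod simp: free_mod_def)

definition Fpr :: "('e \<Rightarrow> 'g) \<Rightarrow> 'g \<Rightarrow> ('e \<Rightarrow>\<^sub>0 'a) \<Rightarrow> ('e \<Rightarrow>\<^sub>0 'a)" where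
  "Fpr ge n f = (\<Sum>e\<in>keys f. single e (pr {m. m + ge e = n} (lookup f e)))"

lemma lookup_Fpr: "lookup (Fpr ge n f) e = pr {m. m + ge e = n} (lookup f e)"
  by (cases "e \<in> keys f") (simp_all add: Fpr_def lookup_sum lookup_single when_def in_keys_iff)

lemma Fpr_Fgr: "f \<in> free_mod E \<Longrightarrow> Fpr ge n f \<in> Fgr E ge n"
  by (intro FgrI) (auto simp: lookup_Fpr pr_in_grS free_mod_iff)

lemma Fpr_id: "f \<in> Fgr E ge n \<Longrightarrow> Fpr ge n f = f"
  by (rule poly_mapping_eqI) (simp add: lookup_Fpr pr_grS Fgr_lookup)

lemma Fpr_zero [simp]: "Fpr ge n 0 = 0"
  by (rule poly_mapping_eqI) (simp add: lookup_Fpr)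

lemma Fpr_sum: "Fpr ge n (\<Sum>i\<in>I. f i) = (\<Sum>i\<in>I. Fpr ge n (f i))"
  by (rule poly_mapping_eqI) (simp add: lookup_Fpr lookup_sum pr_sum)

lemma Fpr_smul:
  assumes "f \<in> Fgr E ge l"
  shows "Fpr ge n (smul a f) = smul (pr {m. m + l = n} a) f"
  by (rule poly_mapping_eqI)
    (auto simp: lookup_Fpr lookup_smul add.assoc intro!: pr_mult_right[OF Fgr_lookup[OF assms]])

definition graded_map :: "'e set \<Rightarrow> ('e \<Rightarrow> 'g) \<Rightarrow> 'f set \<Rightarrow> ('f \<Rightarrow> 'g) \<Rightarrow> (('e \<Rightarrow>\<^sub>0 'a) \<Rightarrow> ('f \<Rightarrow>\<^sub>0 'a)) \<Rightarrow> bool" where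
  "graded_map E ge E' ge' D \<longleftrightarrow> left_linear smul smul (free_mod E) D \<and> (\<forall>n. D ` Fgr E ge n \<subseteq> Fgr E' ge' n)"

lemma graded_map_linear: "graded_map E ge E' ge' D \<Longrightarrow> left_linear smul smul (free_mod E) D"
  and graded_map_Fgr: "graded_map E ge E' ge' D \<Longrightarrow> f \<in> Fgr E ge n \<Longrightarrow> D f \<in> Fgr E' ge' n"
  by (auto simp: graded_map_def)

lemma graded_map_ext:
  assumes "\<And>e. e \<in> E \<Longrightarrow> h e \<in> Fgr E' ge' (ge e)"
  shows "graded_map E ge E' ge' (ext h)"
  using ext_Fgr[OF assms] by (auto simp: graded_map_def left_linear_ext)

lemma graded_map_expand:
  assumes "graded_map E ge E' ge' D" "f \<in> free_mod E"
  shows "D f = (\<Sum>e\<in>keys f. smul (lookup f e) (D (single e 1)))"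
  by (rule left_linear_expand[OF graded_map_linear[OF assms(1)] assms(2)])

lemma graded_map_single: "graded_map E ge E' ge' D \<Longrightarrow> e \<in> E \<Longrightarrow> D (single e 1) \<in> Fgr E' ge' (ge e)"
  by (rule graded_map_Fgr[OF _ Fgr_single_one])

lemma graded_map_free_mod:
  assumes "graded_map E ge E' ge' D" "f \<in> free_mod E"
  shows "D f \<in> free_mod E'"
  unfolding graded_map_expand[OF assms] using assms(2)
  by (intro free_mod_sum free_mod_smul Fgr_free_mod[OF graded_map_single[OF assms(1)]]) (auto simp: free_mod_def)

lemma graded_map_Fpr:
  assumes D: "graded_map E ge E' ge' D" and f: "f \<in> free_mod E"
  shows "D (Fpr ge n f) = Fpr ge' n (D f)"
proof -
  have E: "e \<in> E" if "e \<in> keys f" for e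
    using f that by (auto simp: free_mod_def)
  have "Fpr ge n f = (\<Sum>e\<in>keys f. smul (pr {m. m + ge e = n} (lookup f e)) (single e 1))"
    by (simp add: Fpr_def smul_single)
  then have "D (Fpr ge n f) = (\<Sum>e\<in>keys f. D (smul (pr {m. m + ge e = n} (lookup f e)) (single e 1)))"
    using left_linear_sum[OF graded_map_linear[OF D], of "keys f"] E by (simp add: smul_single)
  also have "\<dots> = (\<Sum>e\<in>keys f. smul (pr {m. m + ge e = n} (lookup f e)) (D (single e 1)))"
    using E by (intro sum.cong refl left_linear_act[OF graded_map_linear[OF D]]) simp
  also have "\<dots> = (\<Sum>e\<in>keys f. Fpr ge' n (smul (lookup f e) (D (single e 1))))"
    using E by (intro sum.cong refl Fpr_smul[symmetric, OF graded_map_single[OF D]])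
  also have "\<dots> = Fpr ge' n (D f)"
    by (simp add: graded_map_expand[OF D f] Fpr_sum)
  finally show ?thesis .
qed

text \<open>Graded maps commute with the projections \<open>Fpr\<close>, so projecting any preimage
  to degree \<open>n\<close> gives a homogeneous one.\<close>

lemma graded_lift:
  assumes D: "graded_map E ge E' ge' D" and x: "x \<in> Fgr E' ge' n" "x \<in> D ` free_mod E"
  shows "\<exists>y\<in>Fgr E ge n. D y = x"
proof -
  obtain y where "y \<in> free_mod E" "x = D y"
    using x(2) by blast
  then show ?thesis
    using graded_map_Fpr[OF D, of y n] Fpr_id[OF x(1)] Fpr_Fgr[of y E ge n] by auto
qed

text \<open>\<open>augF\<close> is the projection from \<open>F\<close> to \<open>k \<otimes> F\<close> and \<open>inc\<close> its \<open>k\<close>-linear section, for a free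
  module \<open>F\<close> and with \<open>k \<otimes> F\<close> identified with the free \<open>k\<close>-module on the same basis.\<close>

definition augF :: "('e \<Rightarrow>\<^sub>0 'a) \<Rightarrow> ('e \<Rightarrow>\<^sub>0 'k)" where
  "augF f = Poly_Mapping.map \<epsilon> f"

definition inc :: "('e \<Rightarrow>\<^sub>0 'k) \<Rightarrow> ('e \<Rightarrow>\<^sub>0 'a)" where
  "inc v = Poly_Mapping.map (\<lambda>c. scale c 1) v"

definition kgr :: "'e set \<Rightarrow> ('e \<Rightarrow> 'g) \<Rightarrow> 'g \<Rightarrow> ('e \<Rightarrow>\<^sub>0 'k) set" where
  "kgr E ge n = {v. keys v \<subseteq> {e \<in> E. ge e = n}}"

lemma kgr_iff: "v \<in> kgr E ge n \<longleftrightarrow> (\<forall>e. \<not> (e \<in> E \<and> ge e = n) \<longrightarrow> lookup v e = 0)"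
  by (auto simp: kgr_def in_keys_iff)

lemma lookup_augF: "lookup (augF f) e = \<epsilon> (lookup f e)"
  by (simp add: augF_def Poly_Mapping.map.rep_eq when_def)

lemma lookup_inc: "lookup (inc v) e = scale (lookup v e) 1"
  by (simp add: inc_def Poly_Mapping.map.rep_eq when_def)

lemma augF_inc [simp]: "augF (inc v) = v"
  by (rule poly_mapping_eqI) (simp add: lookup_augF lookup_inc aug_scale)

lemma augF_add: "augF (f + g) = augF f + augF g"
  by (rule poly_mapping_eqI) (simp add: lookup_augF lookup_add aug_add)

lemma augF_diff: "augF (f - g) = augF f - augF g"
  by (rule poly_mapping_eqI) (simp add: lookup_augF lookup_minus aug_diff)

lemma augF_zero [simp]: "augF 0 = 0"
  by (rule poly_mapping_eqI) (simp add: lookup_augF)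

lemma augF_sum: "augF (\<Sum>i\<in>S. f i) = (\<Sum>i\<in>S. augF (f i))"
  by (rule poly_mapping_eqI) (simp add: lookup_augF lookup_sum aug_sum)

lemma augF_smul: "augF (smul a f) = smul (\<epsilon> a) (augF f)"
  by (rule poly_mapping_eqI) (simp add: lookup_augF lookup_smul aug_mult)

lemma augF_single [simp]: "augF (single e a) = single e (\<epsilon> a)"
  by (rule poly_mapping_eqI) (simp add: lookup_augF lookup_single when_def)

lemma inc_add: "inc (v + w) = inc v + inc w"
  by (rule poly_mapping_eqI) (simp add: lookup_inc lookup_add scale_left_distrib)

lemma inc_smul: "inc (smul c v) = smul (scale c 1) (inc v)"
  by (rule poly_mapping_eqI) (simp add: lookup_inc lookup_smul scale_mult_left)

lemma inc_zero [simp]: "inc 0 = 0"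
  by (rule poly_mapping_eqI) (simp add: lookup_inc)

lemma inc_free_mod: "v \<in> kgr E ge n \<Longrightarrow> inc v \<in> free_mod E"
  by (auto simp: free_mod_def kgr_def in_keys_iff lookup_inc) (metis in_keys_iff scale_zero_left subsetD mem_Collect_eq)

lemma inc_Fgr: "v \<in> kgr E ge n \<Longrightarrow> inc v \<in> Fgr E ge n"
proof (rule FgrI)
  fix e assume v: "v \<in> kgr E ge n" and "e \<in> E"
  show "lookup (inc v) e \<in> grS {m. m + ge e = n}"
  proof (cases "ge e = n")
    case True
    then show ?thesis
      by (auto simp: lookup_inc intro!: gr_grS[OF scale_one_gr])
  next
    case False
    then have "lookup v e = 0"
      using v by (auto simp: kgr_def in_keys_iff)
    then show ?thesis
      by (simp add: lookup_inc subspace_0[OF subspace_grS])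
  qed
qed (rule inc_free_mod)

text \<open>A coefficient with nonzero augmentation has a component of degree \<open>0\<close>; for
  an element of degree \<open>n\<close> this forces the basis element itself to have degree
  \<open>n\<close>.\<close>

lemma augF_kgr:
  assumes f: "f \<in> Fgr E ge n"
  shows "augF f \<in> kgr E ge n"
proof -
  have "e \<in> E \<and> ge e = n" if e: "\<epsilon> (lookup f e) \<noteq> 0" for e
  proof -
    have "pr {m. m + ge e = n} (lookup f e) = lookup f e"
      by (rule pr_grS[OF Fgr_lookup[OF f]])
    then have "\<epsilon> (lookup f e) = (if 0 \<in> {m. m + ge e = n} then \<epsilon> (lookup f e) else 0)"
      using aug_pr by metis
    then have "ge e = n"
      using e by (auto split: if_splits)
    moreover have "lookup f e \<noteq> 0"
      using e by auto
    ultimately show ?thesis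
      using Fgr_free_mod[OF f] by (auto simp: free_mod_def in_keys_iff)
  qed
  then show ?thesis
    by (auto simp: kgr_def in_keys_iff lookup_augF)
qed

lemma subspace_kgr: "sm.subspace (kgr E ge n)"
  by (rule sm.subspaceI) (auto simp: kgr_iff lookup_add lookup_smul)

lemma augF_graded_map:
  assumes "graded_map E ge E' ge' D" "f \<in> free_mod E"
  shows "augF (D f) = (\<Sum>e\<in>keys f. smul (\<epsilon> (lookup f e)) (augF (D (single e 1))))"
  unfolding graded_map_expand[OF assms] by (simp add: augF_sum augF_smul)

lemma lookup_augF_Fpr: "lookup (augF (Fpr ge n f)) e = (if ge e = n then lookup (augF f) e else 0)"
  by (simp add: lookup_augF lookup_Fpr aug_pr)

lemma augF_Fpr_eq: "augF f \<in> kgr E ge n \<Longrightarrow> augF (Fpr ge n f) = augF f"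
  by (rule poly_mapping_eqI) (auto simp: lookup_augF_Fpr kgr_iff)

text \<open>The map \<open>id \<otimes> D\<close> on \<open>k \<otimes> F\<close>, evaluated on the
  lift that \<open>inc\<close> provides; \<open>kmap_augF\<close> shows that every other lift in the
  module gives the same value.\<close>

definition kmap :: "(('e \<Rightarrow>\<^sub>0 'a) \<Rightarrow> ('f \<Rightarrow>\<^sub>0 'a)) \<Rightarrow> ('e \<Rightarrow>\<^sub>0 'k) \<Rightarrow> ('f \<Rightarrow>\<^sub>0 'k)" where
  "kmap D v = augF (D (inc v))"

text \<open>The augmentation is multiplicative, so the reduction of \<open>D f\<close> depends only
  on the augmented coefficients of \<open>f\<close>, and \<open>inc (augF f)\<close> has the same
  ones.\<close>

lemma kmap_augF:
  assumes "graded_map E ge E' ge' D" "f \<in> free_mod E"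
  shows "kmap D (augF f) = augF (D f)"
proof -
  have fm: "inc (augF f) \<in> free_mod E"
    using assms(2) by (simp add: free_mod_iff lookup_inc lookup_augF)
  have "(\<Sum>e\<in>keys (inc (augF f)). smul (\<epsilon> (lookup (inc (augF f)) e)) (augF (D (single e 1)))) =
      (\<Sum>e\<in>keys f. smul (\<epsilon> (lookup (inc (augF f)) e)) (augF (D (single e 1))))"
    by (rule sum.mono_neutral_left) (auto simp: in_keys_iff lookup_inc lookup_augF aug_scale)
  then show ?thesis
    by (simp add: kmap_def augF_graded_map[OF assms(1) fm] augF_graded_map[OF assms] lookup_inc lookup_augF aug_scale)
qed

lemma kmap_add:
  assumes "graded_map E ge E' ge' D" "v \<in> kgr E ge n" "w \<in> kgr E ge n"
  shows "kmap D (v + w) = kmap D v + kmap D w"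
  using left_linear_add[OF graded_map_linear[OF assms(1)] inc_free_mod[OF assms(2)] inc_free_mod[OF assms(3)]]
  by (simp add: kmap_def inc_add augF_add)

lemma kmap_smul:
  assumes "graded_map E ge E' ge' D" "v \<in> kgr E ge n"
  shows "kmap D (smul c v) = smul c (kmap D v)"
  using left_linear_act[OF graded_map_linear[OF assms(1)] inc_free_mod[OF assms(2)]]
  by (simp add: kmap_def inc_smul augF_smul aug_scale)

lemma kmap_zero: "graded_map E ge E' ge' D \<Longrightarrow> kmap D 0 = 0"
  by (simp add: kmap_def left_linear_zero[OF graded_map_linear])

lemma kmap_kgr: "graded_map E ge E' ge' D \<Longrightarrow> v \<in> kgr E ge n \<Longrightarrow> kmap D v \<in> kgr E' ge' n"
  unfolding kmap_def by (rule augF_kgr[OF graded_map_Fgr[OF _ inc_Fgr]])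

end

section \<open>Comparison of resolutions\<close>

lemma left_linear_fun_diff:
  assumes "left_linear act smul M u" "left_linear act smul M v"
  shows "left_linear act smul M (\<lambda>x. u x - v x :: 'e \<Rightarrow>\<^sub>0 'a::ring_1)"
  using assms by (simp add: left_linear_def smul_diff)

lemma left_linear_ident: "left_linear act act M (\<lambda>x. x)"
  by (simp add: left_linear_def)

context connected_graded_algebra
begin

lemma graded_map_comp:
  assumes "graded_map E ge E' ge' f" "graded_map E' ge' E'' ge'' g"
  shows "graded_map E ge E'' ge'' (\<lambda>x. g (f x))"
proof -
  have "left_linear smul smul (free_mod E) (\<lambda>x. g (f x))"
    using graded_map_free_mod[OF assms(1)] by (intro left_linear_comp[OF graded_map_linear[OF assms(1)] graded_map_linear[OF assms(2)]])
  then show ?thesis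
    using graded_map_Fgr[OF assms(1)] graded_map_Fgr[OF assms(2)] unfolding graded_map_def by blast
qed

lemma kmap_comp:
  assumes "graded_map E ge E' ge' f" "graded_map E' ge' E'' ge'' g" "v \<in> kgr E ge n"
  shows "kmap g (kmap f v) = kmap (\<lambda>x. g (f x)) v"
  unfolding kmap_def[of f]
  by (subst kmap_augF[OF assms(2) graded_map_free_mod[OF assms(1) inc_free_mod[OF assms(3)]]]) (simp add: kmap_def)

lemma module_hom_kmap_ext: "module_hom smul smul (kmap (ext h))"
  by unfold_locales (simp_all add: kmap_def inc_add inc_smul ext_add ext_smul augF_add augF_smul aug_scale)

text \<open>Degree \<open>n\<close> of the homology of \<open>k \<otimes> F\<close> at \<open>F\<close>, where \<open>D\<close> is the differential on \<open>F\<close>. By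
  exactness at \<open>F\<close>, the boundaries are the images of the elements of the kernel of \<open>D\<close>.\<close>

definition Hz :: "'e set \<Rightarrow> ('e \<Rightarrow> 'g) \<Rightarrow> (('e \<Rightarrow>\<^sub>0 'a) \<Rightarrow> ('f \<Rightarrow>\<^sub>0 'a)) \<Rightarrow> 'g \<Rightarrow> ('e \<Rightarrow>\<^sub>0 'k) set" where
  "Hz E ge D n = {v \<in> kgr E ge n. kmap D v = 0}"

definition Hb :: "'e set \<Rightarrow> ('e \<Rightarrow> 'g) \<Rightarrow> (('e \<Rightarrow>\<^sub>0 'a) \<Rightarrow> ('f \<Rightarrow>\<^sub>0 'a)) \<Rightarrow> 'g \<Rightarrow> ('e \<Rightarrow>\<^sub>0 'k) set" where
  "Hb E ge D n = augF ` {w \<in> Fgr E ge n. D w = 0}"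

lemma subspace_Hz:
  assumes "graded_map E ge E' ge' D"
  shows "sm.subspace (Hz E ge D n)"
  by (rule sm.subspaceI)
    (auto simp: Hz_def kmap_zero[OF assms] kmap_add[OF assms] kmap_smul[OF assms]
      intro: sm.subspace_0[OF subspace_kgr] sm.subspace_add[OF subspace_kgr] sm.subspace_scale[OF subspace_kgr])

lemma subspace_Hb:
  assumes D: "graded_map E ge E' ge' D"
  shows "sm.subspace (Hb E ge D n)"
proof (rule sm.subspaceI)
  note ll = graded_map_linear[OF D]
  show "0 \<in> Hb E ge D n"
    unfolding Hb_def by (rule image_eqI[of _ _ 0]) (simp_all add: left_linear_zero[OF ll])
  fix x y assume "x \<in> Hb E ge D n" "y \<in> Hb E ge D n"
  then obtain v w where "x = augF v" "y = augF w" "v \<in> Fgr E ge n" "w \<in> Fgr E ge n" "D v = 0" "D w = 0"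
    by (auto simp: Hb_def)
  then show "x + y \<in> Hb E ge D n"
    unfolding Hb_def by (intro image_eqI[of _ _ "v + w"]) (simp_all add: augF_add Fgr_add left_linear_add[OF ll] Fgr_free_mod)
next
  note ll = graded_map_linear[OF D]
  fix c x assume "x \<in> Hb E ge D n"
  then obtain v where v: "x = augF v" "v \<in> Fgr E ge n" "D v = 0"
    by (auto simp: Hb_def)
  moreover have "smul (scale c 1) v \<in> Fgr E ge n"
    by (rule Fgr_smul[OF gr_grS[OF scale_one_gr] v(2), of "{0}"]) auto
  ultimately show "smul c x \<in> Hb E ge D n"
    unfolding Hb_def
    by (intro image_eqI[of _ _ "smul (scale c 1) v"]) (simp_all add: augF_smul aug_scale left_linear_act[OF ll] Fgr_free_mod)
qed

lemma Hb_subset_Hz: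
  assumes "graded_map E ge E' ge' D"
  shows "Hb E ge D n \<subseteq> Hz E ge D n"
  by (auto simp: Hb_def Hz_def kmap_augF[OF assms] Fgr_free_mod intro: augF_kgr)

lemma chain_map_Hz:
  assumes D: "graded_map E1 g1 E0 g0 D" and D': "graded_map E1' g1' E0' g0' D'"
    and f: "graded_map E1 g1 E1' g1' f1" "graded_map E0 g0 E0' g0' f0"
    and comm: "\<forall>x\<in>free_mod E1. D' (f1 x) = f0 (D x)" and v: "v \<in> Hz E1 g1 D n"
  shows "kmap f1 v \<in> Hz E1' g1' D' n"
proof -
  have kgr: "v \<in> kgr E1 g1 n" and zero: "kmap D v = 0"
    using v by (auto simp: Hz_def)
  have "kmap D' (kmap f1 v) = kmap (\<lambda>x. D' (f1 x)) v"
    by (rule kmap_comp[OF f(1) D' kgr])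
  also have "\<dots> = kmap (\<lambda>x. f0 (D x)) v"
    unfolding kmap_def by (simp add: comm inc_free_mod[OF kgr])
  also have "\<dots> = kmap f0 (kmap D v)"
    by (rule kmap_comp[OF D f(2) kgr, symmetric])
  finally show ?thesis
    using kmap_kgr[OF f(1) kgr] by (simp add: Hz_def zero kmap_zero[OF f(2)])
qed

lemma chain_map_Hb:
  assumes "graded_map E1 g1 E1' g1' f1" "graded_map E0 g0 E0' g0' f0"
    and comm: "\<forall>x\<in>free_mod E1. D' (f1 x) = f0 (D x)" and v: "v \<in> Hb E1 g1 D n"
  shows "kmap f1 v \<in> Hb E1' g1' D' n"
proof -
  obtain w where w: "w \<in> Fgr E1 g1 n" "D w = 0" "v = augF w"
    using v by (auto simp: Hb_def)
  have "D' (f1 w) = 0"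
    using comm[rule_format, OF Fgr_free_mod[OF w(1)]] w(2) left_linear_zero[OF graded_map_linear[OF assms(2)]] by simp
  moreover have "kmap f1 v = augF (f1 w)"
    unfolding w(3) by (rule kmap_augF[OF assms(1) Fgr_free_mod[OF w(1)]])
  ultimately show ?thesis
    using graded_map_Fgr[OF assms(1) w(1)] by (auto simp: Hb_def)
qed

text \<open>The usual homotopy formula is weakened: \<open>u x - x - s (D x)\<close> only has to lie
  in the kernel of \<open>D\<close>, instead of being a given image. That suffices because
  \<open>Hb\<close> consists of reductions of such elements; on cycles the term
  \<open>s (D x)\<close> reduces to zero.\<close>

lemma homotopic_identity:
  assumes D: "graded_map E1 g1 E0 g0 D" and u: "graded_map E1 g1 E1 g1 u" and s: "graded_map E0 g0 E1 g1 s"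
    and htp: "\<forall>x\<in>free_mod E1. D (u x - x - s (D x)) = 0" and v: "v \<in> Hz E1 g1 D n"
  shows "v - kmap u v \<in> Hb E1 g1 D n"
proof -
  have kgr: "v \<in> kgr E1 g1 n" and zero: "kmap D v = 0"
    using v by (auto simp: Hz_def)
  let ?x = "inc v"
  let ?w = "u ?x - ?x - s (D ?x)"
  note x = inc_Fgr[OF kgr] note fm = Fgr_free_mod[OF x]
  have "?w \<in> Fgr E1 g1 n"
    by (intro Fgr_diff x graded_map_Fgr[OF u] graded_map_Fgr[OF s] graded_map_Fgr[OF D])
  moreover have "augF (s (D ?x)) = kmap s (kmap D v)"
    using kmap_augF[OF s graded_map_free_mod[OF D fm]] by (simp add: kmap_def[of D])
  then have "augF ?w = kmap u v - v"
    by (simp add: augF_diff zero kmap_zero[OF s] kmap_def[of u])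
  ultimately have "kmap u v - v \<in> Hb E1 g1 D n"
    using htp[rule_format, OF fm] unfolding Hb_def by (metis (mono_tags, lifting) image_eqI mem_Collect_eq)
  then show ?thesis
    using sm.subspace_neg[OF subspace_Hb[OF D]] by fastforce
qed

text \<open>One of the two equivalences is taken of the form \<open>ext h\<close>, so that its
  reduction is linear on the whole type, as the transfer of invariant factors asks.\<close>

lemma homotopy_equivalence_invariant_factors:
  assumes D: "graded_map E1 g1 E0 g0 D" and D': "graded_map E1' g1' E0' g0' D'"
    and f: "graded_map E1 g1 E1' g1' (ext h)" "graded_map E0 g0 E0' g0' f0"
      "\<forall>x\<in>free_mod E1. D' (ext h x) = f0 (D x)"
    and f': "graded_map E1' g1' E1 g1 f1'" "graded_map E0' g0' E0 g0 f0'"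
      "\<forall>x\<in>free_mod E1'. D (f1' x) = f0' (D' x)"
    and s: "graded_map E0 g0 E1 g1 s" "\<forall>x\<in>free_mod E1. D (f1' (ext h x) - x - s (D x)) = 0"
    and s': "graded_map E0' g0' E1' g1' s'" "\<forall>x\<in>free_mod E1'. D' (ext h (f1' x) - x - s' (D' x)) = 0"
    and inv: "invariant_factors smul (Hz E1 g1 D n, Hb E1 g1 D n) ds"
  shows "invariant_factors smul (Hz E1' g1' D' n, Hb E1' g1' D' n) ds"
proof (rule invariant_factors_transfer[OF inv module_smul subspace_Hz[OF D] module_hom_kmap_ext])
  let ?f = "ext h"
  show "kmap ?f z \<in> Hz E1' g1' D' n" if "z \<in> Hz E1 g1 D n" for z
    by (rule chain_map_Hz[OF D D' f that])
  show "\<exists>z\<in>Hz E1 g1 D n. z' - kmap ?f z \<in> Hb E1' g1' D' n" if z': "z' \<in> Hz E1' g1' D' n" for z'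
  proof
    show "kmap f1' z' \<in> Hz E1 g1 D n"
      by (rule chain_map_Hz[OF D' D f' z'])
    have "z' \<in> kgr E1' g1' n"
      using z' by (simp add: Hz_def)
    from kmap_comp[OF f'(1) f(1) this] show "z' - kmap ?f (kmap f1' z') \<in> Hb E1' g1' D' n"
      using homotopic_identity[OF D' graded_map_comp[OF f'(1) f(1)] s' z'] by simp
  qed
  show "kmap ?f z \<in> Hb E1' g1' D' n \<longleftrightarrow> z \<in> Hb E1 g1 D n" if z: "z \<in> Hz E1 g1 D n" for z
  proof
    assume "kmap ?f z \<in> Hb E1' g1' D' n"
    then have "kmap f1' (kmap ?f z) \<in> Hb E1 g1 D n"
      by (rule chain_map_Hb[OF f'])
    moreover have "z \<in> kgr E1 g1 n"
      using z by (simp add: Hz_def)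
    from kmap_comp[OF f(1) f'(1) this] have "z - kmap f1' (kmap ?f z) \<in> Hb E1 g1 D n"
      using homotopic_identity[OF D graded_map_comp[OF f(1) f'(1)] s z] by simp
    ultimately show "z \<in> Hb E1 g1 D n"
      using sm.subspace_add[OF subspace_Hb[OF D]] by fastforce
  qed (rule chain_map_Hb[OF f])
qed (rule subspace_Hb[OF D'] Hb_subset_Hz[OF D])+

text \<open>The beginning F2 -> F1 -> F0 -> k -> 0 of a graded free resolution, on which Tor_1 and
  Tor_2 depend. The bases have independent types, since the given resolution is compared with one
  built from words and relations. The condition on basis elements expresses that \<open>k\<close>
  sits in degree \<open>0\<close>.\<close>

definition part_res :: "'e0 set \<Rightarrow> ('e0 \<Rightarrow> 'g) \<Rightarrow> 'e1 set \<Rightarrow> ('e1 \<Rightarrow> 'g) \<Rightarrow> 'e2 set \<Rightarrow> ('e2 \<Rightarrow> 'g) \<Rightarrow>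
    (('e0 \<Rightarrow>\<^sub>0 'a) \<Rightarrow> 'k) \<Rightarrow> (('e1 \<Rightarrow>\<^sub>0 'a) \<Rightarrow> ('e0 \<Rightarrow>\<^sub>0 'a)) \<Rightarrow> (('e2 \<Rightarrow>\<^sub>0 'a) \<Rightarrow> ('e1 \<Rightarrow>\<^sub>0 'a)) \<Rightarrow> bool" where
  "part_res E0 g0 E1 g1 E2 g2 \<eta> d0 d1 \<longleftrightarrow>
     left_linear smul (\<lambda>a c. \<epsilon> a * c) (free_mod E0) \<eta> \<and>
     (\<forall>e\<in>E0. g0 e \<noteq> 0 \<longrightarrow> \<eta> (single e 1) = 0) \<and>
     \<eta> ` free_mod E0 = UNIV \<and>
     graded_map E1 g1 E0 g0 d0 \<and> graded_map E2 g2 E1 g1 d1 \<and>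
     d0 ` free_mod E1 = {f \<in> free_mod E0. \<eta> f = 0} \<and>
     d1 ` free_mod E2 = {f \<in> free_mod E1. d0 f = 0}"

lemma resolution_part_res:
  assumes "graded_free_resolution scale gr deg E ge d \<eta>"
  shows "part_res (E 0) (ge 0) (E 1) (ge 1) (E 2) (ge 2) \<eta> (d 0) (d 1)"
    and "graded_map (E (Suc i)) (ge (Suc i)) (E i) (ge i) (d i)"
proof -
  show *: "graded_map (E (Suc i)) (ge (Suc i)) (E i) (ge i) (d i)" for i
    using assms by (simp add: graded_free_resolution_def graded_map_def)
  have "\<forall>n. n \<noteq> 0 \<longrightarrow> \<eta> ` Fgr (E 0) (ge 0) n \<subseteq> {0}"
    using assms by (simp add: graded_free_resolution_def)
  then have "\<eta> (single e 1) = 0" if "e \<in> E 0" "ge 0 e \<noteq> 0" for e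
    using Fgr_single_one[OF that(1), of "ge 0"] that(2) by blast
  moreover have "d 1 ` free_mod (E 2) = {f \<in> free_mod (E 1). d 0 f = 0}"
    using assms by (simp add: graded_free_resolution_def numeral_2_eq_2)
  ultimately show "part_res (E 0) (ge 0) (E 1) (ge 1) (E 2) (ge 2) \<eta> (d 0) (d 1)"
    using assms *[of 0] *[of 1] by (simp add: part_res_def graded_free_resolution_def numeral_2_eq_2)
qed

text \<open>Projectivity of graded free modules: homogeneous preimages are chosen on the basis. The
  common target is a general module because the first lifting is along the augmentation, with values
  in \<open>k\<close>.\<close>

lemma lift_map:
  fixes u :: "('e \<Rightarrow>\<^sub>0 'a) \<Rightarrow> 'n::ab_group_add"
  assumes "left_linear smul act (free_mod E) u" "left_linear smul act (free_mod E') D"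
    and ex: "\<And>e. e \<in> E \<Longrightarrow> \<exists>y\<in>Fgr E' ge' (ge e). D y = u (single e 1)"
  shows "\<exists>h. graded_map E ge E' ge' (ext h) \<and> (\<forall>x\<in>free_mod E. D (ext h x) = u x)"
proof -
  obtain h where h: "\<And>e. e \<in> E \<Longrightarrow> h e \<in> Fgr E' ge' (ge e)" "\<And>e. e \<in> E \<Longrightarrow> D (h e) = u (single e 1)"
    using ex by metis
  have gm: "graded_map E ge E' ge' (ext h)"
    by (rule graded_map_ext[OF h(1)])
  have "D (ext h x) = u x" if "x \<in> free_mod E" for x
  proof (rule left_linear_eqI[OF _ assms(1) _ that])
    show "left_linear smul act (free_mod E) (\<lambda>x. D (ext h x))"
      using graded_map_free_mod[OF gm] by (intro left_linear_comp[OF graded_map_linear[OF gm] assms(2)])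
  qed (simp add: h)
  with gm show ?thesis
    by blast
qed

lemma lift_map_exact:
  assumes D: "graded_map E1 g1 E0 g0 D" and u: "graded_map E g E0 g0 u"
    and ex: "\<And>e. e \<in> E \<Longrightarrow> u (single e 1) \<in> D ` free_mod E1"
  shows "\<exists>h. graded_map E g E1 g1 (ext h) \<and> (\<forall>x\<in>free_mod E. D (ext h x) = u x)"
  by (rule lift_map[OF graded_map_linear[OF u] graded_map_linear[OF D]])
    (rule graded_lift[OF D graded_map_single[OF u] ex])

lemma graded_map_diff:
  assumes "graded_map E g E' g' u" "graded_map E g E' g' v"
  shows "graded_map E g E' g' (\<lambda>x. u x - v x)"
  using assms by (simp add: graded_map_def left_linear_fun_diff image_subset_iff Fgr_diff)

lemma graded_map_ident: "graded_map E g E g (\<lambda>x. x)"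
  by (simp add: graded_map_def left_linear_ident)

text \<open>The projection to degree \<open>0\<close> of an arbitrary preimage still maps to
  \<open>c\<close>: what is removed has coefficients of augmentation zero at basis elements of
  degree \<open>0\<close>, and all other basis elements map to zero.\<close>

lemma augmentation_lift:
  assumes \<eta>: "left_linear smul (\<lambda>a c. \<epsilon> a * c) (free_mod E0) \<eta>" "\<forall>e\<in>E0. g0 e \<noteq> 0 \<longrightarrow> \<eta> (single e 1) = 0"
    "\<eta> ` free_mod E0 = UNIV" and "m = 0 \<or> c = 0"
  shows "\<exists>y\<in>Fgr E0 g0 m. \<eta> y = c"
proof (cases "c = 0")
  case True
  then show ?thesis
    by (intro bexI[of _ 0]) (simp_all add: left_linear_zero[OF \<eta>(1)])
next
  case False
  obtain y where y: "y \<in> free_mod E0" "\<eta> y = c"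
    using \<eta>(3) by (metis UNIV_I imageE)
  note Fpr = Fpr_Fgr[OF y(1), of g0 0]
  have "\<eta> (y - Fpr g0 0 y) = (\<Sum>e\<in>keys (y - Fpr g0 0 y). \<epsilon> (lookup (y - Fpr g0 0 y) e) * \<eta> (single e 1))"
    by (intro left_linear_expand[OF \<eta>(1)] free_mod_diff y Fgr_free_mod[OF Fpr])
  also have "\<dots> = 0"
  proof (intro sum.neutral ballI)
    fix e assume "e \<in> keys (y - Fpr g0 0 y)"
    then have "e \<in> E0"
      using free_mod_diff[OF y(1) Fgr_free_mod[OF Fpr]] by (auto simp: free_mod_def)
    then show "\<epsilon> (lookup (y - Fpr g0 0 y) e) * \<eta> (single e 1) = 0"
      using \<eta>(2) by (cases "g0 e = 0") (simp_all add: lookup_minus lookup_Fpr aug_diff aug_pr)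
  qed
  finally have "\<eta> (Fpr g0 0 y) = c"
    using left_linear_diff[OF \<eta>(1) y(1) Fgr_free_mod[OF Fpr]] y(2) by simp
  then show ?thesis
    using Fpr assms(4) False by auto
qed

text \<open>The comparison theorem in degrees 0 to 2: at each stage the previous map sends
  boundaries into a kernel, which exactness identifies with an image.\<close>

lemma chain_map_exists:
  assumes P: "part_res E0 g0 E1 g1 E2 g2 \<eta> d0 d1" and Q: "part_res E0' g0' E1' g1' E2' g2' \<eta>' d0' d1'"
  shows "\<exists>h0 h1 h2. graded_map E0 g0 E0' g0' (ext h0) \<and> graded_map E1 g1 E1' g1' (ext h1) \<and> graded_map E2 g2 E2' g2' (ext h2) \<and>
    (\<forall>x\<in>free_mod E0. \<eta>' (ext h0 x) = \<eta> x) \<and> (\<forall>x\<in>free_mod E1. d0' (ext h1 x) = ext h0 (d0 x)) \<and>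
    (\<forall>x\<in>free_mod E2. d1' (ext h2 x) = ext h1 (d1 x))"
proof -
  note P = P[unfolded part_res_def] and Q = Q[unfolded part_res_def]
  have \<eta>: "left_linear smul (\<lambda>a c. \<epsilon> a * c) (free_mod E0) \<eta>" "\<forall>e\<in>E0. g0 e \<noteq> 0 \<longrightarrow> \<eta> (single e 1) = 0"
    "left_linear smul (\<lambda>a c. \<epsilon> a * c) (free_mod E0') \<eta>'" "\<forall>e\<in>E0'. g0' e \<noteq> 0 \<longrightarrow> \<eta>' (single e 1) = 0"
    "\<eta>' ` free_mod E0' = UNIV"
    using P Q by simp_all
  have d: "graded_map E1 g1 E0 g0 d0" "graded_map E2 g2 E1 g1 d1"
    "graded_map E1' g1' E0' g0' d0'" "graded_map E2' g2' E1' g1' d1'"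
    using P Q by simp_all
  have im: "d0 ` free_mod E1 = {f \<in> free_mod E0. \<eta> f = 0}" "d1 ` free_mod E2 = {f \<in> free_mod E1. d0 f = 0}"
    "d0' ` free_mod E1' = {f \<in> free_mod E0'. \<eta>' f = 0}" "d1' ` free_mod E2' = {f \<in> free_mod E1'. d0' f = 0}"
    using P Q by simp_all
  have ker: "\<And>x. x \<in> free_mod E0' \<Longrightarrow> \<eta>' x = 0 \<Longrightarrow> x \<in> d0' ` free_mod E1'"
    "\<And>x. x \<in> free_mod E1' \<Longrightarrow> d0' x = 0 \<Longrightarrow> x \<in> d1' ` free_mod E2'"
    "\<And>x. x \<in> free_mod E1 \<Longrightarrow> \<eta> (d0 x) = 0" "\<And>x. x \<in> free_mod E2 \<Longrightarrow> d0 (d1 x) = 0"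
    using im by blast+
  obtain h0 where h0: "graded_map E0 g0 E0' g0' (ext h0)" "\<forall>x\<in>free_mod E0. \<eta>' (ext h0 x) = \<eta> x"
    using lift_map[OF \<eta>(1,3) augmentation_lift[OF \<eta>(3-5)]] \<eta>(2) by blast
  have "\<exists>h. graded_map E1 g1 E1' g1' (ext h) \<and> (\<forall>x\<in>free_mod E1. d0' (ext h x) = ext h0 (d0 x))"
  proof (rule lift_map_exact[OF d(3) graded_map_comp[OF d(1) h0(1)]])
    fix e assume e: "e \<in> E1"
    note fm = graded_map_free_mod[OF d(1) free_mod_single[OF e, of 1]]
    show "ext h0 (d0 (single e 1)) \<in> d0' ` free_mod E1'"
      using h0(2) fm ker(3)[OF free_mod_single[OF e]] by (intro ker(1) graded_map_free_mod[OF h0(1)]) auto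
  qed
  then obtain h1 where h1: "graded_map E1 g1 E1' g1' (ext h1)" "\<forall>x\<in>free_mod E1. d0' (ext h1 x) = ext h0 (d0 x)"
    by blast
  have "\<exists>h. graded_map E2 g2 E2' g2' (ext h) \<and> (\<forall>x\<in>free_mod E2. d1' (ext h x) = ext h1 (d1 x))"
  proof (rule lift_map_exact[OF d(4) graded_map_comp[OF d(2) h1(1)]])
    fix e assume e: "e \<in> E2"
    note fm = graded_map_free_mod[OF d(2) free_mod_single[OF e, of 1]]
    show "ext h1 (d1 (single e 1)) \<in> d1' ` free_mod E2'"
      using h1(2) fm ker(4)[OF free_mod_single[OF e]] by (intro ker(2) graded_map_free_mod[OF h1(1)]) auto
  qed
  with h0 h1 show ?thesis
    by blast
qed

text \<open>The homotopy ends with \<open>s1\<close>. In degree 2 the difference is only shown to be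
  annihilated by \<open>d1\<close>, which is the form used in
  \<open>homotopic_identity\<close>.\<close>

lemma chain_homotopy_exists:
  assumes P: "part_res E0 g0 E1 g1 E2 g2 \<eta> d0 d1"
    and u: "graded_map E0 g0 E0 g0 u0" "graded_map E1 g1 E1 g1 u1" "graded_map E2 g2 E2 g2 u2"
    and comm: "\<And>x. x \<in> free_mod E0 \<Longrightarrow> \<eta> (u0 x) = \<eta> x" "\<And>x. x \<in> free_mod E1 \<Longrightarrow> d0 (u1 x) = u0 (d0 x)"
      "\<And>x. x \<in> free_mod E2 \<Longrightarrow> d1 (u2 x) = u1 (d1 x)"
  shows "\<exists>s0 s1. graded_map E0 g0 E1 g1 s0 \<and> graded_map E1 g1 E2 g2 s1 \<and>
    (\<forall>x\<in>free_mod E1. d0 (u1 x - x - s0 (d0 x)) = 0) \<and> (\<forall>x\<in>free_mod E2. d1 (u2 x - x - s1 (d1 x)) = 0)"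
proof -
  note P = P[unfolded part_res_def]
  have \<eta>: "left_linear smul (\<lambda>a c. \<epsilon> a * c) (free_mod E0) \<eta>"
    using P by simp
  have d: "graded_map E1 g1 E0 g0 d0" "graded_map E2 g2 E1 g1 d1"
    using P by simp_all
  have im: "d0 ` free_mod E1 = {f \<in> free_mod E0. \<eta> f = 0}" "d1 ` free_mod E2 = {f \<in> free_mod E1. d0 f = 0}"
    using P by simp_all
  have ker: "\<And>x. x \<in> free_mod E0 \<Longrightarrow> \<eta> x = 0 \<Longrightarrow> x \<in> d0 ` free_mod E1"
    "\<And>x. x \<in> free_mod E1 \<Longrightarrow> d0 x = 0 \<Longrightarrow> x \<in> d1 ` free_mod E2"
    "\<And>x. x \<in> free_mod E2 \<Longrightarrow> d0 (d1 x) = 0"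
    using im by blast+
  note diff0 = left_linear_diff[OF graded_map_linear[OF d(1)]] and diff1 = left_linear_diff[OF graded_map_linear[OF d(2)]]
  note fm = graded_map_free_mod
  have "\<exists>s. graded_map E0 g0 E1 g1 (ext s) \<and> (\<forall>x\<in>free_mod E0. d0 (ext s x) = u0 x - x)"
  proof (rule lift_map_exact[OF d(1) graded_map_diff[OF u(1) graded_map_ident]])
    fix e assume "e \<in> E0"
    then show "u0 (single e 1) - single e 1 \<in> d0 ` free_mod E1"
      by (intro ker(1)) (simp_all add: free_mod_diff fm[OF u(1)] left_linear_diff[OF \<eta>] comm)
  qed
  then obtain s0 where s0: "graded_map E0 g0 E1 g1 (ext s0)" "\<And>x. x \<in> free_mod E0 \<Longrightarrow> d0 (ext s0 x) = u0 x - x"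
    by blast
  have rel: "d0 (u1 x - x - ext s0 (d0 x)) = 0" if "x \<in> free_mod E1" for x
    using that by (simp add: diff0 free_mod_diff fm[OF u(2)] fm[OF s0(1)] fm[OF d(1)] comm(2) s0(2))
  have "\<exists>s. graded_map E1 g1 E2 g2 (ext s) \<and> (\<forall>x\<in>free_mod E1. d1 (ext s x) = u1 x - x - ext s0 (d0 x))"
  proof (rule lift_map_exact[OF d(2)])
    show "graded_map E1 g1 E1 g1 (\<lambda>x. u1 x - x - ext s0 (d0 x))"
      by (intro graded_map_diff u(2) graded_map_ident graded_map_comp[OF d(1) s0(1)])
    fix e assume "e \<in> E1"
    then show "u1 (single e 1) - single e 1 - ext s0 (d0 (single e 1)) \<in> d1 ` free_mod E2"
      by (intro ker(2) rel) (simp_all add: free_mod_diff fm[OF u(2)] fm[OF s0(1)] fm[OF d(1)])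
  qed
  then obtain s1 where s1: "graded_map E1 g1 E2 g2 (ext s1)"
      "\<And>x. x \<in> free_mod E1 \<Longrightarrow> d1 (ext s1 x) = u1 x - x - ext s0 (d0 x)"
    by blast
  have "d1 (u2 x - x - ext s1 (d1 x)) = 0" if "x \<in> free_mod E2" for x
    using that by (simp add: diff1 free_mod_diff fm[OF u(3)] fm[OF s1(1)] fm[OF d(2)] comm(3) s1(2) ker(3)
        left_linear_zero[OF graded_map_linear[OF s0(1)]])
  with s0(1) s1(1) rel show ?thesis
    by blast
qed

theorem homology_independent_of_resolution:
  assumes P: "part_res E0 g0 E1 g1 E2 g2 \<eta> d0 d1" and Q: "part_res E0' g0' E1' g1' E2' g2' \<eta>' d0' d1'"
  shows "invariant_factors smul (Hz E1 g1 d0 n, Hb E1 g1 d0 n) ds \<Longrightarrow>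
      invariant_factors smul (Hz E1' g1' d0' n, Hb E1' g1' d0' n) ds"
    and "invariant_factors smul (Hz E2 g2 d1 n, Hb E2 g2 d1 n) es \<Longrightarrow>
      invariant_factors smul (Hz E2' g2' d1' n, Hb E2' g2' d1' n) es"
proof -
  obtain h0 h1 h2 where h: "graded_map E0 g0 E0' g0' (ext h0)" "graded_map E1 g1 E1' g1' (ext h1)"
    "graded_map E2 g2 E2' g2' (ext h2)" "\<forall>x\<in>free_mod E0. \<eta>' (ext h0 x) = \<eta> x"
    "\<forall>x\<in>free_mod E1. d0' (ext h1 x) = ext h0 (d0 x)" "\<forall>x\<in>free_mod E2. d1' (ext h2 x) = ext h1 (d1 x)"
    using chain_map_exists[OF P Q] by (elim exE conjE)
  obtain k0 k1 k2 where k: "graded_map E0' g0' E0 g0 (ext k0)" "graded_map E1' g1' E1 g1 (ext k1)"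
    "graded_map E2' g2' E2 g2 (ext k2)" "\<forall>x\<in>free_mod E0'. \<eta> (ext k0 x) = \<eta>' x"
    "\<forall>x\<in>free_mod E1'. d0 (ext k1 x) = ext k0 (d0' x)" "\<forall>x\<in>free_mod E2'. d1 (ext k2 x) = ext k1 (d1' x)"
    using chain_map_exists[OF Q P] by (elim exE conjE)
  have d: "graded_map E1 g1 E0 g0 d0" "graded_map E2 g2 E1 g1 d1"
    "graded_map E1' g1' E0' g0' d0'" "graded_map E2' g2' E1' g1' d1'"
    using P Q by (simp_all add: part_res_def)
  note fm = graded_map_free_mod
  have "\<exists>s0 s1. graded_map E0 g0 E1 g1 s0 \<and> graded_map E1 g1 E2 g2 s1 \<and>
      (\<forall>x\<in>free_mod E1. d0 (ext k1 (ext h1 x) - x - s0 (d0 x)) = 0) \<and>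
      (\<forall>x\<in>free_mod E2. d1 (ext k2 (ext h2 x) - x - s1 (d1 x)) = 0)"
    by (rule chain_homotopy_exists[OF P graded_map_comp[OF h(1) k(1)] graded_map_comp[OF h(2) k(2)] graded_map_comp[OF h(3) k(3)]])
      (simp_all add: fm[OF h(1)] fm[OF h(2)] fm[OF h(3)] fm[OF d(1)] fm[OF d(2)] h(4-6) k(4-6))
  then obtain s0 s1 where s: "graded_map E0 g0 E1 g1 s0" "graded_map E1 g1 E2 g2 s1"
      "\<forall>x\<in>free_mod E1. d0 (ext k1 (ext h1 x) - x - s0 (d0 x)) = 0"
      "\<forall>x\<in>free_mod E2. d1 (ext k2 (ext h2 x) - x - s1 (d1 x)) = 0"
    by (elim exE conjE)
  have "\<exists>s0 s1. graded_map E0' g0' E1' g1' s0 \<and> graded_map E1' g1' E2' g2' s1 \<and>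
      (\<forall>x\<in>free_mod E1'. d0' (ext h1 (ext k1 x) - x - s0 (d0' x)) = 0) \<and>
      (\<forall>x\<in>free_mod E2'. d1' (ext h2 (ext k2 x) - x - s1 (d1' x)) = 0)"
    by (rule chain_homotopy_exists[OF Q graded_map_comp[OF k(1) h(1)] graded_map_comp[OF k(2) h(2)] graded_map_comp[OF k(3) h(3)]])
      (simp_all add: fm[OF k(1)] fm[OF k(2)] fm[OF k(3)] fm[OF d(3)] fm[OF d(4)] h(4-6) k(4-6))
  then obtain t0 t1 where t: "graded_map E0' g0' E1' g1' t0" "graded_map E1' g1' E2' g2' t1"
      "\<forall>x\<in>free_mod E1'. d0' (ext h1 (ext k1 x) - x - t0 (d0' x)) = 0"
      "\<forall>x\<in>free_mod E2'. d1' (ext h2 (ext k2 x) - x - t1 (d1' x)) = 0"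
    by (elim exE conjE)
  show "invariant_factors smul (Hz E1' g1' d0' n, Hb E1' g1' d0' n) ds"
    if "invariant_factors smul (Hz E1 g1 d0 n, Hb E1 g1 d0 n) ds"
    by (rule homotopy_equivalence_invariant_factors[OF d(1,3) h(2,1) h(5) k(2,1) k(5)
          s(1) s(3) t(1) t(3) that])
  show "invariant_factors smul (Hz E2' g2' d1' n, Hb E2' g2' d1' n) es"
    if "invariant_factors smul (Hz E2 g2 d1 n, Hb E2 g2 d1 n) es"
    by (rule homotopy_equivalence_invariant_factors[OF d(2,4) h(3,2) h(6) k(3,2) k(6)
          s(2) s(4) t(2) t(4) that])
qed

end

section \<open>Tor in terms of the reduced complex\<close>

lemma tensor_map_ext: "tensor_map h p = ext (\<lambda>x. single (fst x, h (snd x)) 1) (p :: ('m \<times> 'n) \<Rightarrow>\<^sub>0 'k::comm_ring_1)"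
  by (simp add: tensor_map_def ext_def smul_single case_prod_unfold)

context connected_graded_algebra
begin

text \<open>The isomorphism from \<open>k \<otimes> F\<close>, in terms of representatives, to the free \<open>k\<close>-module on the
  basis of \<open>F\<close>.\<close>

definition Theta :: "(('k \<times> ('e \<Rightarrow>\<^sub>0 'a)) \<Rightarrow>\<^sub>0 'k) \<Rightarrow> ('e \<Rightarrow>\<^sub>0 'k)" where
  "Theta = ext (\<lambda>x. smul (fst x) (augF (snd x)))"

lemma Theta_tens: "Theta (tens c f) = smul c (augF f)"
  by (simp add: Theta_def tens_def)

lemma Theta_linear: "Theta (p + q) = Theta p + Theta q" "Theta (smul c p) = smul c (Theta p)"
  "Theta (p - q) = Theta p - Theta q"
  by (simp_all add: Theta_def ext_add ext_smul ext_diff)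

lemma module_hom_Theta: "module_hom smul smul Theta"
  unfolding Theta_def by (rule module_hom_ext)

lemma Theta_kgr:
  assumes "keys p \<subseteq> UNIV \<times> Fgr E ge n"
  shows "Theta p \<in> kgr E ge n"
  unfolding Theta_def ext_def using assms
  by (intro sm.subspace_sum[OF subspace_kgr] sm.subspace_scale[OF subspace_kgr] augF_kgr) auto

lemma Theta_tensor_map:
  assumes D: "graded_map E ge E' ge' D" and p: "keys p \<subseteq> UNIV \<times> free_mod E"
  shows "Theta (tensor_map D p) = kmap D (Theta p)"
proof -
  \<comment> \<open>\<open>D\<close> is controlled only on \<open>free_mod E\<close>; this map
    agrees with it there and is linear everywhere.\<close>
  let ?D = "ext (\<lambda>e. D (single e 1))"
  have ext: "?D f = D f" if "f \<in> free_mod E" for f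
    using graded_map_expand[OF D that] by (simp add: ext_def)
  interpret module_hom smul smul "kmap ?D"
    by (rule module_hom_kmap_ext)
  have D': "graded_map E ge E' ge' ?D"
    by (rule graded_map_ext[OF graded_map_single[OF D]])
  have fm: "inc (Theta p) \<in> free_mod E"
  proof -
    have "Theta p \<in> {v. \<forall>e. e \<notin> E \<longrightarrow> lookup v e = 0}"
      unfolding Theta_def ext_def
    proof (rule sm.subspace_sum)
      show "sm.subspace {v. \<forall>e. e \<notin> E \<longrightarrow> lookup v e = 0}"
        by (rule sm.subspaceI) (auto simp: lookup_add lookup_smul)
      fix x assume "x \<in> keys p"
      then have "snd x \<in> free_mod E"
        using p by auto
      then show "smul (lookup p x) (smul (fst x) (augF (snd x))) \<in> {v. \<forall>e. e \<notin> E \<longrightarrow> lookup v e = 0}"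
        by (simp add: lookup_smul lookup_augF free_mod_iff)
    qed
    then show ?thesis
      by (simp add: free_mod_iff lookup_inc)
  qed
  have "kmap D (Theta p) = kmap ?D (Theta p)"
    by (simp add: kmap_def ext[OF fm])
  also have "\<dots> = (\<Sum>x\<in>keys p. smul (lookup p x) (smul (fst x) (kmap ?D (augF (snd x)))))"
    by (simp add: Theta_def ext_def[of "\<lambda>x. smul (fst x) (augF (snd x))"] sum scale)
  also have "\<dots> = (\<Sum>x\<in>keys p. smul (lookup p x) (Theta (single (fst x, D (snd x)) 1)))"
  proof (intro sum.cong refl arg_cong[of _ _ "smul _"])
    fix x assume "x \<in> keys p"
    then have "snd x \<in> free_mod E"
      using p by auto
    then show "smul (fst x) (kmap ?D (augF (snd x))) = Theta (single (fst x, D (snd x)) 1)"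
      by (simp add: kmap_augF[OF D'] ext Theta_def)
  qed
  also have "\<dots> = Theta (tensor_map D p)"
    by (simp add: tensor_map_ext ext_def[of "\<lambda>x. single (fst x, D (snd x)) 1"] Theta_def ext_sum ext_smul)
  finally show ?thesis
    by simp
qed

lemma Theta_tor_rel:
  assumes "p \<in> tor_rel scale gr deg E i"
  shows "Theta p = 0"
proof -
  have "tor_rel scale gr deg E i \<subseteq> {p. Theta p = 0}"
    unfolding tor_rel_def tensor_rel_def
  proof (rule sm.span_minimal)
    show "sm.subspace {p. Theta p = 0}"
      by (rule sm.subspaceI) (simp_all add: Theta_linear, simp add: Theta_def)
  qed (auto simp: Theta_linear Theta_tens augF_add augF_smul smul_add smul_add_left smul_smul mult.assoc)
  then show ?thesis
    using assms by blast
qed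

lemma subspace_tor_rel: "sm.subspace (tor_rel scale gr deg E i)"
  by (simp add: tor_rel_def tensor_rel_def)

text \<open>A normal form for elementary tensors: the coefficients of \<open>f\<close> move across
  the tensor sign and become scalars, which leaves a combination of the tensors of \<open>1\<close>
  with basis elements. This gives injectivity of \<open>Theta\<close> modulo the relations.\<close>

lemma tens_reduce:
  assumes f: "f \<in> free_mod (E i)"
  shows "tens c f - ext (\<lambda>e. tens 1 (single e 1)) (smul c (augF f)) \<in> tor_rel scale gr deg E i"
proof -
  let ?R = "tor_rel scale gr deg E i"
  let ?S = "ext (\<lambda>e. tens 1 (single e 1))"
  note sub = sm.subspace_add[OF subspace_tor_rel[of E i]] sm.subspace_diff[OF subspace_tor_rel[of E i]]
  have add: "tens x (y + y') - tens x y - tens x y' \<in> ?R" if "y \<in> free_mod (E i)" "y' \<in> free_mod (E i)" for x y y'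
    unfolding tor_rel_def tensor_rel_def using that by (intro sm.span_base) blast
  have sc: "tens (b * x) y - smul b (tens x y) \<in> ?R" if "y \<in> free_mod (E i)" for b x y
    unfolding tor_rel_def tensor_rel_def using that by (intro sm.span_base) blast
  have bal: "tens (x * \<epsilon> a) y - tens x (smul a y) \<in> ?R" if "y \<in> free_mod (E i)" for x a y
    unfolding tor_rel_def tensor_rel_def using that by (intro sm.span_base) blast
  have one: "tens 1 f - ?S (augF f) \<in> ?R" if f: "f \<in> free_mod (E i)" for f
  proof -
    have "tens 1 (\<Sum>e\<in>S. single e (lookup f e)) - ?S (augF (\<Sum>e\<in>S. single e (lookup f e))) \<in> ?R"
      if "finite S" "S \<subseteq> E i" for S
      using that
    proof (induction S)
      case empty
      \<comment> \<open>Additivity for \<open>0 + 0\<close> shows that \<open>tens 1 0\<close> is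
        itself a relation.\<close>
      show ?case
        using sm.subspace_neg[OF subspace_tor_rel add[of 0 0 1]] by simp
    next
      case (insert e S)
      let ?g = "\<Sum>e\<in>S. single e (lookup f e)" and ?a = "lookup f e"
      have e: "single e b \<in> free_mod (E i)" for b
        using insert by simp
      have g: "?g \<in> free_mod (E i)"
        using insert by (intro free_mod_sum) auto
      have IH: "tens 1 ?g - ?S (augF ?g) \<in> ?R"
        using insert by simp
      \<comment> \<open>Additivity splits off the new term; the balancing relation turns its
        coefficient into \<open>\<epsilon> ?a\<close>, and the scalar relation moves this to the
        front.\<close>
      have "tens 1 (single e ?a + ?g) - ?S (augF (single e ?a + ?g)) =
        ((tens 1 (single e ?a + ?g) - tens 1 (single e ?a) - tens 1 ?g) + (tens 1 ?g - ?S (augF ?g))) +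
        ((tens (\<epsilon> ?a * 1) (single e 1) - smul (\<epsilon> ?a) (tens 1 (single e 1))) -
         (tens (1 * \<epsilon> ?a) (single e 1) - tens 1 (smul ?a (single e 1))))"
        by (simp add: augF_add ext_add smul_single)
      also have "\<dots> \<in> ?R"
        by (rule sub(1)[OF sub(1)[OF add[OF e g] IH] sub(2)[OF sc[OF e] bal[OF e]]])
      finally show ?case
        using insert by simp
    qed
    from this[of "keys f"] show ?thesis
      using f pm_expand[of "keys f" f] by (simp add: free_mod_def)
  qed
  have "tens c f - ?S (smul c (augF f)) =
      (tens (1 * \<epsilon> (scale c 1)) f - tens 1 (smul (scale c 1) f)) +
      (tens 1 (smul (scale c 1) f) - ?S (augF (smul (scale c 1) f)))"
    by (simp add: aug_scale augF_smul)
  also have "\<dots> \<in> ?R"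
    by (rule sub(1)[OF bal[OF f] one[OF free_mod_smul[OF f]]])
  finally show ?thesis .
qed

text \<open>Summing \<open>tens_reduce\<close> over the terms of \<open>p\<close> shows that
  \<open>p\<close> is congruent to a combination of basis tensors determined by
  \<open>Theta p\<close>.\<close>

lemma tor_rel_iff:
  assumes "keys p \<subseteq> UNIV \<times> free_mod (E i)"
  shows "p \<in> tor_rel scale gr deg E i \<longleftrightarrow> Theta p = 0"
proof
  assume zero: "Theta p = 0"
  let ?S = "ext (\<lambda>e. tens 1 (single e 1))" and ?th = "\<lambda>x. smul (fst x) (augF (snd x))"
  have "(\<Sum>x\<in>keys p. smul (lookup p x) (tens (fst x) (snd x) - ?S (?th x))) \<in> tor_rel scale gr deg E i"
    using assms by (intro sm.subspace_sum[OF subspace_tor_rel] sm.subspace_scale[OF subspace_tor_rel] tens_reduce) auto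
  also have "(\<Sum>x\<in>keys p. smul (lookup p x) (tens (fst x) (snd x) - ?S (?th x))) = p - ?S (Theta p)"
    using pm_expand[of "keys p" p]
    by (simp add: smul_diff sum_subtractf tens_def smul_single Theta_def ext_def[of ?th] ext_sum ext_smul)
  finally show "p \<in> tor_rel scale gr deg E i"
    by (simp add: zero)
qed (rule Theta_tor_rel)

lemma subspace_tor_chains: "sm.subspace (tor_chains scale gr E ge i n)"
proof (rule sm.subspaceI)
  fix p q assume "p \<in> tor_chains scale gr E ge i n" "q \<in> tor_chains scale gr E ge i n"
  then show "p + q \<in> tor_chains scale gr E ge i n"
    using keys_add[of p q] by (auto simp: tor_chains_def)
next
  fix c p assume "p \<in> tor_chains scale gr E ge i n"
  moreover have "keys (smul c p) \<subseteq> keys p"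
    by (auto simp: in_keys_iff lookup_smul)
  ultimately show "smul c p \<in> tor_chains scale gr E ge i n"
    by (auto simp: tor_chains_def)
qed (simp add: tor_chains_def)

lemma tor_chains_free_mod: "p \<in> tor_chains scale gr E ge i n \<Longrightarrow> keys p \<subseteq> UNIV \<times> free_mod (E i)"
  by (auto simp: tor_chains_def dest: Fgr_free_mod)

lemma tensor_map_free_mod:
  assumes "graded_map E ge E' ge' D" "keys p \<subseteq> UNIV \<times> free_mod E"
  shows "keys (tensor_map D p) \<subseteq> UNIV \<times> free_mod E'"
  unfolding tensor_map_ext ext_def using assms(2) graded_map_free_mod[OF assms(1)]
  by (intro keys_sum_subset) (auto simp: smul_single)

lemma tens_inc_chain: "v \<in> kgr (E i) (ge i) n \<Longrightarrow> tens 1 (inc v) \<in> tor_chains scale gr E ge i n"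
  by (simp add: tens_def tor_chains_def inc_Fgr)

context
  fixes E :: "nat \<Rightarrow> 'e set" and ge :: "nat \<Rightarrow> 'e \<Rightarrow> 'g" and d :: "nat \<Rightarrow> ('e \<Rightarrow>\<^sub>0 'a) \<Rightarrow> ('e \<Rightarrow>\<^sub>0 'a)"
    and \<eta> :: "('e \<Rightarrow>\<^sub>0 'a) \<Rightarrow> 'k"
  assumes F: "graded_free_resolution scale gr deg E ge d \<eta>"
begin

lemma tor_cycles_eq:
  "fst (Tor scale gr deg E ge d (Suc j) n) =
    {p \<in> tor_chains scale gr E ge (Suc j) n. Theta p \<in> Hz (E (Suc j)) (ge (Suc j)) (d j) n}"
proof -
  note D = resolution_part_res(2)[OF F]
  have "tensor_map (d j) p \<in> tor_rel scale gr deg E j \<longleftrightarrow> Theta p \<in> Hz (E (Suc j)) (ge (Suc j)) (d j) n"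
    if p: "p \<in> tor_chains scale gr E ge (Suc j) n" for p
    using Theta_kgr[of p "E (Suc j)" "ge (Suc j)" n] p
    by (simp add: tor_rel_iff[where E = E and i = j, OF tensor_map_free_mod[OF D tor_chains_free_mod[OF p]]]
        Theta_tensor_map[OF D tor_chains_free_mod[OF p]] Hz_def tor_chains_def)
  then show ?thesis
    by (auto simp: Tor_def)
qed

text \<open>By exactness, an element of degree \<open>n\<close> is killed by \<open>d j\<close> if
  and only if it is the image of some element; \<open>graded_lift\<close> makes that element
  homogeneous of degree \<open>n\<close>. Reducing both descriptions gives the boundaries.\<close>

lemma tor_boundaries_eq:
  "snd (Tor scale gr deg E ge d (Suc j) n) =
    {p \<in> tor_chains scale gr E ge (Suc j) n. Theta p \<in> Hb (E (Suc j)) (ge (Suc j)) (d j) n}"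
proof -
  let ?i = "Suc j"
  note D = resolution_part_res(2)[OF F]
  have exact: "d ?i ` free_mod (E (Suc ?i)) = {f \<in> free_mod (E ?i). d j f = 0}"
    using F by (simp add: graded_free_resolution_def)
  have "(\<exists>q\<in>tor_chains scale gr E ge (Suc ?i) n. p - tensor_map (d ?i) q \<in> tor_rel scale gr deg E ?i) \<longleftrightarrow>
      Theta p \<in> Hb (E ?i) (ge ?i) (d j) n" if p: "p \<in> tor_chains scale gr E ge ?i n" for p
  proof -
    have rel: "p - tensor_map (d ?i) q \<in> tor_rel scale gr deg E ?i \<longleftrightarrow> Theta p = kmap (d ?i) (Theta q)"
      if q: "q \<in> tor_chains scale gr E ge (Suc ?i) n" for q
    proof -
      note qf = tor_chains_free_mod[OF q]
      have "keys (p - tensor_map (d ?i) q) \<subseteq> keys p \<union> keys (tensor_map (d ?i) q)"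
        by (auto simp: in_keys_iff lookup_minus)
      then have "keys (p - tensor_map (d ?i) q) \<subseteq> UNIV \<times> free_mod (E ?i)"
        using tensor_map_free_mod[OF D qf] tor_chains_free_mod[OF p] by blast
      then show ?thesis
        by (simp add: tor_rel_iff Theta_linear Theta_tensor_map[OF D qf])
    qed
    show ?thesis
    proof
      assume "\<exists>q\<in>tor_chains scale gr E ge (Suc ?i) n. p - tensor_map (d ?i) q \<in> tor_rel scale gr deg E ?i"
      then obtain q where q: "q \<in> tor_chains scale gr E ge (Suc ?i) n" "Theta p = kmap (d ?i) (Theta q)"
        using rel by blast
      have "inc (Theta q) \<in> Fgr (E (Suc ?i)) (ge (Suc ?i)) n"
        using q(1) by (intro inc_Fgr Theta_kgr) (simp add: tor_chains_def)
      then have "d ?i (inc (Theta q)) \<in> Fgr (E ?i) (ge ?i) n" "d j (d ?i (inc (Theta q))) = 0"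
        using graded_map_Fgr[OF D] exact Fgr_free_mod by blast+
      then show "Theta p \<in> Hb (E ?i) (ge ?i) (d j) n"
        by (auto simp: Hb_def q(2) kmap_def)
    next
      assume "Theta p \<in> Hb (E ?i) (ge ?i) (d j) n"
      then obtain w where w: "w \<in> Fgr (E ?i) (ge ?i) n" "d j w = 0" "Theta p = augF w"
        by (auto simp: Hb_def)
      then have "w \<in> d ?i ` free_mod (E (Suc ?i))"
        using exact Fgr_free_mod by blast
      then obtain y where y: "y \<in> Fgr (E (Suc ?i)) (ge (Suc ?i)) n" "d ?i y = w"
        using graded_lift[OF D w(1)] by blast
      have "tens 1 y \<in> tor_chains scale gr E ge (Suc ?i) n"
        using y(1) by (simp add: tens_def tor_chains_def)
      moreover have "Theta p = kmap (d ?i) (Theta (tens 1 y))"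
        by (simp add: Theta_tens kmap_augF[OF D Fgr_free_mod[OF y(1)]] y(2) w(3))
      ultimately show "\<exists>q\<in>tor_chains scale gr E ge (Suc ?i) n. p - tensor_map (d ?i) q \<in> tor_rel scale gr deg E ?i"
        using rel by blast
    qed
  qed
  then show ?thesis
    by (auto simp: Tor_def)
qed

lemma subspace_Tor:
  "sm.subspace (fst (Tor scale gr deg E ge d (Suc j) n))" "sm.subspace (snd (Tor scale gr deg E ge d (Suc j) n))"
  "snd (Tor scale gr deg E ge d (Suc j) n) \<subseteq> fst (Tor scale gr deg E ge d (Suc j) n)"
proof -
  note D = resolution_part_res(2)[OF F]
  interpret module_hom smul smul "Theta :: _ \<Rightarrow> ('e \<Rightarrow>\<^sub>0 'k)"
    by (rule module_hom_Theta)
  have "sm.subspace {p \<in> tor_chains scale gr E ge (Suc j) n. Theta p \<in> S}" if "sm.subspace S" for S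
    using sm.subspace_inter[OF subspace_tor_chains[of E ge "Suc j" n] subspace_vimage[OF that]]
    by (simp add: vimage_def Int_def)
  then show "sm.subspace (fst (Tor scale gr deg E ge d (Suc j) n))" "sm.subspace (snd (Tor scale gr deg E ge d (Suc j) n))"
    unfolding tor_cycles_eq tor_boundaries_eq using subspace_Hz[OF D] subspace_Hb[OF D] by blast+
  show "snd (Tor scale gr deg E ge d (Suc j) n) \<subseteq> fst (Tor scale gr deg E ge d (Suc j) n)"
    unfolding tor_cycles_eq tor_boundaries_eq using Hb_subset_Hz[OF D] by blast
qed

lemma Tor_invariant_factors:
  assumes "invariant_factors smul (Tor scale gr deg E ge d (Suc j) n) ds"
  shows "invariant_factors smul (Hz (E (Suc j)) (ge (Suc j)) (d j) n, Hb (E (Suc j)) (ge (Suc j)) (d j) n) ds"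
proof -
  note D = resolution_part_res(2)[OF F]
  let ?Z = "fst (Tor scale gr deg E ge d (Suc j) n)" and ?B = "snd (Tor scale gr deg E ge d (Suc j) n)"
  have inv: "invariant_factors smul (?Z, ?B) ds"
    using assms by simp
  show ?thesis
  proof (rule invariant_factors_transfer[OF inv module_smul subspace_Tor(1) module_hom_Theta])
    show "Theta z \<in> Hb (E (Suc j)) (ge (Suc j)) (d j) n \<longleftrightarrow> z \<in> ?B" if "z \<in> ?Z" for z
      using that by (simp add: tor_cycles_eq tor_boundaries_eq)
    show "\<exists>z\<in>?Z. v - Theta z \<in> Hb (E (Suc j)) (ge (Suc j)) (d j) n"
      if v: "v \<in> Hz (E (Suc j)) (ge (Suc j)) (d j) n" for v
    proof
      show "tens 1 (inc v) \<in> ?Z"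
        using v by (simp add: tor_cycles_eq Theta_tens) (simp add: Hz_def tens_inc_chain)
      show "v - Theta (tens 1 (inc v)) \<in> Hb (E (Suc j)) (ge (Suc j)) (d j) n"
        by (simp add: Theta_tens sm.subspace_0[OF subspace_Hb[OF D]])
    qed
  qed (simp_all add: tor_cycles_eq subspace_Hb[OF D] subspace_Tor(3)[unfolded tor_cycles_eq])
qed

end

end

section \<open>Presentations and the Fox resolution\<close>

abbreviation gen_word :: "'x \<Rightarrow> 'x word \<Rightarrow>\<^sub>0 'k::comm_ring_1" where
  "gen_word x \<equiv> single (Word [x]) 1"

definition wdeg :: "('x \<Rightarrow> 'g::comm_monoid_add) \<Rightarrow> 'x word \<Rightarrow> 'g" where
  "wdeg gx w = sum_list (map gx (letters w))"

lemma wdeg_plus: "wdeg gx (u + v) = wdeg gx u + wdeg gx v"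
  by (simp add: wdeg_def plus_word_def)

lemma wdeg_zero [simp]: "wdeg gx 0 = 0"
  by (simp add: wdeg_def zero_word_def)

lemma letters_zero [simp]: "letters 0 = []"
  by (simp add: zero_word_def)

lemma word_neq_zero_iff: "w \<noteq> 0 \<longleftrightarrow> letters w \<noteq> []"
  by (cases w) (simp add: zero_word_def)

lemma word_snoc: "w \<noteq> 0 \<Longrightarrow> Word (butlast (letters w)) + Word [last (letters w)] = w"
  by (cases w) (simp add: zero_word_def plus_word_def)

lemma free_alg_iff: "p \<in> free_alg X \<longleftrightarrow> (\<forall>w. \<not> set (letters w) \<subseteq> X \<longrightarrow> lookup p w = 0)"
  by (auto simp: free_alg_def in_keys_iff)

lemma free_alg_gr_iff:
  "p \<in> free_alg_gr X gx n \<longleftrightarrow> p \<in> free_alg X \<and> (\<forall>w. wdeg gx w \<noteq> n \<longrightarrow> lookup p w = 0)"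
  by (auto simp: free_alg_gr_def wdeg_def in_keys_iff)

lemma free_alg_add: "p \<in> free_alg X \<Longrightarrow> q \<in> free_alg X \<Longrightarrow> p + q \<in> free_alg X"
  by (simp add: free_alg_iff lookup_add)

lemma free_alg_diff: "p \<in> free_alg X \<Longrightarrow> q \<in> free_alg X \<Longrightarrow> p - q \<in> free_alg X"
  by (simp add: free_alg_iff lookup_minus)

lemma free_alg_smul: "p \<in> free_alg X \<Longrightarrow> smul c p \<in> free_alg X"
  by (simp add: free_alg_iff lookup_smul)

lemma free_alg_zero [simp]: "0 \<in> free_alg X"
  by (simp add: free_alg_iff)

lemma free_alg_sum: "(\<And>i. i \<in> I \<Longrightarrow> f i \<in> free_alg X) \<Longrightarrow> (\<Sum>i\<in>I. f i) \<in> free_alg X"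
  by (simp add: free_alg_iff lookup_sum)

lemma free_alg_single: "set (letters w) \<subseteq> X \<Longrightarrow> single w c \<in> free_alg X"
  by (auto simp: free_alg_iff lookup_single when_def)

lemma free_alg_gen [simp]: "x \<in> X \<Longrightarrow> gen_word x \<in> free_alg X"
  by (simp add: free_alg_single)

lemma free_alg_mult:
  assumes "p \<in> free_alg X" "q \<in> free_alg X"
  shows "p * q \<in> free_alg X"
proof -
  have "set (letters w) \<subseteq> X" if w: "w \<in> keys (p * q)" for w
  proof -
    obtain u v where "u \<in> keys p" "v \<in> keys q" "w = u + v"
      using keys_mult[of p q] w by blast
    then show ?thesis
      using assms by (auto simp: free_alg_def plus_word_def)
  qed
  then show ?thesis
    by (simp add: free_alg_def)
qed

lemma single_zero_word: "single 0 c = smul c (1 :: 'x word \<Rightarrow>\<^sub>0 'k::comm_ring_1)"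
  by (rule poly_mapping_eqI) (simp add: lookup_single lookup_smul lookup_one when_def)

lemma smul_mult: "smul c p * q = smul c (p * q :: 'x word \<Rightarrow>\<^sub>0 'k::comm_ring_1)"
proof -
  have smul: "smul c q = single 0 c * q" for q :: "'x word \<Rightarrow>\<^sub>0 'k"
  proof (rule poly_mapping_eqI)
    fix w
    have "single 0 c * q = single 0 c * (\<Sum>v\<in>keys q. single v (lookup q v))"
      using pm_expand[of "keys q" q] by simp
    also have "\<dots> = (\<Sum>v\<in>keys q. single v (c * lookup q v))"
      by (simp add: sum_distrib_left mult_single)
    also have "\<dots> = smul c (\<Sum>v\<in>keys q. single v (lookup q v))"
      by (simp add: smul_sum smul_single)
    also have "\<dots> = smul c q"
      using pm_expand[of "keys q" q] by simp
    finally show "lookup (smul c q) w = lookup (single 0 c * q) w"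
      by simp
  qed
  show ?thesis
    by (simp add: smul mult.assoc)
qed

lemma free_alg_one [simp]: "1 \<in> free_alg X"
  by (simp add: free_alg_iff lookup_one zero_word_def when_def)

lemma free_alg_induct [consumes 1, case_names single add]:
  assumes "p \<in> free_alg X" "\<And>w c. set (letters w) \<subseteq> X \<Longrightarrow> P (single w c)"
    "\<And>p q. p \<in> free_alg X \<Longrightarrow> q \<in> free_alg X \<Longrightarrow> P p \<Longrightarrow> P q \<Longrightarrow> P (p + q)"
  shows "P p"
proof -
  have "P (\<Sum>w\<in>S. single w (lookup p w)) \<and> (\<Sum>w\<in>S. single w (lookup p w)) \<in> free_alg X"
    if "finite S" "S \<subseteq> keys p" for S
    using that
  proof (induction S)
    case empty
    have "P (single (Word []) 0)"
      by (rule assms(2)) simp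
    then show ?case
      by simp
  next
    case (insert w S)
    then have "set (letters w) \<subseteq> X"
      using assms(1) by (auto simp: free_alg_def)
    then show ?case
      using insert by (simp add: assms(2,3) free_alg_single free_alg_add)
  qed
  from this[of "keys p"] show ?thesis
    using pm_expand[of "keys p" p] by simp
qed

lemma lookup_mult_gen_zero [simp]: "lookup (p * gen_word x) 0 = 0"
proof -
  have "0 \<notin> keys (p * gen_word x)"
    using keys_mult[of p "gen_word x"] by (auto simp: zero_word_def plus_word_def split: if_splits)
  then show ?thesis
    by (simp add: in_keys_iff)
qed

text \<open>The counterpart of \<open>pr\<close> on the free algebra, to which it corresponds under
  a graded homomorphism (\<open>\<phi>_restr\<close>).\<close>

definition restr :: "('x \<Rightarrow> 'g::comm_monoid_add) \<Rightarrow> 'g set \<Rightarrow> ('x word \<Rightarrow>\<^sub>0 'k::comm_ring_1) \<Rightarrow> ('x word \<Rightarrow>\<^sub>0 'k)" where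
  "restr gx S p = (\<Sum>w\<in>keys p. single w (if wdeg gx w \<in> S then lookup p w else 0))"

lemma lookup_restr: "lookup (restr gx S p) w = (if wdeg gx w \<in> S then lookup p w else 0)"
  by (cases "w \<in> keys p") (simp_all add: restr_def lookup_sum lookup_single when_def in_keys_iff)

lemma restr_free_alg: "p \<in> free_alg X \<Longrightarrow> restr gx S p \<in> free_alg X"
  by (simp add: free_alg_iff lookup_restr)

lemma restr_add: "restr gx S (p + q) = restr gx S p + restr gx S q"
  by (rule poly_mapping_eqI) (simp add: lookup_restr lookup_add)

lemma restr_single: "restr gx S (single w c) = (if wdeg gx w \<in> S then single w c else 0)"
  by (rule poly_mapping_eqI) (auto simp: lookup_restr lookup_single when_def)

lemma restr_singleton_gr: "p \<in> free_alg X \<Longrightarrow> restr gx {n} p \<in> free_alg_gr X gx n"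
  by (simp add: free_alg_gr_iff restr_free_alg lookup_restr)

section \<open>Decomposable elements and evaluation of noncommutative polynomials\<close>

context connected_graded_algebra
begin

text \<open>The square of the augmentation ideal. The augmentation ideal modulo its square is
  Tor_1.\<close>

definition decomposables :: "'a set" where
  "decomposables = span {a * b | a b. \<epsilon> a = 0 \<and> \<epsilon> b = 0}"

text \<open>A homogeneous component of an element of augmentation zero vanishes unless its integer
  degree is positive. Hence both factors have degrees strictly below that of the product, as
  inductions on the degree require.\<close>

lemma cmp_decomposables:
  assumes "a \<in> decomposables"
  shows "cmp n a \<in> span {x * y | x y m l. x \<in> gr m \<and> y \<in> gr l \<and> m + l = n \<and> 0 < deg m \<and> 0 < deg l}"
    (is "_ \<in> span ?D")
  using assms unfolding decomposables_def
proof (induction rule: span_induct_alt)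
  case (step c a b)
  obtain x y where a: "a = x * y" "\<epsilon> x = 0" "\<epsilon> y = 0"
    using step(1) by blast
  have pos: "0 < deg m" if "\<epsilon> x = 0" "cmp m x \<noteq> 0" for m x
    using that cmp_nonpos[of m x] by (cases "m = 0") (auto simp: cmp_zero_eq not_le[symmetric])
  have "a = (\<Sum>m | cmp m x \<noteq> 0. cmp m x) * (\<Sum>l | cmp l y \<noteq> 0. cmp l y)"
    by (simp add: a cmp_props)
  also have "\<dots> = (\<Sum>m | cmp m x \<noteq> 0. \<Sum>l | cmp l y \<noteq> 0. cmp m x * cmp l y)"
    by (rule sum_product)
  finally have "cmp n a = (\<Sum>m | cmp m x \<noteq> 0. \<Sum>l | cmp l y \<noteq> 0. if n = m + l then cmp m x * cmp l y else 0)"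
    by (simp add: cmp_sum cmp_gr[OF mult_gr[OF cmp_props(1) cmp_props(1)]])
  also have "\<dots> \<in> span ?D"
  proof (intro span_sum)
    fix m l assume "m \<in> {m. cmp m x \<noteq> 0}" "l \<in> {l. cmp l y \<noteq> 0}"
    then have ml: "0 < deg m" "0 < deg l"
      using pos a by simp_all
    show "(if n = m + l then cmp m x * cmp l y else 0) \<in> span ?D"
    proof (cases "n = m + l")
      case True
      then have "cmp m x * cmp l y \<in> ?D"
        using ml cmp_props(1)[of m x] cmp_props(1)[of l y] by blast
      then show ?thesis
        using True by (simp add: span_base)
    qed (simp add: span_zero)
  qed
  finally show ?case
    using step(2) by (simp add: cmp_add cmp_scale span_add span_scale)
qed (simp add: span_zero)

text \<open>The graded Nakayama lemma for algebras, by induction on the integer degree: modulo an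
  element of \<open>S\<close>, an element of \<open>gr n\<close> is a combination of products whose
  factors have smaller degree and so lie in \<open>S\<close>.\<close>

lemma subalgebra_eq_UNIV:
  assumes S: "subspace S" "1 \<in> S" "\<And>x y. x \<in> S \<Longrightarrow> y \<in> S \<Longrightarrow> x * y \<in> S"
    and gen: "\<And>n a. 0 < deg n \<Longrightarrow> a \<in> gr n \<Longrightarrow> \<exists>s\<in>S \<inter> gr n. a - s \<in> decomposables"
  shows "S = UNIV"
proof -
  have "gr n \<subseteq> S" for n
  proof (induction "nat (deg n)" arbitrary: n rule: less_induct)
    case less
    show ?case
    proof
      fix a assume a: "a \<in> gr n"
      show "a \<in> S"
      proof (cases "0 < deg n")
        case True
        obtain s where s: "s \<in> S" "s \<in> gr n" "a - s \<in> decomposables"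
          using gen[OF True a] by blast
        have "x * y \<in> S" if "x \<in> gr m" "y \<in> gr l" "m + l = n" "0 < deg m" "0 < deg l" for x y m l
        proof -
          have "deg m < deg n" "deg l < deg n"
            using that deg_add[of m l] by auto
          then show ?thesis
            using that less[of m] less[of l] by (intro S(3)) auto
        qed
        then have "span {x * y | x y m l. x \<in> gr m \<and> y \<in> gr l \<and> m + l = n \<and> 0 < deg m \<and> 0 < deg l} \<subseteq> S"
          by (intro span_minimal S(1)) blast
        moreover have "cmp n (a - s) = a - s"
          using cmp_gr[OF subspace_diff[OF subspace_gr a s(2)], of n] by simp
        ultimately have "a - s \<in> S"
          using cmp_decomposables[OF s(3), of n] by auto
        then show ?thesis
          using subspace_add[OF S(1) _ s(1)] by fastforce
      next
        case False
        show ?thesis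
        proof (cases "n = 0")
          case True
          then have "a = scale (\<epsilon> a) 1"
            using cmp_gr[OF a, of 0] cmp_zero_eq[of a] by simp
          then show ?thesis
            using subspace_scale[OF S(1,2)] by metis
        next
          case n: False
          then have "a = 0"
            using gr_nonpos[OF a] False by simp
          then show ?thesis
            by (simp add: subspace_0[OF S(1)])
        qed
      qed
    qed
  qed
  then have "a \<in> S" for a
    by (induction a rule: homogeneous_induct) (auto intro: subspace_add[OF S(1)])
  then show ?thesis
    by blast
qed

definition eval :: "('x \<Rightarrow> 'a) \<Rightarrow> ('x word \<Rightarrow>\<^sub>0 'k) \<Rightarrow> 'a" where
  "eval a p = (\<Sum>w\<in>keys p. scale (lookup p w) (prod_list (map a (letters w))))"

lemma eval_superset:
  "finite S \<Longrightarrow> keys p \<subseteq> S \<Longrightarrow> eval a p = (\<Sum>w\<in>S. scale (lookup p w) (prod_list (map a (letters w))))"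
  unfolding eval_def by (intro sum.mono_neutral_left) (auto simp: in_keys_iff)

lemma eval_single: "eval a (single w c) = scale c (prod_list (map a (letters w)))"
  by (simp add: eval_def)

lemma eval_gen: "eval a (gen_word x) = a x"
  by (simp add: eval_single)

lemma eval_one: "eval a 1 = 1"
  using eval_single[of a 0 1] by simp

lemma eval_add: "eval a (p + q) = eval a p + eval a q"
proof -
  let ?S = "keys p \<union> keys q"
  have "eval a (p + q) = (\<Sum>w\<in>?S. scale (lookup (p + q) w) (prod_list (map a (letters w))))"
    using keys_add[of p q] by (intro eval_superset) auto
  also have "\<dots> = eval a p + eval a q"
    by (simp add: eval_superset[of ?S] lookup_add scale_left_distrib sum.distrib)
  finally show ?thesis .
qed

lemma eval_smul: "eval a (smul c p) = scale c (eval a p)"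
proof -
  have "eval a (smul c p) = (\<Sum>w\<in>keys p. scale (lookup (smul c p) w) (prod_list (map a (letters w))))"
    by (rule eval_superset) (auto simp: in_keys_iff lookup_smul)
  then show ?thesis
    by (simp add: eval_def lookup_smul scale_sum_right)
qed

lemma eval_mult: "eval a (p * q) = eval a p * eval a q"
proof -
  have UNIV: "p \<in> free_alg UNIV" for p :: "'x word \<Rightarrow>\<^sub>0 'k"
    by (simp add: free_alg_iff)
  show ?thesis
    using UNIV[of p]
  proof (induction p rule: free_alg_induct)
    case (single u b)
    show ?case
      using UNIV[of q]
    proof (induction q rule: free_alg_induct)
      case (single v c)
      show ?case
        by (simp add: mult_single eval_single plus_word_def scale_mult_left scale_mult_right mult.commute[of b c])
    qed (simp add: distrib_left eval_add)
  qed (simp add: distrib_right eval_add)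
qed

lemma eval_gr:
  assumes "\<And>x. x \<in> X \<Longrightarrow> a x \<in> gr (gx x)" "p \<in> free_alg_gr X gx n"
  shows "eval a p \<in> gr n"
  unfolding eval_def
proof (intro subspace_sum[OF subspace_gr] subspace_scale[OF subspace_gr])
  have *: "prod_list (map a xs) \<in> gr (sum_list (map gx xs))" if "set xs \<subseteq> X" for xs
    using that by (induction xs) (auto simp: one_gr intro!: mult_gr assms(1))
  fix w assume "w \<in> keys p"
  then show "prod_list (map a (letters w)) \<in> gr n"
    using *[of "letters w"] assms(2) by (auto simp: free_alg_gr_def free_alg_def)
qed

end

text \<open>A presentation with its relations left open, so that the family of all relations and a
  smaller family can be studied over the same \<open>\<phi>\<close>.\<close>

locale generated_algebra = connected_graded_algebra scale gr deg
  for scale :: "'k::comm_ring_1 \<Rightarrow> 'a::ring_1 \<Rightarrow> 'a"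
    and gr :: "'g::comm_monoid_add \<Rightarrow> 'a set"
    and deg :: "'g \<Rightarrow> int" +
  fixes X :: "'x set" and gx :: "'x \<Rightarrow> 'g" and \<phi> :: "('x word \<Rightarrow>\<^sub>0 'k) \<Rightarrow> 'a"
  assumes gx_pos: "x \<in> X \<Longrightarrow> deg (gx x) > 0"
    and \<phi>_add: "p \<in> free_alg X \<Longrightarrow> q \<in> free_alg X \<Longrightarrow> \<phi> (p + q) = \<phi> p + \<phi> q"
    and \<phi>_mult: "p \<in> free_alg X \<Longrightarrow> q \<in> free_alg X \<Longrightarrow> \<phi> (p * q) = \<phi> p * \<phi> q"
    and \<phi>_smul: "p \<in> free_alg X \<Longrightarrow> \<phi> (smul c p) = scale c (\<phi> p)"
    and \<phi>_one: "\<phi> 1 = 1"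
    and \<phi>_gr: "\<phi> ` free_alg_gr X gx n \<subseteq> gr n"
    and \<phi>_surj: "\<phi> ` free_alg X = UNIV"
begin

lemma \<phi>_zero [simp]: "\<phi> 0 = 0"
  using \<phi>_add[of 0 0] by simp

lemma \<phi>_diff: "p \<in> free_alg X \<Longrightarrow> q \<in> free_alg X \<Longrightarrow> \<phi> (p - q) = \<phi> p - \<phi> q"
  using \<phi>_add[of "p - q" q] by (simp add: free_alg_diff)

lemma \<phi>_sum: "(\<And>i. i \<in> I \<Longrightarrow> f i \<in> free_alg X) \<Longrightarrow> \<phi> (\<Sum>i\<in>I. f i) = (\<Sum>i\<in>I. \<phi> (f i))"
  by (induction I rule: infinite_finite_induct) (auto simp: \<phi>_add free_alg_sum)

lemma \<phi>_single: "set (letters w) \<subseteq> X \<Longrightarrow> \<phi> (single w c) = scale c (\<phi> (single w 1))"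
  using \<phi>_smul[of "single w 1" c] by (simp add: smul_single free_alg_single)

lemma \<phi>_word_gr: "set (letters w) \<subseteq> X \<Longrightarrow> \<phi> (single w 1) \<in> gr (wdeg gx w)"
  using \<phi>_gr[of "wdeg gx w"] by (auto simp: free_alg_gr_iff free_alg_single lookup_single when_def image_subset_iff)

lemma deg_sum_list: "deg (sum_list (map gx xs)) = (\<Sum>x\<leftarrow>xs. deg (gx x))"
  by (induction xs) (simp_all add: deg_zero deg_add)

lemma wdeg_nonneg:
  assumes "set (letters w) \<subseteq> X"
  shows "deg (wdeg gx w) \<ge> 0"
  using assms gx_pos unfolding wdeg_def deg_sum_list by (intro sum_list_nonneg) fastforce

lemma wdeg_pos:
  assumes "set (letters w) \<subseteq> X" "w \<noteq> 0"
  shows "deg (wdeg gx w) > 0"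
proof -
  let ?u = "Word (butlast (letters w))" and ?x = "last (letters w)"
  have "letters w \<noteq> []"
    using assms(2) by (simp add: word_neq_zero_iff)
  then have "set (letters ?u) \<subseteq> X" "?x \<in> X"
    using assms(1) by (auto dest: in_set_butlastD)
  then have "deg (wdeg gx ?u) \<ge> 0" "deg (gx ?x) > 0"
    using wdeg_nonneg[of ?u] gx_pos[of ?x] by simp_all
  moreover have "wdeg gx w = wdeg gx ?u + gx ?x"
    using wdeg_plus[of gx ?u "Word [?x]"] word_snoc[OF assms(2)] by (simp add: wdeg_def)
  ultimately show ?thesis
    by (simp add: deg_add)
qed

lemma \<phi>_gen_gr: "x \<in> X \<Longrightarrow> \<phi> (gen_word x) \<in> gr (gx x)"
  using \<phi>_word_gr[of "Word [x]"] by (simp add: wdeg_def)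

lemma aug_\<phi>: "p \<in> free_alg X \<Longrightarrow> \<epsilon> (\<phi> p) = lookup p 0"
proof (induction p rule: free_alg_induct)
  case (single w c)
  have "\<epsilon> (\<phi> (single w 1)) = (if w = 0 then 1 else 0)"
    using wdeg_pos[OF single] by (auto simp: \<phi>_one deg_zero intro!: aug_gr[OF \<phi>_word_gr[OF single]])
  then show ?case
    by (simp add: \<phi>_single[OF single, of c] aug_scale lookup_single when_def)
qed (simp add: \<phi>_add aug_add lookup_add)

lemma \<phi>_restr: "p \<in> free_alg X \<Longrightarrow> \<phi> (restr gx S p) = pr S (\<phi> p)"
proof (induction p rule: free_alg_induct)
  case (single w c)
  then show ?case
    by (simp add: restr_single \<phi>_single[of w c] pr_scale pr_gr[OF \<phi>_word_gr])
qed (simp add: \<phi>_add restr_add restr_free_alg pr_add)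

text \<open>The Fox derivative of a monomial: the last letter becomes the basis element and the rest
  of the word is evaluated in the algebra. Constants have derivative zero.\<close>

definition foxw :: "'x word \<Rightarrow> 'k \<Rightarrow> ('x \<Rightarrow>\<^sub>0 'a)" where
  "foxw w c = (if w = 0 then 0
    else single (last (letters w)) (scale c (\<phi> (single (Word (butlast (letters w))) 1))))"

text \<open>The Fox derivation: \<open>fox (\<Sum>x. p x * x) = \<Sum>x. \<phi> (p x) * x\<close>. It identifies the kernel of the map
  from the free module on \<open>X\<close> to \<open>A\<close> with a quotient of the ideal of relations.\<close>

definition fox :: "('x word \<Rightarrow>\<^sub>0 'k) \<Rightarrow> ('x \<Rightarrow>\<^sub>0 'a)" where
  "fox p = (\<Sum>w\<in>keys p. foxw w (lookup p w))"

lemma foxw_zero [simp]: "foxw w 0 = 0"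
  by (simp add: foxw_def)

lemma foxw_add: "foxw w (b + c) = foxw w b + foxw w c"
  by (simp add: foxw_def scale_left_distrib single_add)

lemma fox_superset: "finite S \<Longrightarrow> keys p \<subseteq> S \<Longrightarrow> fox p = (\<Sum>w\<in>S. foxw w (lookup p w))"
  unfolding fox_def by (intro sum.mono_neutral_left) (auto simp: in_keys_iff)

lemma fox_add: "fox (p + q) = fox p + fox q"
proof -
  let ?S = "keys p \<union> keys q"
  have "fox (p + q) = (\<Sum>w\<in>?S. foxw w (lookup (p + q) w))"
    using keys_add[of p q] by (intro fox_superset) auto
  also have "\<dots> = fox p + fox q"
    by (simp add: fox_superset[of ?S] lookup_add foxw_add sum.distrib)
  finally show ?thesis .
qed

lemma fox_zero [simp]: "fox 0 = 0"
  by (simp add: fox_def)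

lemma fox_diff: "fox (p - q) = fox p - fox q"
  using fox_add[of "p - q" q] by simp

lemma fox_sum: "fox (\<Sum>i\<in>I. f i) = (\<Sum>i\<in>I. fox (f i))"
  by (induction I rule: infinite_finite_induct) (auto simp: fox_add)

lemma fox_single: "fox (single w c) = foxw w c"
  by (simp add: fox_def)

lemma fox_gen: "fox (gen_word x) = single x 1"
proof -
  have "Word [x] \<noteq> 0" "single (Word []) 1 = (1 :: 'x word \<Rightarrow>\<^sub>0 'k)"
    by (simp_all add: zero_word_def[symmetric] word_neq_zero_iff)
  then show ?thesis
    by (simp add: fox_single foxw_def \<phi>_one)
qed

lemma fox_mult_word:
  assumes "set (letters u) \<subseteq> X" "set (letters v) \<subseteq> X"
  shows "fox (single u a * single v b) =
    smul (\<phi> (single u a)) (fox (single v b)) + smul (scale (lookup (single v b) 0) 1) (fox (single u a))"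
proof (cases "v = 0")
  case True
  then show ?thesis
    by (simp add: mult_single fox_single foxw_def smul_single scale_mult_left mult.commute)
next
  case False
  let ?v = "butlast (letters v)" and ?x = "last (letters v)"
  have nonempty: "letters v \<noteq> []"
    using False by (simp add: word_neq_zero_iff)
  then have "set ?v \<subseteq> X"
    using assms(2) by (auto dest: in_set_butlastD)
  moreover have "single u 1 * single (Word ?v) 1 = (single (Word (letters u @ ?v)) 1 :: 'x word \<Rightarrow>\<^sub>0 'k)"
    by (simp add: mult_single plus_word_def)
  ultimately have "\<phi> (single (Word (letters u @ ?v)) 1) = \<phi> (single u 1) * \<phi> (single (Word ?v) 1)"
    using \<phi>_mult[of "single u 1" "single (Word ?v) 1"] assms(1) by (simp add: free_alg_single)
  moreover have "u + v \<noteq> 0" "letters (u + v) = letters u @ letters v"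
    using nonempty by (simp_all add: plus_word_def zero_word_def)
  ultimately show ?thesis
    using False nonempty
    by (simp add: mult_single fox_single foxw_def butlast_append smul_single \<phi>_single[OF assms(1), of a] \<phi>_single[OF assms(1), of "a * b"] lookup_single
        scale_mult_left scale_mult_right mult.commute[of a b])
qed

text \<open>A twisted Leibniz rule, with values in a module on which the right action is by
  augmentation. Only last letters are differentiated, so the derivative of \<open>p\<close> enters
  just through the constant term of \<open>q\<close>.\<close>

lemma fox_mult:
  assumes "p \<in> free_alg X" "q \<in> free_alg X"
  shows "fox (p * q) = smul (\<phi> p) (fox q) + smul (scale (lookup q 0) 1) (fox p)"
  using assms(1)
proof (induction p rule: free_alg_induct)
  case (single u a)
  show ?case
    using assms(2)
  proof (induction q rule: free_alg_induct)
    case (single v b)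
    show ?case
      by (rule fox_mult_word) fact+
  qed (simp add: distrib_left fox_add smul_add lookup_add scale_left_distrib smul_add_left)
qed (simp add: distrib_right fox_add \<phi>_add smul_add smul_add_left)

lemma foxw_Fgr:
  assumes "set (letters w) \<subseteq> X"
  shows "foxw w c \<in> Fgr X gx (wdeg gx w)"
proof (cases "w = 0")
  case False
  let ?u = "Word (butlast (letters w))" and ?x = "last (letters w)"
  have "letters w \<noteq> []"
    using False by (simp add: word_neq_zero_iff)
  then have "set (letters ?u) \<subseteq> X" "?x \<in> X"
    using assms by (auto dest: in_set_butlastD)
  moreover have "wdeg gx ?u + gx ?x = wdeg gx w"
    using wdeg_plus[of gx ?u "Word [?x]"] word_snoc[OF False] by (simp add: wdeg_def)
  ultimately show ?thesis
    using False by (auto simp: foxw_def intro!: Fgr_single subspace_scale[OF subspace_gr] \<phi>_word_gr)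
qed (simp add: foxw_def)

lemma fox_Fgr: "p \<in> free_alg_gr X gx n \<Longrightarrow> fox p \<in> Fgr X gx n"
  unfolding fox_def using foxw_Fgr by (intro Fgr_sum) (auto simp: free_alg_gr_def free_alg_def wdeg_def)

lemma fox_free_mod: "p \<in> free_alg X \<Longrightarrow> fox p \<in> free_mod X"
  unfolding fox_def by (intro free_mod_sum Fgr_free_mod[OF foxw_Fgr]) (auto simp: free_alg_def)

lemma fox_surj:
  assumes "y \<in> free_mod X"
  obtains p where "p \<in> free_alg X" "fox p = y" "lookup p 0 = 0"
proof -
  have "\<exists>t. t \<in> free_alg X \<and> \<phi> t = lookup y x" for x
    using \<phi>_surj by (metis UNIV_I imageE)
  then obtain t where t: "\<And>x. t x \<in> free_alg X" "\<And>x. \<phi> (t x) = lookup y x"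
    by metis
  let ?p = "\<Sum>x\<in>keys y. t x * gen_word x"
  have X: "x \<in> X" if "x \<in> keys y" for x
    using assms that by (auto simp: free_mod_def)
  have "?p \<in> free_alg X"
    using X by (intro free_alg_sum free_alg_mult t) auto
  moreover have "fox (t x * gen_word x) = single x (lookup y x)" if "x \<in> keys y" for x
    using fox_mult[OF t(1) free_alg_gen[OF X[OF that]]]
    by (simp add: t(2) fox_gen smul_single lookup_single zero_word_def when_def)
  then have "fox ?p = y"
    using pm_expand[of "keys y" y] by (simp add: fox_sum)
  moreover have "lookup ?p 0 = 0"
    by (simp add: lookup_sum)
  ultimately show ?thesis
    using that by blast
qed

text \<open>The algebra itself appears as the free module on the one-element basis, to fit the
  format of a resolution.\<close>

definition d0 :: "('x \<Rightarrow>\<^sub>0 'a) \<Rightarrow> (unit \<Rightarrow>\<^sub>0 'a)" where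
  "d0 = ext (\<lambda>x. single () (\<phi> (gen_word x)))"

lemma d0_graded_map: "graded_map X gx {()} (\<lambda>_. 0) d0"
  unfolding d0_def by (intro graded_map_ext Fgr_single[OF _ \<phi>_gen_gr]) auto

text \<open>The fundamental formula of Fox calculus: multiplying the partial derivatives by the
  generators recovers an element up to its constant term.\<close>

lemma d0_fox: "p \<in> free_alg X \<Longrightarrow> d0 (fox p) = single () (\<phi> p - scale (lookup p 0) 1)"
proof (induction p rule: free_alg_induct)
  case (single w c)
  show ?case
  proof (cases "w = 0")
    case True
    have "fox (single w c) = 0"
      by (simp add: fox_single foxw_def True)
    moreover have "\<phi> (single w c) = scale c 1"
      by (simp add: True single_zero_word \<phi>_smul \<phi>_one)
    ultimately show ?thesis
      by (simp add: d0_def True)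
  next
    case False
    let ?u = "Word (butlast (letters w))" and ?x = "last (letters w)"
    have "letters w \<noteq> []"
      using False by (simp add: word_neq_zero_iff)
    then have "set (letters ?u) \<subseteq> X" "?x \<in> X"
      using single by (auto dest: in_set_butlastD)
    then have "\<phi> (single w 1) = \<phi> (single ?u 1) * \<phi> (gen_word ?x)"
      using \<phi>_mult[of "single ?u 1" "gen_word ?x"] word_snoc[OF False] by (simp add: mult_single free_alg_single)
    then show ?thesis
      using False
      by (simp add: fox_single foxw_def d0_def smul_single scale_mult_left \<phi>_single[OF single, of c] lookup_single)
  qed
next
  case (add p q)
  have "d0 (fox p + fox q) = d0 (fox p) + d0 (fox q)"
    by (simp add: d0_def ext_add)
  then show ?case
    using add by (simp add: fox_add \<phi>_add lookup_add scale_left_distrib algebra_simps flip: single_add)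
qed

lemma d0_image: "d0 ` free_mod X = {f \<in> free_mod {()}. \<epsilon> (lookup f ()) = 0}"
proof (intro equalityI subsetI)
  fix f assume "f \<in> d0 ` free_mod X"
  then obtain y where "y \<in> free_mod X" "f = d0 y"
    by blast
  then obtain p where "p \<in> free_alg X" "f = d0 (fox p)" "lookup p 0 = 0"
    by (metis fox_surj)
  then show "f \<in> {f \<in> free_mod {()}. \<epsilon> (lookup f ()) = 0}"
    by (simp add: d0_fox aug_\<phi>)
next
  fix f assume f: "f \<in> {f \<in> free_mod {()}. \<epsilon> (lookup f ()) = 0}"
  obtain p where p: "p \<in> free_alg X" "\<phi> p = lookup f ()"
    using \<phi>_surj by (metis UNIV_I imageE)
  have "lookup p 0 = 0"
    using f aug_\<phi>[OF p(1)] p(2) by simp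
  then have "d0 (fox p) = f"
    by (intro poly_mapping_eqI) (simp add: d0_fox[OF p(1)] p(2))
  then show "f \<in> d0 ` free_mod X"
    using fox_free_mod[OF p(1)] by blast
qed

text \<open>The image of \<open>d0\<close> is the augmentation ideal, which reduces to zero. Hence
  all of \<open>k \<otimes> A^X\<close> consists of cycles.\<close>

lemma kmap_d0: "v \<in> kgr X gx n \<Longrightarrow> kmap d0 v = 0"
proof (rule poly_mapping_eqI)
  fix u :: unit
  assume "v \<in> kgr X gx n"
  then have "d0 (inc v) \<in> d0 ` free_mod X"
    by (intro imageI inc_free_mod)
  then show "lookup (kmap d0 v) u = lookup 0 u"
    unfolding d0_image by (simp add: kmap_def lookup_augF)
qed

lemma Hz_d0: "Hz X gx d0 n = kgr X gx n"
  by (auto simp: Hz_def kmap_d0)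

text \<open>The linear combination of the generators of the algebra with coefficients
  \<open>v\<close>. Modulo decomposables this map identifies Tor_1 with the indecomposables.\<close>

definition gen_val :: "('x \<Rightarrow>\<^sub>0 'k) \<Rightarrow> 'a" where
  "gen_val v = lookup (d0 (inc v)) ()"

lemma module_hom_gen_val: "module_hom smul scale gen_val"
proof -
  show ?thesis
    by unfold_locales (simp_all add: gen_val_def d0_def inc_add inc_smul ext_add ext_smul lookup_add lookup_smul scale_mult_left)
qed

lemma gen_val_single: "gen_val (single x c) = scale c (\<phi> (gen_word x))"
proof -
  have "inc (single x c) = single x (scale c 1)"
    by (rule poly_mapping_eqI) (auto simp: lookup_inc lookup_single when_def)
  then show ?thesis
    by (simp add: gen_val_def d0_def smul_single scale_mult_left)
qed

lemma lookup_d0: "lookup (d0 y) () = (\<Sum>x\<in>keys y. lookup y x * \<phi> (gen_word x))"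
  by (simp add: d0_def ext_def lookup_sum lookup_smul)

lemma aug_gen: "x \<in> X \<Longrightarrow> \<epsilon> (\<phi> (gen_word x)) = 0"
  by (simp add: aug_\<phi> lookup_single zero_word_def)

text \<open>If \<open>v\<close> is the reduction of a cycle \<open>w\<close>, its value is
  \<open>d0 (inc v - w)\<close>, a combination of generators with coefficients of augmentation zero.
  Conversely, such coefficients can be chosen for every decomposable value and subtracted from
  \<open>inc v\<close>.\<close>

lemma Hb_d0_iff:
  assumes v: "v \<in> kgr X gx n"
  shows "v \<in> Hb X gx d0 n \<longleftrightarrow> gen_val v \<in> decomposables"
proof
  assume "v \<in> Hb X gx d0 n"
  then obtain w where w: "w \<in> Fgr X gx n" "d0 w = 0" "v = augF w"
    by (auto simp: Hb_def)
  let ?y = "inc v - w"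
  have fm: "?y \<in> free_mod X"
    by (intro free_mod_diff inc_free_mod[OF v] Fgr_free_mod[OF w(1)])
  have "gen_val v = lookup (d0 ?y) ()"
    using w(2) by (simp add: gen_val_def d0_def ext_diff)
  also have "\<dots> \<in> decomposables"
    unfolding lookup_d0 decomposables_def
  proof (intro span_sum span_base)
    fix x assume "x \<in> keys ?y"
    then have "x \<in> X"
      using fm by (auto simp: free_mod_def)
    moreover have "\<epsilon> (lookup ?y x) = 0"
      by (simp add: lookup_minus aug_diff lookup_inc aug_scale w(3) lookup_augF)
    ultimately show "lookup ?y x * \<phi> (gen_word x) \<in> {a * b | a b. \<epsilon> a = 0 \<and> \<epsilon> b = 0}"
      using aug_gen by blast
  qed
  finally show "gen_val v \<in> decomposables" .
next
  assume dec: "gen_val v \<in> decomposables"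
  \<comment> \<open>For a product \<open>a1 * a2\<close> the second factor is in the image of
    \<open>d0\<close>; multiplying a preimage by \<open>a1\<close> makes its reduction
    vanish.\<close>
  have "\<exists>y\<in>free_mod X. augF y = 0 \<and> lookup (d0 y) () = a" if "a \<in> decomposables" for a
    using that unfolding decomposables_def
  proof (induction rule: span_induct_alt)
    case base
    then show ?case
      by (intro bexI[of _ 0]) (simp_all add: d0_def)
  next
    case (step c a b)
    then obtain y where y: "y \<in> free_mod X" "augF y = 0" "lookup (d0 y) () = b"
      by blast
    obtain a1 a2 where a: "a = a1 * a2" "\<epsilon> a1 = 0" "\<epsilon> a2 = 0"
      using step(1) by blast
    have "single () a2 \<in> d0 ` free_mod X"
      using a(3) by (simp add: d0_image)
    then obtain z where z: "z \<in> free_mod X" "d0 z = single () a2"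
      by (metis imageE)
    have "lookup (d0 (smul (scale c a1) z + y)) () = scale c a + b"
      using z(2) y(3) a(1) by (simp add: d0_def ext_add ext_smul smul_single lookup_add scale_mult_left)
    moreover have "augF (smul (scale c a1) z + y) = 0"
      by (simp add: augF_add augF_smul aug_scale a(2) y(2))
    ultimately show ?case
      using z(1) y(1) by (intro bexI[of _ "smul (scale c a1) z + y"]) (simp_all add: free_mod_add free_mod_smul)
  qed
  from this[OF dec] obtain y where y: "y \<in> free_mod X" "augF y = 0" "lookup (d0 y) () = gen_val v"
    by blast
  \<comment> \<open>The element \<open>y\<close> may be inhomogeneous. The projection preserves
    cycles, and it preserves the reduction because that is \<open>v\<close>, already of degree
    \<open>n\<close>.\<close>
  let ?w = "Fpr gx n (inc v - y)"
  have fm: "inc v - y \<in> free_mod X"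
    by (rule free_mod_diff[OF inc_free_mod[OF v] y(1)])
  have "d0 (inc v - y) = 0"
    using y(3) by (intro poly_mapping_eqI) (simp add: gen_val_def d0_def ext_diff lookup_minus)
  then have "d0 ?w = 0"
    by (simp add: graded_map_Fpr[OF d0_graded_map fm])
  moreover have "augF ?w = v"
    using augF_Fpr_eq[of "inc v - y" X gx n] v by (simp add: augF_diff y(2))
  ultimately show "v \<in> Hb X gx d0 n"
    unfolding Hb_def by (intro image_eqI[of _ _ ?w]) (simp_all add: Fpr_Fgr[OF fm])
qed

end

section \<open>Generated ideals and exactness of the Fox complex\<close>

lemma ideal_gen_least: "ideal_in T I \<Longrightarrow> R \<subseteq> I \<Longrightarrow> ideal_gen T R \<subseteq> I"
  by (auto simp: ideal_gen_def)

lemma ideal_gen_superset: "R \<subseteq> ideal_gen T R"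
  by (auto simp: ideal_gen_def)

lemma ideal_in_free_alg: "ideal_in (free_alg X :: ('x word \<Rightarrow>\<^sub>0 'k::comm_ring_1) set) (free_alg X)"
  by (simp add: ideal_in_def free_alg_diff free_alg_mult)

lemma ideal_in_ideal_gen:
  assumes "ideal_in T T" "R \<subseteq> T"
  shows "ideal_in T (ideal_gen T R)"
proof -
  have "ideal_gen T R \<subseteq> T"
    using assms by (intro ideal_gen_least)
  then show ?thesis
    unfolding ideal_in_def by (auto simp: ideal_gen_def) (auto simp: ideal_in_def)
qed

lemma ideal_in_zero: "ideal_in T I \<Longrightarrow> 0 \<in> I"
  by (simp add: ideal_in_def)

lemma ideal_in_diff: "ideal_in T I \<Longrightarrow> p \<in> I \<Longrightarrow> q \<in> I \<Longrightarrow> p - q \<in> I"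
  by (simp add: ideal_in_def)

lemma ideal_in_add: "ideal_in T I \<Longrightarrow> p \<in> I \<Longrightarrow> q \<in> I \<Longrightarrow> p + q \<in> I"
  using ideal_in_diff[of T I p "0 - q"] ideal_in_diff[of T I 0 q] ideal_in_zero[of T I] by simp

lemma ideal_in_mult: "ideal_in T I \<Longrightarrow> t \<in> T \<Longrightarrow> p \<in> I \<Longrightarrow> t * p \<in> I"
  "ideal_in T I \<Longrightarrow> t \<in> T \<Longrightarrow> p \<in> I \<Longrightarrow> p * t \<in> I"
  by (simp_all add: ideal_in_def)

lemma ideal_in_sum: "ideal_in T I \<Longrightarrow> (\<And>i. i \<in> S \<Longrightarrow> f i \<in> I) \<Longrightarrow> (\<Sum>i\<in>S. f i) \<in> I"
  by (induction S rule: infinite_finite_induct) (auto simp: ideal_in_add ideal_in_zero)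

context generated_algebra
begin

lemma ideal_in_kernel: "ideal_in (free_alg X) {p \<in> free_alg X. \<phi> p = 0}"
  by (auto simp: ideal_in_def free_alg_diff free_alg_mult \<phi>_diff \<phi>_mult)

end

locale presented_algebra = generated_algebra scale gr deg X gx \<phi>
  for scale :: "'k::comm_ring_1 \<Rightarrow> 'a::ring_1 \<Rightarrow> 'a"
    and gr :: "'g::comm_monoid_add \<Rightarrow> 'a set"
    and deg :: "'g \<Rightarrow> int"
    and X :: "'x set" and gx :: "'x \<Rightarrow> 'g" and \<phi> :: "('x word \<Rightarrow>\<^sub>0 'k) \<Rightarrow> 'a" +
  fixes J :: "'j set" and gj :: "'j \<Rightarrow> 'g" and r :: "'j \<Rightarrow> ('x word \<Rightarrow>\<^sub>0 'k)"
  assumes rel_gr: "j \<in> J \<Longrightarrow> r j \<in> free_alg_gr X gx (gj j)"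
    and kernel: "{p \<in> free_alg X. \<phi> p = 0} = ideal_gen (free_alg X) (r ` J)"
begin

definition d1 :: "('j \<Rightarrow>\<^sub>0 'a) \<Rightarrow> ('x \<Rightarrow>\<^sub>0 'a)" where
  "d1 = ext (\<lambda>j. fox (r j))"

lemma rel_free_alg: "j \<in> J \<Longrightarrow> r j \<in> free_alg X"
  using rel_gr by (simp add: free_alg_gr_iff)

lemma rel_kernel: "j \<in> J \<Longrightarrow> \<phi> (r j) = 0"
  using kernel ideal_gen_superset[of "r ` J" "free_alg X"] by blast

lemma d1_graded_map: "graded_map J gj X gx d1"
  unfolding d1_def by (intro graded_map_ext fox_Fgr rel_gr)

text \<open>The relations whose Fox derivative lies in the image of \<open>d1\<close> form an ideal:
  in the Leibniz rule for a product with such a relation, one term vanishes because the relation has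
  value zero, or because it has no constant term.\<close>

lemma fox_kernel:
  assumes "p \<in> free_alg X" "\<phi> p = 0"
  shows "fox p \<in> d1 ` free_mod J"
proof -
  let ?I = "{p \<in> free_alg X. \<phi> p = 0 \<and> fox p \<in> d1 ` free_mod J}"
  have diff: "u - v \<in> d1 ` free_mod J" if uv: "u \<in> d1 ` free_mod J" "v \<in> d1 ` free_mod J" for u v
  proof -
    obtain y z where "y \<in> free_mod J" "z \<in> free_mod J" "u = d1 y" "v = d1 z"
      using uv by blast
    then show ?thesis
      by (intro image_eqI[of _ _ "y - z"]) (simp_all add: d1_def ext_diff free_mod_diff)
  qed
  have smul: "smul a u \<in> d1 ` free_mod J" if u: "u \<in> d1 ` free_mod J" for a u
  proof -
    obtain y where "y \<in> free_mod J" "u = d1 y"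
      using u by blast
    then show ?thesis
      by (intro image_eqI[of _ _ "smul a y"]) (simp_all add: d1_def ext_smul free_mod_smul)
  qed
  have "0 \<in> d1 ` free_mod J"
    by (intro image_eqI[of _ _ 0]) (simp_all add: d1_def)
  then have "ideal_in (free_alg X) ?I"
    by (auto simp: ideal_in_def free_alg_diff free_alg_mult \<phi>_diff \<phi>_mult fox_diff fox_mult diff smul
        simp flip: aug_\<phi>)
  moreover have "r ` J \<subseteq> ?I"
  proof clarify
    fix j assume j: "j \<in> J"
    have "fox (r j) = d1 (single j 1)"
      by (simp add: d1_def)
    then show "r j \<in> free_alg X \<and> \<phi> (r j) = 0 \<and> fox (r j) \<in> d1 ` free_mod J"
      using j by (simp add: rel_free_alg rel_kernel)
  qed
  ultimately have "ideal_gen (free_alg X) (r ` J) \<subseteq> ?I"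
    by (rule ideal_gen_least)
  then show ?thesis
    using assms kernel by blast
qed

text \<open>For exactness at \<open>A^X\<close>, a cycle is written as the Fox derivative of some
  \<open>p\<close> without constant term. The fundamental formula then gives
  \<open>\<phi> p = 0\<close>, and \<open>fox_kernel\<close> applies.\<close>

theorem fox_resolution: "part_res {()} (\<lambda>_. 0) X gx J gj (\<lambda>f. \<epsilon> (lookup f ())) d0 d1"
  unfolding part_res_def
proof (intro conjI)
  show "left_linear smul (\<lambda>a c. \<epsilon> a * c) (free_mod {()}) (\<lambda>f. \<epsilon> (lookup f ()))"
    by (simp add: left_linear_def lookup_add lookup_smul aug_add aug_mult)
  have "c \<in> (\<lambda>f. \<epsilon> (lookup f ())) ` free_mod {()}" for c
    by (intro image_eqI[of _ _ "single () (scale c 1)"]) (simp_all add: aug_scale)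
  then show "(\<lambda>f. \<epsilon> (lookup f ())) ` free_mod {()} = UNIV"
    by blast
  show "d1 ` free_mod J = {f \<in> free_mod X. d0 f = 0}"
  proof (intro equalityI subsetI)
    fix f assume "f \<in> d1 ` free_mod J"
    then obtain y where y: "y \<in> free_mod J" "f = d1 y"
      by blast
    have "d0 (d1 y) = 0"
    proof (rule left_linear_eqI[OF graded_map_linear[OF graded_map_comp[OF d1_graded_map d0_graded_map]], where h' = "\<lambda>_. 0", OF _ _ y(1)])
      show "left_linear smul smul (free_mod J) (\<lambda>_. 0)"
        by (simp add: left_linear_def)
      show "d0 (d1 (single j 1)) = 0" if "j \<in> J" for j
        using rel_kernel[OF that] rel_free_alg[OF that] by (simp add: d1_def d0_fox flip: aug_\<phi>)
    qed
    then show "f \<in> {f \<in> free_mod X. d0 f = 0}"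
      using graded_map_free_mod[OF d1_graded_map y(1)] y(2) by simp
  next
    fix f assume f: "f \<in> {f \<in> free_mod X. d0 f = 0}"
    then obtain p where p: "p \<in> free_alg X" "fox p = f" "lookup p 0 = 0"
      by (auto elim: fox_surj)
    then have "single () (\<phi> p) = 0"
      using f d0_fox[OF p(1)] by simp
    then have "lookup (single () (\<phi> p)) () = 0"
      by (simp only: lookup_zero)
    then have "\<phi> p = 0"
      by simp
    then show "f \<in> d1 ` free_mod J"
      using fox_kernel[OF p(1)] p(2) by simp
  qed
qed (auto simp: d0_graded_map d1_graded_map d0_image)

text \<open>A cycle of degree \<open>n\<close> has a homogeneous preimage under \<open>d1\<close>,
  and reduction makes the boundary a combination of linear parts of the relations of degree
  \<open>n\<close>.\<close>

lemma Hb_d0_subset: "Hb X gx d0 n \<subseteq> kmap d1 ` kgr J gj n"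
proof
  fix v assume "v \<in> Hb X gx d0 n"
  then obtain w where w: "w \<in> Fgr X gx n" "d0 w = 0" "v = augF w"
    by (auto simp: Hb_def)
  have "w \<in> d1 ` free_mod J"
    using fox_resolution w(2) Fgr_free_mod[OF w(1)] by (simp add: part_res_def)
  then obtain y where y: "y \<in> Fgr J gj n" "d1 y = w"
    using graded_lift[OF d1_graded_map w(1)] by blast
  have "v = kmap d1 (augF y)"
    by (simp add: kmap_augF[OF d1_graded_map Fgr_free_mod[OF y(1)]] y(2) w(3))
  then show "v \<in> kmap d1 ` kgr J gj n"
    using augF_kgr[OF y(1)] by blast
qed

end

lemma presented_algebra_iff:
  assumes "connected_graded_algebra scale gr deg"
  shows "presented_algebra scale gr deg X gx \<phi> J gj r \<longleftrightarrow>
    (\<forall>x\<in>X. deg (gx x) > 0) \<and> (\<forall>j\<in>J. r j \<in> free_alg_gr X gx (gj j)) \<and>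
    (\<forall>p\<in>free_alg X. \<forall>q\<in>free_alg X. \<phi> (p + q) = \<phi> p + \<phi> q \<and> \<phi> (p * q) = \<phi> p * \<phi> q) \<and>
    (\<forall>c. \<forall>p\<in>free_alg X. \<phi> (smul c p) = scale c (\<phi> p)) \<and> \<phi> 1 = 1 \<and>
    (\<forall>n. \<phi> ` free_alg_gr X gx n \<subseteq> gr n) \<and> \<phi> ` free_alg X = UNIV \<and>
    {p \<in> free_alg X. \<phi> p = 0} = ideal_gen (free_alg X) (r ` J)"
  unfolding presented_algebra_def presented_algebra_axioms_def generated_algebra_def generated_algebra_axioms_def
  by (rule iffI; elim conjE; intro conjI allI ballI impI assms) simp_all

lemma homogeneous_presentation_iff:
  assumes "connected_graded_algebra scale gr deg"
  shows "homogeneous_presentation scale gr deg X gx J gj r \<longleftrightarrow>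
    (\<forall>j\<in>J. deg (gj j) > 0) \<and> (\<exists>\<phi>. presented_algebra scale gr deg X gx \<phi> J gj r)"
  unfolding homogeneous_presentation_def presented_algebra_iff[OF assms] by auto

section \<open>Lower bounds for the numbers of generators and relations\<close>

text \<open>Lifts of the generators of a decomposition into cyclic modules are linearly independent. For
  the relations, such lifts of generators of the kernel of \<open>f\<close> and preimages of \<open>d1 z1, \<dots>, ds zs\<close>
  are linearly independent together.\<close>

lemma rank_bound_generators:
  fixes ds :: "'k::pid list"
  assumes inv: "invariant_factors smul (Z, B) ds" and Z: "Z \<subseteq> {v. keys v \<subseteq> S}" and "0 \<in> B" "finite S"
  shows "length ds \<le> card S"
proof (rule ccontr)
  assume "\<not> length ds \<le> card S"
  from inv obtain zs where zs: "length zs = length ds" "set zs \<subseteq> Z"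
    "\<forall>c. (\<Sum>i<length ds. smul (c i) (zs ! i)) \<in> B \<longleftrightarrow> (\<forall>i<length ds. ds ! i dvd c i)"
    and unit: "\<forall>i<length ds. \<not> ds ! i dvd 1" and chain: "\<forall>i. Suc i < length ds \<longrightarrow> ds ! i dvd ds ! Suc i"
    by (rule invariant_factorsE)
  have "\<forall>i\<in>{..<length ds}. keys (zs ! i) \<subseteq> S"
  proof
    fix i assume "i \<in> {..<length ds}"
    then have "zs ! i \<in> Z"
      using zs(1,2) by (metis lessThan_iff nth_mem subsetD)
    then show "keys (zs ! i) \<subseteq> S"
      using Z by blast
  qed
  then obtain c where "\<exists>i\<in>{..<length ds}. c i \<noteq> 0" "(\<Sum>i<length ds. smul (c i) (zs ! i)) = 0"
    using too_many_vectors_dependent[of S "{..<length ds}" "\<lambda>i. zs ! i"] \<open>\<not> length ds \<le> card S\<close> \<open>finite S\<close> by auto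
  then show False
    using invariant_factors_independent[OF zs(3) unit chain \<open>0 \<in> B\<close>] by auto
qed

lemma rank_bound_relations:
  fixes ds es :: "'k::pid list" and f :: "('j \<Rightarrow>\<^sub>0 'k) \<Rightarrow> ('x \<Rightarrow>\<^sub>0 'k)"
  assumes f: "module_hom smul smul f"
    and inv: "invariant_factors smul (Z, B) ds" "0 \<in> B" "B \<subseteq> f ` {v. keys v \<subseteq> S}"
    and inv': "invariant_factors smul (Z', B') es" "0 \<in> B'" "Z' \<subseteq> {v. keys v \<subseteq> S \<and> f v = 0}"
    and "finite S"
  shows "length es + nonzero_length ds \<le> card S"
proof (rule ccontr)
  define s where "s = nonzero_length ds"
  assume "\<not> length es + nonzero_length ds \<le> card S"
  then have card: "card S < length es + s"
    by (simp add: s_def)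
  interpret module_hom smul smul f by fact
  from inv(1) obtain zs where zs: "length zs = length ds" "set zs \<subseteq> Z"
    "\<forall>c. (\<Sum>i<length ds. smul (c i) (zs ! i)) \<in> B \<longleftrightarrow> (\<forall>i<length ds. ds ! i dvd c i)"
    and unit: "\<forall>i<length ds. \<not> ds ! i dvd 1" and chain: "\<forall>i. Suc i < length ds \<longrightarrow> ds ! i dvd ds ! Suc i"
    by (rule invariant_factorsE)
  from inv'(1) obtain zs' where zs': "length zs' = length es" "set zs' \<subseteq> Z'"
    "\<forall>c. (\<Sum>i<length es. smul (c i) (zs' ! i)) \<in> B' \<longleftrightarrow> (\<forall>i<length es. es ! i dvd c i)"
    and unit': "\<forall>i<length es. \<not> es ! i dvd 1" and chain': "\<forall>i. Suc i < length es \<longrightarrow> es ! i dvd es ! Suc i"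
    by (rule invariant_factorsE)
  have s: "s \<le> length ds"
    by (simp add: s_def nonzero_length_le)
  then have nonzero: "ds ! i \<noteq> 0" if "i < s" for i
    using invariant_factor_nonzero_iff[OF chain less_le_trans[OF that s]] that unfolding s_def by blast
  \<comment> \<open>The multiple of \<open>zs ! i\<close> by its annihilator lies in
    \<open>B\<close> and hence in the image of \<open>f\<close>.\<close>
  have "\<exists>y. keys y \<subseteq> S \<and> f y = smul (ds ! i) (zs ! i)" if "i < s" for i
  proof -
    have "(\<Sum>k<length ds. smul (if k = i then ds ! i else 0) (zs ! k)) \<in> B"
      unfolding zs(3)[rule_format] by simp
    also have "(\<Sum>k<length ds. smul (if k = i then ds ! i else 0) (zs ! k)) = smul (ds ! i) (zs ! i)"
      using that s by (simp add: if_distrib[of "\<lambda>c. smul c _"] cong: if_cong)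
    finally show ?thesis
      using inv(3) by force
  qed
  then obtain y where y: "\<And>i. i < s \<Longrightarrow> keys (y i) \<subseteq> S" "\<And>i. i < s \<Longrightarrow> f (y i) = smul (ds ! i) (zs ! i)"
    by metis
  let ?I = "{..<length es} <+> {..<s}" and ?v = "case_sum ((!) zs') y"
  have zs'_nth: "keys (zs' ! i) \<subseteq> S" "f (zs' ! i) = 0" if "i < length es" for i
  proof -
    have "zs' ! i \<in> Z'"
      using zs'(1,2) that by (metis nth_mem subsetD)
    then show "keys (zs' ! i) \<subseteq> S" "f (zs' ! i) = 0"
      using inv'(3) by auto
  qed
  have "\<forall>i\<in>?I. keys (?v i) \<subseteq> S"
    by (intro ballI, elim PlusE) (simp_all add: y(1) zs'_nth(1))
  then obtain c where c: "\<exists>i\<in>?I. c i \<noteq> 0" "(\<Sum>i\<in>?I. smul (c i) (?v i)) = 0"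
    using too_many_vectors_dependent[of S ?I ?v] card \<open>finite S\<close> by (auto simp: card_Plus)
  then have sum0: "(\<Sum>i<length es. smul (c (Inl i)) (zs' ! i)) + (\<Sum>i<s. smul (c (Inr i)) (y i)) = 0"
    by (simp add: sum.Plus)
  \<comment> \<open>Applying \<open>f\<close> removes the elements of its kernel and leaves a
    relation between the \<open>zs\<close>. Their independence and \<open>ds ! i \<noteq> 0\<close>
    for \<open>i < s\<close> force the second half of the coefficients to vanish; then the first
    half is a relation between the \<open>zs'\<close>.\<close>
  have "f ((\<Sum>i<length es. smul (c (Inl i)) (zs' ! i)) + (\<Sum>i<s. smul (c (Inr i)) (y i))) =
      (\<Sum>i<s. smul (c (Inr i) * ds ! i) (zs ! i))"
    by (simp add: add sum scale zs'_nth y(2) smul_smul)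
  also have "\<dots> = (\<Sum>i<length ds. smul (if i < s then c (Inr i) * ds ! i else 0) (zs ! i))"
    using s by (intro sum.mono_neutral_cong_left) auto
  finally have "(\<Sum>i<length ds. smul (if i < s then c (Inr i) * ds ! i else 0) (zs ! i)) = 0"
    by (simp add: sum0 zero)
  from invariant_factors_independent[OF zs(3) unit chain inv(2) this]
  have "c (Inr i) = 0" if "i < s" for i
    using that s nonzero[OF that] by (metis (full_types) less_le_trans mult_eq_0_iff)
  moreover from this have "(\<Sum>i<length es. smul (c (Inl i)) (zs' ! i)) = 0"
    using sum0 by simp
  from invariant_factors_independent[OF zs'(3) unit' chain' inv'(2) this]
  have "c (Inl i) = 0" if "i < length es" for i
    using that .
  ultimately show False
    using c(1) by auto
qed

theorem presentation_bounds:
  fixes scale :: "'k::pid \<Rightarrow> 'a::ring_1 \<Rightarrow> 'a" and gr :: "'g::comm_monoid_add \<Rightarrow> 'a set" and E :: "nat \<Rightarrow> 'e set"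
  assumes A: "connected_graded_algebra scale gr deg"
    and F: "graded_free_resolution scale gr deg E ge d \<eta>"
    and ds: "invariant_factors smul (Tor scale gr deg E ge d 1 n) ds"
    and es: "invariant_factors smul (Tor scale gr deg E ge d 2 n) es"
    and pres: "homogeneous_presentation scale gr deg X gx J gj r"
  shows "finite {x \<in> X. gx x = n} \<Longrightarrow> length ds \<le> card {x \<in> X. gx x = n}"
    and "finite {j \<in> J. gj j = n} \<Longrightarrow>
      length es + nonzero_length ds \<le> card {j \<in> J. gj j = n}"
proof -
  obtain \<phi> where "presented_algebra scale gr deg X gx \<phi> J gj r"
    using pres unfolding homogeneous_presentation_iff[OF A] by (elim conjE exE)
  then interpret presented_algebra scale gr deg X gx \<phi> J gj r .
  note cmp = homology_independent_of_resolution[OF resolution_part_res(1)[OF F] fox_resolution]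
  have inv1: "invariant_factors smul (Hz X gx d0 n, Hb X gx d0 n) ds"
    using cmp(1) Tor_invariant_factors[OF F, of 0 n ds] ds by simp
  have inv2: "invariant_factors smul (Hz J gj d1 n, Hb J gj d1 n) es"
    using cmp(2) Tor_invariant_factors[OF F, of 1 n es] es by (simp add: numeral_2_eq_2)
  have zero: "0 \<in> Hb X gx d0 n" "0 \<in> Hb J gj d1 n"
    using subspace_Hb[OF d0_graded_map] subspace_Hb[OF d1_graded_map] by (simp_all add: sm.subspace_0)
  show "length ds \<le> card {x \<in> X. gx x = n}" if "finite {x \<in> X. gx x = n}"
    by (rule rank_bound_generators[OF inv1 _ zero(1) that]) (simp add: Hz_d0 kgr_def)
  have hom: "module_hom smul smul (kmap d1)"
    unfolding d1_def by (rule module_hom_kmap_ext)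
  show "length es + nonzero_length ds \<le> card {j \<in> J. gj j = n}"
    if "finite {j \<in> J. gj j = n}"
    by (rule rank_bound_relations[OF hom inv1 zero(1) _ inv2 zero(2) _ that])
      (use Hb_d0_subset in \<open>auto simp: kgr_def Hz_def\<close>)
qed

section \<open>Minimal presentations\<close>

text \<open>In a zero quotient the relation with all coefficients \<open>1\<close> holds, so every
  factor would be invertible. This excludes generators and relations of nonpositive degree.\<close>

lemma invariant_factors_trivial:
  assumes "invariant_factors sc (Z, B) ds" "module sc" "module.subspace sc Z" "Z \<subseteq> B"
  shows "ds = []"
proof (rule ccontr)
  assume "ds \<noteq> []"
  interpret module sc by fact
  from assms(1) obtain zs where zs: "length zs = length ds" "set zs \<subseteq> Z"
    "\<forall>c. (\<Sum>i<length ds. sc (c i) (zs ! i)) \<in> B \<longleftrightarrow> (\<forall>i<length ds. ds ! i dvd c i)"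
    "\<forall>i<length ds. \<not> ds ! i dvd 1"
    by (rule invariant_factorsE)
  have "(\<Sum>i<length ds. sc 1 (zs ! i)) \<in> Z"
    using zs(1,2) by (intro subspace_sum[OF assms(3)] subspace_scale[OF assms(3)]) auto
  then have "\<forall>i<length ds. ds ! i dvd 1"
    using zs(3)[rule_format, of "\<lambda>_. 1"] assms(4) by blast
  then show False
    using zs(4) \<open>ds \<noteq> []\<close> by blast
qed

lemma sum_restr: "p = (\<Sum>n\<in>wdeg gx ` keys p. restr gx {n} p)"
proof (rule poly_mapping_eqI)
  fix w
  have "(\<Sum>n\<in>wdeg gx ` keys p. if wdeg gx w = n then lookup p w else 0) = (if wdeg gx w \<in> wdeg gx ` keys p then lookup p w else 0)"
    by simp
  then show "lookup p w = lookup (\<Sum>n\<in>wdeg gx ` keys p. restr gx {n} p) w"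
    by (auto simp: lookup_sum lookup_restr in_keys_iff image_iff)
qed

context connected_graded_algebra
begin

lemma generated_algebra_eval:
  assumes "\<And>x. x \<in> X \<Longrightarrow> 0 < deg (gx x)" "\<And>x. x \<in> X \<Longrightarrow> a x \<in> gr (gx x)" "eval a ` free_alg X = UNIV"
  shows "generated_algebra scale gr deg X gx (eval a)"
  using assms by unfold_locales (auto simp: eval_add eval_mult eval_smul eval_one intro: eval_gr)

lemma eval_image_eq_UNIV:
  assumes gr: "\<And>x. x \<in> X \<Longrightarrow> a x \<in> gr (gx x)"
    and gen: "\<And>n b. 0 < deg n \<Longrightarrow> b \<in> gr n \<Longrightarrow> \<exists>s\<in>eval a ` free_alg_gr X gx n. b - s \<in> decomposables"
  shows "eval a ` free_alg X = UNIV"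
proof (rule subalgebra_eq_UNIV)
  show "subspace (eval a ` free_alg X)"
  proof (rule subspaceI)
    show "0 \<in> eval a ` free_alg X"
      by (rule image_eqI[of _ _ 0]) (simp_all add: eval_def)
    show "x + y \<in> eval a ` free_alg X" if xy: "x \<in> eval a ` free_alg X" "y \<in> eval a ` free_alg X" for x y
    proof -
      obtain p q where "p \<in> free_alg X" "q \<in> free_alg X" "x = eval a p" "y = eval a q"
        using xy by blast
      then show ?thesis
        by (intro image_eqI[of _ _ "p + q"]) (simp_all add: eval_add free_alg_add)
    qed
    show "scale c x \<in> eval a ` free_alg X" if x: "x \<in> eval a ` free_alg X" for c x
    proof -
      obtain p where "p \<in> free_alg X" "x = eval a p"
        using x by blast
      then show ?thesis
        by (intro image_eqI[of _ _ "smul c p"]) (simp_all add: eval_smul free_alg_smul)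
    qed
  qed
  show "1 \<in> eval a ` free_alg X"
    by (rule image_eqI[of _ _ 1]) (simp_all add: eval_one)
  show "x * y \<in> eval a ` free_alg X" if xy: "x \<in> eval a ` free_alg X" "y \<in> eval a ` free_alg X" for x y
  proof -
    obtain p q where "p \<in> free_alg X" "q \<in> free_alg X" "x = eval a p" "y = eval a q"
      using xy by blast
    then show ?thesis
      by (intro image_eqI[of _ _ "p * q"]) (simp_all add: eval_mult free_alg_mult)
  qed
  fix n b assume "0 < deg n" "b \<in> gr n"
  from gen[OF this] obtain p where p: "p \<in> free_alg_gr X gx n" "b - eval a p \<in> decomposables"
    by blast
  moreover have "eval a p \<in> gr n"
    by (rule eval_gr[OF gr p(1)])
  ultimately show "\<exists>s\<in>eval a ` free_alg X \<inter> gr n. b - s \<in> decomposables"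
    by (auto simp: free_alg_gr_iff)
qed

lemma subspace_positive: "subspace {a \<in> gr n. \<epsilon> a = 0}"
  by (rule subspaceI) (auto simp: aug_add aug_scale zero_in_gr intro: subspace_add[OF subspace_gr] subspace_scale[OF subspace_gr])

lemma positive_trivial:
  assumes "deg n \<le> 0"
  shows "{a \<in> gr n. \<epsilon> a = 0} \<subseteq> {0}"
proof clarify
  fix a assume a: "a \<in> gr n" "\<epsilon> a = 0"
  show "a = 0"
  proof (cases "n = 0")
    case True
    then show ?thesis
      using a cmp_gr[OF a(1), of 0] cmp_zero_eq[of a] by simp
  qed (rule gr_nonpos[OF a(1) assms])
qed

end

section \<open>The family of all relations and its generating subfamilies\<close>

context generated_algebra
begin

lemma kernel_restr: "p \<in> free_alg X \<Longrightarrow> \<phi> p = 0 \<Longrightarrow> \<phi> (restr gx S p) = 0"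
  by (simp add: \<phi>_restr)

text \<open>Among words in \<open>X\<close>, only the empty one has nonpositive degree, and its
  coefficient is the augmentation of \<open>\<phi> p\<close>.\<close>

lemma kernel_restr_nonpos:
  assumes p: "p \<in> free_alg X" "\<phi> p = 0" and "deg n \<le> 0"
  shows "restr gx {n} p = 0"
proof (rule poly_mapping_eqI)
  fix w
  have "lookup p w = 0" if "wdeg gx w = n"
  proof (cases "w = 0")
    case True
    then show ?thesis
      using aug_\<phi>[OF p(1)] p(2) by simp
  next
    case False
    then have "\<not> set (letters w) \<subseteq> X"
      using wdeg_pos[of w] that assms(3) by auto
    then show ?thesis
      using p(1) by (simp add: free_alg_iff)
  qed
  then show "lookup (restr gx {n} p) w = lookup 0 w"
    by (simp add: lookup_restr)
qed

text \<open>Each relation carries its degree along: the family must assign one, and the zero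
  relation is homogeneous of every degree.\<close>

definition all_rels :: "('g \<times> ('x word \<Rightarrow>\<^sub>0 'k)) set" where
  "all_rels = {(n, p). 0 < deg n \<and> p \<in> free_alg_gr X gx n \<and> \<phi> p = 0}"

lemma presented_all_rels: "presented_algebra scale gr deg X gx \<phi> all_rels fst snd"
proof unfold_locales
  show "snd j \<in> free_alg_gr X gx (fst j)" if "j \<in> all_rels" for j
    using that by (auto simp: all_rels_def)
  have sub: "snd ` all_rels \<subseteq> {p \<in> free_alg X. \<phi> p = 0}"
    by (auto simp: all_rels_def free_alg_gr_iff)
  show "{p \<in> free_alg X. \<phi> p = 0} = ideal_gen (free_alg X) (snd ` all_rels)"
  proof
    show "ideal_gen (free_alg X) (snd ` all_rels) \<subseteq> {p \<in> free_alg X. \<phi> p = 0}"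
      by (rule ideal_gen_least[OF ideal_in_kernel sub])
    have ideal: "ideal_in (free_alg X) (ideal_gen (free_alg X) (snd ` all_rels))"
      using sub by (intro ideal_in_ideal_gen ideal_in_free_alg) auto
    show "{p \<in> free_alg X. \<phi> p = 0} \<subseteq> ideal_gen (free_alg X) (snd ` all_rels)"
    proof clarify
      fix p assume p: "p \<in> free_alg X" "\<phi> p = 0"
      have "restr gx {n} p \<in> ideal_gen (free_alg X) (snd ` all_rels)" for n
      proof (cases "0 < deg n")
        case True
        then have "(n, restr gx {n} p) \<in> all_rels"
          by (simp add: all_rels_def restr_singleton_gr p kernel_restr)
        then have "restr gx {n} p \<in> snd ` all_rels"
          by force
        then show ?thesis
          using ideal_gen_superset by blast
      next
        case False
        then show ?thesis
          by (simp add: kernel_restr_nonpos p ideal_in_zero[OF ideal])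
      qed
      then have "(\<Sum>n\<in>wdeg gx ` keys p. restr gx {n} p) \<in> ideal_gen (free_alg X) (snd ` all_rels)"
        by (intro ideal_in_sum[OF ideal])
      then show "p \<in> ideal_gen (free_alg X) (snd ` all_rels)"
        by (simp flip: sum_restr)
    qed
  qed
qed

text \<open>The partial Fox derivative before evaluation: it collects the words that end in
  \<open>x\<close>, with that letter removed.\<close>

definition part :: "'x \<Rightarrow> ('x word \<Rightarrow>\<^sub>0 'k) \<Rightarrow> ('x word \<Rightarrow>\<^sub>0 'k)" where
  "part x p = (\<Sum>w\<in>{w \<in> keys p. last (letters w) = x}. single (Word (butlast (letters w))) (lookup p w))"

text \<open>Without a constant term every word of \<open>p\<close> has a last letter, so grouping by
  it expresses \<open>p\<close> through products with generators.\<close>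

lemma
  assumes p: "p \<in> free_alg X" "lookup p 0 = 0"
  shows part_free_alg: "part x p \<in> free_alg X"
    and \<phi>_part: "\<phi> (part x p) = lookup (fox p) x"
    and part_expand: "p = (\<Sum>x\<in>(\<lambda>w. last (letters w)) ` keys p. part x p * gen_word x)"
    and part_keys: "\<And>u. u \<in> keys (part x p) \<Longrightarrow> u + Word [x] \<in> keys p \<and> x \<in> X"
proof -
  have nz: "w \<noteq> 0" "letters w \<noteq> []" "set (letters w) \<subseteq> X" if "w \<in> keys p" for w
    using that p by (auto simp: in_keys_iff free_alg_def simp flip: word_neq_zero_iff)
  have bl: "set (letters (Word (butlast (letters w)))) \<subseteq> X" if "w \<in> keys p" for w
    using nz(3)[OF that] by (auto dest: in_set_butlastD)
  then show fa: "part x p \<in> free_alg X" for x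
    unfolding part_def by (intro free_alg_sum free_alg_single) blast
  have "\<phi> (part x p) = (\<Sum>w\<in>{w \<in> keys p. last (letters w) = x}. \<phi> (single (Word (butlast (letters w))) (lookup p w)))"
    unfolding part_def using bl by (intro \<phi>_sum free_alg_single) blast
  also have "\<dots> = (\<Sum>w\<in>{w \<in> keys p. last (letters w) = x}. scale (lookup p w) (\<phi> (single (Word (butlast (letters w))) 1)))"
    using bl by (intro sum.cong refl \<phi>_single) blast
  also have "\<dots> = (\<Sum>w\<in>keys p. lookup (foxw w (lookup p w)) x)"
    using nz(1) by (intro sum.mono_neutral_cong_left) (auto simp: foxw_def lookup_single when_def)
  also have "\<dots> = lookup (fox p) x"
    by (simp add: fox_def lookup_sum)
  finally show "\<phi> (part x p) = lookup (fox p) x" .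
  have "part x p * gen_word x = (\<Sum>w\<in>{w \<in> keys p. last (letters w) = x}. single w (lookup p w))" for x
    unfolding part_def sum_distrib_right
  proof (rule sum.cong)
    fix w assume "w \<in> {w \<in> keys p. last (letters w) = x}"
    then show "single (Word (butlast (letters w))) (lookup p w) * gen_word x = single w (lookup p w)"
      using word_snoc[of w] nz(1) by (auto simp: mult_single)
  qed simp
  then have "(\<Sum>x\<in>(\<lambda>w. last (letters w)) ` keys p. part x p * gen_word x) = (\<Sum>w\<in>keys p. single w (lookup p w))"
    using sum.group[of "keys p" "(\<lambda>w. last (letters w)) ` keys p" "\<lambda>w. last (letters w)" "\<lambda>w. single w (lookup p w)"]
    by simp
  then show "p = (\<Sum>x\<in>(\<lambda>w. last (letters w)) ` keys p. part x p * gen_word x)"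
    using pm_expand[of "keys p" p] by simp
  fix u assume "u \<in> keys (part x p)"
  moreover have "keys (part x p) \<subseteq> {u. u + Word [x] \<in> keys p \<and> x \<in> X}"
    unfolding part_def
  proof (rule keys_sum_subset)
    fix w assume w: "w \<in> {w \<in> keys p. last (letters w) = x}"
    then have "x \<in> X"
      using nz(2,3)[of w] by auto
    then show "keys (single (Word (butlast (letters w))) (lookup p w)) \<subseteq> {u. u + Word [x] \<in> keys p \<and> x \<in> X}"
      using w word_snoc[of w] nz(1) by auto
  qed
  ultimately show "u + Word [x] \<in> keys p \<and> x \<in> X"
    by blast
qed

interpretation rels: presented_algebra scale gr deg X gx \<phi> all_rels fst snd
  by (rule presented_all_rels)

text \<open>If \<open>d1 w = 0\<close> and \<open>t\<close> lifts the coefficients of \<open>w\<close>, then the relation \<open>\<Sum>j. t j * r j\<close> is killed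
  by the Fox derivation and hence a sum of products of relations of smaller degree with generators.\<close>

theorem relations_generate:
  fixes R :: "'g \<Rightarrow> (('g \<times> ('x word \<Rightarrow>\<^sub>0 'k)) \<Rightarrow>\<^sub>0 'k) set"
  assumes R: "\<And>n. R n \<subseteq> kgr all_rels fst n"
    and gen: "\<And>n v. v \<in> kgr all_rels fst n \<Longrightarrow> \<exists>s\<in>sm.span (R n). v - s \<in> Hb all_rels fst rels.d1 n"
  shows "{p \<in> free_alg X. \<phi> p = 0} = ideal_gen (free_alg X) (\<Union>n. ext snd ` R n)"
proof
  let ?lam = "ext snd :: (('g \<times> ('x word \<Rightarrow>\<^sub>0 'k)) \<Rightarrow>\<^sub>0 'k) \<Rightarrow> _"
  let ?I = "ideal_gen (free_alg X) (\<Union>n. ?lam ` R n)"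
  have rel: "snd j \<in> free_alg X" "\<phi> (snd j) = 0" "snd j \<in> free_alg_gr X gx (fst j)" if "j \<in> all_rels" for j
    using that rels.rel_gr by (auto simp: rels.rel_free_alg rels.rel_kernel)
  have lam: "?lam v \<in> free_alg X" "\<phi> (?lam v) = 0" if v: "v \<in> kgr all_rels fst n" for n v
  proof -
    have j: "j \<in> all_rels" if "j \<in> keys v" for j
      using v that by (auto simp: kgr_def)
    show "?lam v \<in> free_alg X"
      unfolding ext_def by (intro free_alg_sum free_alg_smul rel(1) j)
    have "\<phi> (?lam v) = (\<Sum>j\<in>keys v. \<phi> (smul (lookup v j) (snd j)))"
      unfolding ext_def by (intro \<phi>_sum free_alg_smul rel(1) j)
    also have "\<dots> = 0"
      using j by (intro sum.neutral) (simp add: \<phi>_smul rel)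
    finally show "\<phi> (?lam v) = 0" .
  qed
  have sub: "(\<Union>n. ?lam ` R n) \<subseteq> {p \<in> free_alg X. \<phi> p = 0}"
    using lam R by blast
  show "?I \<subseteq> {p \<in> free_alg X. \<phi> p = 0}"
    by (rule ideal_gen_least[OF ideal_in_kernel sub])
  have ideal: "ideal_in (free_alg X) ?I"
    using sub by (intro ideal_in_ideal_gen ideal_in_free_alg) auto
  have span: "?lam s \<in> ?I" if "s \<in> sm.span (R n)" for s n
    using that
  proof (induction rule: sm.span_induct_alt)
    case base
    then show ?case
      by (simp add: ideal_in_zero[OF ideal])
  next
    case (step c v s)
    have "?lam v \<in> (\<Union>n. ?lam ` R n)"
      using step(1) by blast
    then have "?lam v \<in> ?I"
      by (rule subsetD[OF ideal_gen_superset])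
    then have "smul c 1 * ?lam v \<in> ?I"
      by (intro ideal_in_mult(1)[OF ideal] free_alg_smul) auto
    then show ?case
      using step(2) by (simp add: ext_add ext_smul smul_mult ideal_in_add[OF ideal])
  qed
  \<comment> \<open>Induction on the integer degree, so that relations of smaller degree are
    available for all degrees in \<open>G\<close> at once.\<close>
  have "snd j \<in> ?I" if "j \<in> all_rels" for j
    using that
  proof (induction "nat (deg (fst j))" arbitrary: j rule: less_induct)
    case less
    define n where "n = fst j"
    have IH: "p \<in> ?I" if "deg m < deg n" "p \<in> free_alg_gr X gx m" "\<phi> p = 0" "0 < deg m" for p m
      using less.hyps[of "(m, p)"] that by (auto simp: n_def all_rels_def)
    have IHj: "snd i \<in> ?I" if "i \<in> all_rels" "deg (fst i) < deg n" for i
      using that by (intro IH[of "fst i"]) (auto simp: all_rels_def)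
    have IHp: "p \<in> ?I" if p: "p \<in> free_alg X" "\<phi> p = 0" "\<And>w. w \<in> keys p \<Longrightarrow> deg (wdeg gx w) < deg n" for p
    proof -
      have "restr gx {m} p \<in> ?I" if "m \<in> wdeg gx ` keys p" for m
      proof (cases "0 < deg m")
        case True
        then show ?thesis
          using that p by (intro IH[of m]) (auto simp: restr_singleton_gr kernel_restr)
      next
        case False
        then show ?thesis
          by (simp add: kernel_restr_nonpos p ideal_in_zero[OF ideal])
      qed
      then have "(\<Sum>m\<in>wdeg gx ` keys p. restr gx {m} p) \<in> ?I"
        by (rule ideal_in_sum[OF ideal])
      then show ?thesis
        by (simp flip: sum_restr)
    qed
    have "single j 1 \<in> kgr all_rels fst n"
      using less.prems by (simp add: kgr_def n_def)
    then obtain s where s: "s \<in> sm.span (R n)" "single j 1 - s \<in> Hb all_rels fst rels.d1 n"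
      using gen by blast
    then obtain w where w: "w \<in> Fgr all_rels fst n" "rels.d1 w = 0" "single j 1 - s = augF w"
      by (auto simp: Hb_def)
    have keys: "i \<in> all_rels" if "i \<in> keys w" for i
      using Fgr_free_mod[OF w(1)] that by (auto simp: free_mod_def)
    \<comment> \<open>Homogeneous lifts of the coefficients of \<open>w\<close>. Keeping only the
      words whose degree completes \<open>fst i\<close> to \<open>n\<close> does not change the
      value, since the coefficient lies in the corresponding components.\<close>
    have "\<exists>t. t \<in> free_alg X \<and> \<phi> t = lookup w i \<and> (\<forall>u\<in>keys t. wdeg gx u + fst i = n)" for i
    proof -
      obtain p where p: "p \<in> free_alg X" "\<phi> p = lookup w i"
        using \<phi>_surj by (metis UNIV_I imageE)
      let ?t = "restr gx {m. m + fst i = n} p"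
      have "\<phi> ?t = lookup w i"
        using pr_grS[OF Fgr_lookup[OF w(1)]] by (simp add: \<phi>_restr p)
      moreover have "\<forall>u\<in>keys ?t. wdeg gx u + fst i = n"
        by (auto simp: in_keys_iff lookup_restr split: if_splits)
      ultimately show ?thesis
        using restr_free_alg[OF p(1)] by blast
    qed
    then obtain t where t: "\<And>i. t i \<in> free_alg X" "\<And>i. \<phi> (t i) = lookup w i"
        "\<And>i u. u \<in> keys (t i) \<Longrightarrow> wdeg gx u + fst i = n"
      by metis
    let ?q = "\<Sum>i\<in>keys w. t i * snd i"
    have q: "?q \<in> free_alg X" "lookup ?q 0 = 0"
    proof -
      show "?q \<in> free_alg X"
        by (intro free_alg_sum free_alg_mult t rel(1) keys)
      have "\<phi> ?q = (\<Sum>i\<in>keys w. \<phi> (t i * snd i))"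
        by (intro \<phi>_sum free_alg_mult t rel(1) keys)
      also have "\<dots> = 0"
        using keys by (intro sum.neutral) (simp add: \<phi>_mult t rel)
      finally show "lookup ?q 0 = 0"
        by (simp flip: aug_\<phi>[OF \<open>?q \<in> free_alg X\<close>])
    qed
    have "fox ?q = (\<Sum>i\<in>keys w. smul (lookup w i) (fox (snd i)))"
      unfolding fox_sum
    proof (rule sum.cong)
      fix i assume "i \<in> keys w"
      note i = keys[OF this]
      have "lookup (snd i) 0 = 0"
        using aug_\<phi>[OF rel(1)[OF i]] rel(2)[OF i] by simp
      then show "fox (t i * snd i) = smul (lookup w i) (fox (snd i))"
        by (simp add: fox_mult[OF t(1) rel(1)[OF i]] t(2))
    qed simp
    then have fox: "fox ?q = 0"
      using w(2) by (simp add: rels.d1_def ext_def)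
    have wdeg_q: "wdeg gx u = n" if "u \<in> keys ?q" for u
    proof -
      have "keys ?q \<subseteq> {u. wdeg gx u = n}"
      proof (rule keys_sum_subset)
        fix i assume "i \<in> keys w"
        then have i: "snd i \<in> free_alg_gr X gx (fst i)"
          using rel(3) keys by blast
        show "keys (t i * snd i) \<subseteq> {u. wdeg gx u = n}"
        proof
          fix u assume "u \<in> keys (t i * snd i)"
          then obtain a b where "a \<in> keys (t i)" "b \<in> keys (snd i)" "u = a + b"
            using keys_mult[of "t i" "snd i"] by blast
          moreover from this have "wdeg gx b = fst i"
            using i by (simp add: free_alg_gr_def wdeg_def)
          ultimately show "u \<in> {u. wdeg gx u = n}"
            using t(3)[of a i] by (simp add: wdeg_plus)
        qed
      qed
      then show ?thesis
        using that by blast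
    qed
    \<comment> \<open>The value of \<open>part x ?q\<close> is a coefficient of
      \<open>fox ?q = 0\<close>, so it is a relation. It has lost a letter of positive degree and
      falls under the induction hypothesis.\<close>
    have "part x ?q * gen_word x \<in> ?I" if x: "x \<in> (\<lambda>w. last (letters w)) ` keys ?q" for x
    proof -
      have "x \<in> X"
      proof -
        obtain u where u: "u \<in> keys ?q" "x = last (letters u)"
          using x by blast
        then have "letters u \<noteq> []"
          using q(2) by (auto simp: in_keys_iff simp flip: word_neq_zero_iff)
        then have "x \<in> set (letters u)"
          by (simp add: u(2))
        then show ?thesis
          using u(1) q(1) unfolding free_alg_def by blast
      qed
      moreover have "part x ?q \<in> ?I"
      proof (rule IHp)
        show "part x ?q \<in> free_alg X"
          by (rule part_free_alg[OF q])
        show "\<phi> (part x ?q) = 0"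
          using \<phi>_part[OF q] by (simp add: fox)
        fix u assume "u \<in> keys (part x ?q)"
        then have "wdeg gx (u + Word [x]) = n"
          using part_keys[OF q] wdeg_q by blast
        then have "wdeg gx u + gx x = n"
          unfolding wdeg_plus by (simp add: wdeg_def)
        then show "deg (wdeg gx u) < deg n"
          using gx_pos[OF \<open>x \<in> X\<close>] deg_add[of "wdeg gx u" "gx x"] by simp
      qed
      ultimately show ?thesis
        by (intro ideal_in_mult(2)[OF ideal]) auto
    qed
    then have "(\<Sum>x\<in>(\<lambda>w. last (letters w)) ` keys ?q. part x ?q * gen_word x) \<in> ?I"
      by (rule ideal_in_sum[OF ideal])
    then have qI: "?q \<in> ?I"
      by (simp flip: part_expand[OF q])
    have "?lam (augF w) = (\<Sum>i\<in>keys w. smul (lookup (t i) 0) (snd i))"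
    proof -
      have "?lam (augF w) = (\<Sum>i\<in>keys w. smul (lookup (augF w) i) (snd i))"
        by (rule ext_superset) (auto simp: in_keys_iff lookup_augF)
      then show ?thesis
        by (simp add: lookup_augF aug_\<phi>[OF t(1), symmetric] t(2))
    qed
    \<comment> \<open>The constant terms of the lifts are the augmented coefficients of
      \<open>w\<close>. What remains of a lift has positive degree, so it only multiplies relations
      of degree below \<open>n\<close>.\<close>
    then have "?q - ?lam (augF w) = (\<Sum>i\<in>keys w. (t i - smul (lookup (t i) 0) 1) * snd i)"
      by (simp add: sum_subtractf left_diff_distrib smul_mult)
    also have "\<dots> \<in> ?I"
    proof (rule ideal_in_sum[OF ideal])
      fix i assume "i \<in> keys w"
      note i = keys[OF this]
      show "(t i - smul (lookup (t i) 0) 1) * snd i \<in> ?I"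
      proof (cases "t i - smul (lookup (t i) 0) 1 = 0")
        case True
        then show ?thesis
          by (simp add: ideal_in_zero[OF ideal])
      next
        case False
        then obtain u where "lookup (t i - smul (lookup (t i) 0) 1) u \<noteq> 0"
          by (metis lookup_zero poly_mapping_eqI)
        then have u: "u \<noteq> 0" "u \<in> keys (t i)"
          by (auto simp: lookup_minus lookup_smul lookup_one in_keys_iff when_def split: if_splits)
        then have "0 < deg (wdeg gx u)"
          using t(1)[of i] by (intro wdeg_pos) (auto simp: free_alg_def)
        then have "deg (fst i) < deg n"
          using t(3)[OF u(2)] deg_add[of "wdeg gx u" "fst i"] by simp
        then have "snd i \<in> ?I"
          by (rule IHj[OF i])
        then show ?thesis
          by (intro ideal_in_mult(1)[OF ideal] free_alg_diff free_alg_smul t) auto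
      qed
    qed
    finally have "?lam (augF w) \<in> ?I"
      using ideal_in_diff[OF ideal qI] by fastforce
    moreover have "snd j = ?lam (augF w) + ?lam s"
      by (simp flip: w(3) add: ext_diff)
    ultimately show ?case
      using span[OF s(1)] by (simp add: ideal_in_add[OF ideal])
  qed
  then have "ideal_gen (free_alg X) (snd ` all_rels) \<subseteq> ?I"
    by (intro ideal_gen_least[OF ideal]) auto
  then show "{p \<in> free_alg X. \<phi> p = 0} \<subseteq> ?I"
    by (simp add: rels.kernel)
qed

end

context generated_algebra
begin

lemma gen_val_positive:
  assumes "v \<in> kgr X gx n"
  shows "gen_val v \<in> gr n" "\<epsilon> (gen_val v) = 0"
proof -
  have "lookup (d0 (inc v)) () \<in> grS {m. m + 0 = n}"
    by (rule Fgr_lookup[OF graded_map_Fgr[OF d0_graded_map inc_Fgr[OF assms]]])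
  then show "gen_val v \<in> gr n"
    by (simp add: gen_val_def grS_singleton)
  have "lookup (kmap d0 v) () = 0"
    by (simp add: kmap_d0[OF assms])
  then show "\<epsilon> (gen_val v) = 0"
    by (simp add: gen_val_def kmap_def lookup_augF)
qed

end

context presented_algebra
begin

lemma kmap_d1_Hb:
  assumes "v \<in> kgr J gj n"
  shows "kmap d1 v \<in> Hb X gx d0 n"
proof -
  have "d0 (d1 (inc v)) = 0"
    using fox_resolution inc_free_mod[OF assms] by (auto simp: part_res_def)
  then show ?thesis
    using graded_map_Fgr[OF d1_graded_map inc_Fgr[OF assms]] by (auto simp: Hb_def kmap_def)
qed

end

section \<open>Tor_1 as indecomposables and the minimal presentation\<close>

context connected_graded_algebra
begin

context
  fixes E :: "nat \<Rightarrow> 'e set" and ge :: "nat \<Rightarrow> 'e \<Rightarrow> 'g" and d :: "nat \<Rightarrow> ('e \<Rightarrow>\<^sub>0 'a) \<Rightarrow> ('e \<Rightarrow>\<^sub>0 'a)"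
    and \<eta> :: "('e \<Rightarrow>\<^sub>0 'a) \<Rightarrow> 'k"
  assumes F: "graded_free_resolution scale gr deg E ge d \<eta>"
begin

text \<open>Tor is computed from the tautological presentation, with all homogeneous elements of
  positive degree as generators and all their relations. There \<open>gen_val\<close> maps onto the
  augmentation ideal in each degree, and its preimage of the decomposables consists of the
  boundaries.\<close>

theorem indecomposables_invariant_factors:
  assumes inv: "invariant_factors smul (Tor scale gr deg E ge d 1 n) ds"
  shows "invariant_factors scale ({a \<in> gr n. \<epsilon> a = 0}, decomposables) ds"
proof -
  \<comment> \<open>Pairs are used because an element alone does not determine its degree: zero lies
    in every component.\<close>
  let ?X = "{(n, a). 0 < deg n \<and> a \<in> gr n}"
  have gr: "snd x \<in> gr (fst x)" if "x \<in> ?X" for x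
    using that by auto
  have "eval snd ` free_alg ?X = UNIV"
  proof (rule eval_image_eq_UNIV[where gx = fst, OF gr])
    fix n b assume "0 < deg n" "b \<in> gr n"
    then have "gen_word (n, b) \<in> free_alg_gr ?X fst n"
      by (simp add: free_alg_gr_iff lookup_single wdeg_def when_def)
    moreover have "b - eval snd (gen_word (n, b)) \<in> decomposables"
      by (simp add: eval_gen decomposables_def span_zero)
    ultimately show "\<exists>s\<in>eval snd ` free_alg_gr ?X fst n. b - s \<in> decomposables"
      by blast
  qed
  then interpret G: generated_algebra scale gr deg ?X fst "eval snd"
    by (intro generated_algebra_eval gr) auto
  interpret R: presented_algebra scale gr deg ?X fst "eval snd" G.all_rels fst snd
    by (rule G.presented_all_rels)
  have "invariant_factors smul (Hz (E 1) (ge 1) (d 0) n, Hb (E 1) (ge 1) (d 0) n) ds"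
    using Tor_invariant_factors[OF F, of 0 n ds] inv by simp
  then have inv1: "invariant_factors smul (Hz ?X fst G.d0 n, Hb ?X fst G.d0 n) ds"
    by (rule homology_independent_of_resolution(1)[OF resolution_part_res(1)[OF F] R.fox_resolution])
  show ?thesis
  proof (rule invariant_factors_transfer[OF inv1 module_smul subspace_Hz[OF G.d0_graded_map] G.module_hom_gen_val])
    show "G.gen_val z \<in> {a \<in> gr n. \<epsilon> a = 0}" if "z \<in> Hz ?X fst G.d0 n" for z
      using that G.gen_val_positive[of z n] by (simp add: G.Hz_d0)
    show "G.gen_val z \<in> decomposables \<longleftrightarrow> z \<in> Hb ?X fst G.d0 n" if "z \<in> Hz ?X fst G.d0 n" for z
      using that G.Hb_d0_iff[of z n] by (simp add: G.Hz_d0)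
    show "subspace decomposables"
      by (simp add: decomposables_def)
    show "Hb ?X fst G.d0 n \<subseteq> Hz ?X fst G.d0 n"
      by (rule Hb_subset_Hz[OF G.d0_graded_map])
    show "\<exists>z\<in>Hz ?X fst G.d0 n. a - G.gen_val z \<in> decomposables" if a: "a \<in> {a \<in> gr n. \<epsilon> a = 0}" for a
    proof (cases "0 < deg n")
      case True
      then have "single (n, a) 1 \<in> Hz ?X fst G.d0 n"
        using a by (simp add: G.Hz_d0 kgr_def)
      moreover have "a - G.gen_val (single (n, a) 1) \<in> decomposables"
        by (simp add: G.gen_val_single eval_gen decomposables_def span_zero)
      ultimately show ?thesis
        by blast
    next
      case False
      then have "a = 0"
        using positive_trivial[of n] a by auto
      then have "a - G.gen_val 0 \<in> decomposables"
        by (simp add: G.gen_val_def G.d0_def decomposables_def span_zero)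
      then show ?thesis
        using sm.subspace_0[OF subspace_Hz[OF G.d0_graded_map]] by blast
    qed
  qed
qed

theorem minimal_presentation:
  assumes ds: "\<And>n. invariant_factors smul (Tor scale gr deg E ge d 1 n) (ds n)"
    and es: "\<And>n. invariant_factors smul (Tor scale gr deg E ge d 2 n) (es n)"
  defines "s \<equiv> \<lambda>n. nonzero_length (ds n)"
  shows "\<exists>r. homogeneous_presentation scale gr deg {(n, i). i < length (ds n)} fst
    {(n, i). i < length (es n) + s n} fst r"
proof -
  let ?X = "{(n, i). i < length (ds n)}" and ?J = "{(n, i). i < length (es n) + s n}"
  have indec: "invariant_factors scale ({a \<in> gr n. \<epsilon> a = 0}, decomposables) (ds n)" for n
    by (rule indecomposables_invariant_factors[OF ds])
  \<comment> \<open>In nonpositive integer degrees the augmentation ideal is zero, so no generators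
    are placed there.\<close>
  have pos: "0 < deg n" if "ds n \<noteq> []" for n
  proof (rule ccontr)
    assume "\<not> 0 < deg n"
    then have "{a \<in> gr n. \<epsilon> a = 0} \<subseteq> decomposables"
      using positive_trivial[of n] span_zero by (auto simp: decomposables_def)
    then show False
      using invariant_factors_trivial[OF indec module_axioms subspace_positive] that by blast
  qed
  let ?P = "\<lambda>n zs. length zs = length (ds n) \<and> set zs \<subseteq> {a \<in> gr n. \<epsilon> a = 0} \<and>
    (\<forall>z\<in>{a \<in> gr n. \<epsilon> a = 0}. \<exists>c. z - (\<Sum>i<length (ds n). scale (c i) (zs ! i)) \<in> decomposables) \<and>
    (\<forall>c. (\<Sum>i<length (ds n). scale (c i) (zs ! i)) \<in> decomposables \<longleftrightarrow> (\<forall>i<length (ds n). ds n ! i dvd c i))"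
  have "\<forall>n. \<exists>zs. ?P n zs"
    using indec by (simp add: invariant_factors_def)
  then obtain zs where P: "\<And>n. ?P n (zs n)"
    using choice[of ?P] by blast
  then have zs: "\<And>n. length (zs n) = length (ds n)" "\<And>n. set (zs n) \<subseteq> {a \<in> gr n. \<epsilon> a = 0}"
    "\<And>n. \<forall>z\<in>{a \<in> gr n. \<epsilon> a = 0}. \<exists>c. z - (\<Sum>i<length (ds n). scale (c i) (zs n ! i)) \<in> decomposables"
    "\<And>n c. (\<Sum>i<length (ds n). scale (c i) (zs n ! i)) \<in> decomposables \<longleftrightarrow> (\<forall>i<length (ds n). ds n ! i dvd c i)"
    by simp_all
  have chain: "\<forall>i. Suc i < length (ds n) \<longrightarrow> ds n ! i dvd ds n ! Suc i" for n
    using indec by (simp add: invariant_factors_def)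
  define a where "a x = zs (fst x) ! snd x" for x
  have gr: "a x \<in> gr (fst x)" if "x \<in> ?X" for x
  proof -
    have "a x \<in> set (zs (fst x))"
      using that by (auto simp: a_def zs(1))
    then show ?thesis
      using zs(2) by blast
  qed
  have "eval a ` free_alg ?X = UNIV"
  proof (rule eval_image_eq_UNIV[where gx = fst, OF gr])
    fix n b assume n: "0 < deg n" "b \<in> gr n"
    then have "n \<noteq> 0"
      by (auto simp: deg_zero)
    then have "\<epsilon> b = 0"
      by (rule aug_gr[OF n(2)])
    then obtain c where c: "b - (\<Sum>i<length (ds n). scale (c i) (zs n ! i)) \<in> decomposables"
      using zs(3)[of n] n(2) by blast
    let ?p = "\<Sum>i<length (ds n). smul (c i) (gen_word (n, i)) :: (_ word \<Rightarrow>\<^sub>0 'k)"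
    have "?p \<in> free_alg_gr ?X fst n"
      by (auto simp: free_alg_gr_iff lookup_sum lookup_smul lookup_single wdeg_def when_def
          intro!: free_alg_sum free_alg_smul sum.neutral)
    moreover have "eval a (\<Sum>i\<in>S. smul (c i) (gen_word (n, i))) = (\<Sum>i\<in>S. scale (c i) (zs n ! i))" if "finite S" for S
      using that by (induction S) (simp_all add: eval_add eval_smul eval_gen a_def, simp add: eval_def)
    then have "b - eval a ?p \<in> decomposables"
      using c by simp
    ultimately show "\<exists>s\<in>eval a ` free_alg_gr ?X fst n. b - s \<in> decomposables"
      by blast
  qed
  then interpret G: generated_algebra scale gr deg ?X fst "eval a"
    by (intro generated_algebra_eval gr) (use pos in force)+
  interpret R: presented_algebra scale gr deg ?X fst "eval a" G.all_rels fst snd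
    by (rule G.presented_all_rels)
  let ?K = "kgr G.all_rels fst" and ?f = "kmap R.d1"
  have hom: "module_hom smul smul ?f"
    unfolding R.d1_def by (rule module_hom_kmap_ext)
  interpret f: module_hom smul smul ?f
    by (rule hom)
  have inv2: "invariant_factors smul (Hz G.all_rels fst R.d1 n, Hb G.all_rels fst R.d1 n) (es n)" for n
    using homology_independent_of_resolution(2)[OF resolution_part_res(1)[OF F] R.fox_resolution]
      Tor_invariant_factors[OF F, of 1 n "es n"] es by (simp add: numeral_2_eq_2)
  have s: "s n \<le> length (ds n)" "\<And>i. i < length (ds n) \<Longrightarrow> i < s n \<longleftrightarrow> ds n ! i \<noteq> 0" for n
  proof -
    show "s n \<le> length (ds n)"
      by (simp add: s_def nonzero_length_le)
    show "i < s n \<longleftrightarrow> ds n ! i \<noteq> 0" if "i < length (ds n)" for i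
      unfolding s_def using invariant_factor_nonzero_iff[OF chain that] by blast
  qed
  have pos': "0 < deg n" if "es n \<noteq> []" for n
  proof (rule ccontr)
    assume n: "\<not> 0 < deg n"
    have "Hz G.all_rels fst R.d1 n \<subseteq> {0}"
    proof
      fix v assume "v \<in> Hz G.all_rels fst R.d1 n"
      then have "keys v \<subseteq> {j \<in> G.all_rels. fst j = n}"
        by (simp add: Hz_def kgr_def)
      also have "\<dots> = {}"
        using n by (auto simp: G.all_rels_def)
      finally show "v \<in> {0}"
        by (auto intro!: poly_mapping_eqI simp: in_keys_iff)
    qed
    then have "Hz G.all_rels fst R.d1 n \<subseteq> Hb G.all_rels fst R.d1 n"
      using sm.subspace_0[OF subspace_Hb[OF R.d1_graded_map]] by blast
    then show False
      using invariant_factors_trivial[OF inv2 module_smul subspace_Hz[OF R.d1_graded_map]] that by blast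
  qed
  \<comment> \<open>With these generators, the module of boundaries in
    \<open>k \<otimes> A^X\<close> is diagonal: in degree \<open>n\<close> it is the direct sum of
    the ideals \<open>(ds n ! i)\<close>, because the generators are lifts of a cyclic
    decomposition.\<close>
  have Hb1: "v \<in> Hb ?X fst G.d0 n \<longleftrightarrow> (\<forall>i<length (ds n). ds n ! i dvd lookup v (n, i))" if v: "v \<in> kgr ?X fst n" for v n
  proof -
    interpret g: module_hom smul scale G.gen_val
      by (rule G.module_hom_gen_val)
    have "keys v \<subseteq> Pair n ` {..<length (ds n)}"
      using v by (auto simp: kgr_def)
    then have "v = (\<Sum>x\<in>Pair n ` {..<length (ds n)}. single x (lookup v x))"
      by (intro pm_expand) auto
    also have "\<dots> = (\<Sum>i<length (ds n). single (n, i) (lookup v (n, i)))"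
      by (subst sum.reindex) (auto simp: inj_on_def)
    finally have "G.gen_val v = G.gen_val (\<Sum>i<length (ds n). single (n, i) (lookup v (n, i)))"
      by simp
    also have "\<dots> = (\<Sum>i<length (ds n). scale (lookup v (n, i)) (zs n ! i))"
      by (simp add: g.sum G.gen_val_single eval_gen a_def)
    finally show ?thesis
      by (simp add: G.Hb_d0_iff[OF v] zs(4))
  qed
  let ?P' = "\<lambda>n zs'. length zs' = length (es n) \<and> set zs' \<subseteq> Hz G.all_rels fst R.d1 n \<and>
    (\<forall>z\<in>Hz G.all_rels fst R.d1 n. \<exists>c. z - (\<Sum>i<length (es n). smul (c i) (zs' ! i)) \<in> Hb G.all_rels fst R.d1 n)"
  have "\<exists>zs'. ?P' n zs'" for n
    using inv2[of n] unfolding invariant_factors_def fst_conv snd_conv by blast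
  then obtain zs' where P': "\<And>n. ?P' n (zs' n)"
    using choice[of ?P'] by blast
  then have zs': "\<And>n. length (zs' n) = length (es n)" "\<And>n. set (zs' n) \<subseteq> Hz G.all_rels fst R.d1 n"
    "\<And>n. \<forall>z\<in>Hz G.all_rels fst R.d1 n. \<exists>c. z - (\<Sum>i<length (es n). smul (c i) (zs' n ! i)) \<in> Hb G.all_rels fst R.d1 n"
    by simp_all
  define y where "y n i = (SOME y. y \<in> ?K n \<and> ?f y = single (n, i) (ds n ! i))" for n i
  \<comment> \<open>For a nonzero factor, \<open>ds n ! i\<close> times a basis vector is a boundary
    and hence the linear part of a combination of relations. These are the \<open>rel\<close> many
    relations that come from Tor_1.\<close>
  have y: "y n i \<in> ?K n" "?f (y n i) = single (n, i) (ds n ! i)" if i: "i < s n" for n i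
  proof -
    have "single (n, i) (ds n ! i) \<in> kgr ?X fst n"
      using i s(1)[of n] by (simp add: kgr_def)
    then have "single (n, i) (ds n ! i) \<in> Hb ?X fst G.d0 n"
      by (simp add: Hb1 lookup_single when_def)
    then have "single (n, i) (ds n ! i) \<in> ?f ` ?K n"
      by (rule subsetD[OF R.Hb_d0_subset])
    then have "\<exists>y. y \<in> ?K n \<and> ?f y = single (n, i) (ds n ! i)"
      by (elim imageE) auto
    from someI_ex[OF this] show "y n i \<in> ?K n" "?f (y n i) = single (n, i) (ds n ! i)"
      by (simp_all add: y_def)
  qed
  \<comment> \<open>The two families are concatenated: first the lifts of the generators of Tor_2,
    then the preimages \<open>y\<close>, with the index shifted by the length of the first
    family.\<close>
  define v where "v j = (if snd j < length (es (fst j)) then zs' (fst j) ! snd j else y (fst j) (snd j - length (es (fst j))))" for j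
  define V where "V n = (\<lambda>i. v (n, i)) ` {..<length (es n) + s n}" for n
  have vK: "v (n, i) \<in> ?K n" if "i < length (es n) + s n" for n i
  proof (cases "i < length (es n)")
    case True
    then have "v (n, i) \<in> set (zs' n)"
      by (simp add: v_def zs'(1))
    then show ?thesis
      using zs'(2)[of n] by (auto simp: Hz_def)
  next
    case False
    then show ?thesis
      using that y(1) by (simp add: v_def)
  qed
  have "{p \<in> free_alg ?X. eval a p = 0} = ideal_gen (free_alg ?X) (\<Union>n. ext snd ` V n)"
  proof (rule G.relations_generate)
    show "V n \<subseteq> ?K n" for n
      using vK by (auto simp: V_def)
    fix n w assume w: "w \<in> ?K n"
    have "\<forall>i<length (ds n). ds n ! i dvd lookup (?f w) (n, i)"
      using R.kmap_d1_Hb[OF w] Hb1[OF kmap_kgr[OF R.d1_graded_map w]] by simp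
    then have "\<exists>c. \<forall>i<length (ds n). lookup (?f w) (n, i) = ds n ! i * c i"
      by (intro choice) (auto simp: dvd_def)
    then obtain c where c: "\<And>i. i < length (ds n) \<Longrightarrow> lookup (?f w) (n, i) = ds n ! i * c i"
      by blast
    \<comment> \<open>This combination has the same linear part as \<open>w\<close>: from index
      \<open>s n\<close> on the factors are zero, so there the linear part of \<open>w\<close>
      vanishes too. The difference is a cycle and is therefore represented by the lifts of Tor_2 up
      to a boundary.\<close>
    let ?y = "\<Sum>i<s n. smul (c i) (y n i)"
    have fy: "?f ?y = ?f w"
    proof (rule poly_mapping_eqI)
      fix x
      have *: "lookup (?f ?y) x = (\<Sum>i<s n. c i * (ds n ! i when (n, i) = x))"
        by (simp add: f.sum f.scale lookup_sum lookup_smul y(2) lookup_single)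
      show "lookup (?f ?y) x = lookup (?f w) x"
      proof (cases "x \<in> ?X \<and> fst x = n")
        case True
        then obtain k where k: "x = (n, k)" "k < length (ds n)"
          by auto
        then have "lookup (?f ?y) x = (\<Sum>i<s n. if i = k then c i * ds n ! i else 0)"
          unfolding * by (intro sum.cong) (auto simp: when_def)
        then show ?thesis
          using s(2)[OF k(2)] c[OF k(2)] by (simp add: k(1) mult.commute)
      next
        case False
        then have "lookup (?f w) x = 0"
          using kmap_kgr[OF R.d1_graded_map w] by (cases x) (auto simp: kgr_iff)
        moreover have "lookup (?f ?y) x = 0"
          unfolding * using False s(1)[of n] by (intro sum.neutral) (auto simp: when_def)
        ultimately show ?thesis
          by simp
      qed
    qed
    have "?y \<in> ?K n"
      by (intro sm.subspace_sum[OF subspace_kgr] sm.subspace_scale[OF subspace_kgr] y(1)) auto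
    then have "w - ?y \<in> Hz G.all_rels fst R.d1 n"
      using sm.subspace_diff[OF subspace_kgr w] by (simp add: Hz_def f.diff fy)
    then obtain c' where c': "w - ?y - (\<Sum>i<length (es n). smul (c' i) (zs' n ! i)) \<in> Hb G.all_rels fst R.d1 n"
      using zs'(3) by blast
    have V: "v (n, i) \<in> sm.span (V n)" if "i < length (es n) + s n" for i
      using that by (intro sm.span_base) (auto simp: V_def)
    have "y n i \<in> sm.span (V n)" if "i < s n" for i
      using V[of "length (es n) + i"] that by (simp add: v_def)
    moreover have "zs' n ! i \<in> sm.span (V n)" if "i < length (es n)" for i
      using V[of i] that by (simp add: v_def)
    ultimately have "?y + (\<Sum>i<length (es n). smul (c' i) (zs' n ! i)) \<in> sm.span (V n)"
      by (intro sm.span_add sm.span_sum sm.span_scale) auto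
    then show "\<exists>u\<in>sm.span (V n). w - u \<in> Hb G.all_rels fst R.d1 n"
      using c' by (intro bexI[of _ "?y + (\<Sum>i<length (es n). smul (c' i) (zs' n ! i))"]) (simp_all only: diff_diff_eq)
  qed
  also have "(\<Union>n. ext snd ` V n) = (\<lambda>j. ext snd (v j)) ` ?J"
    by (auto simp: V_def)
  finally have kernel: "{p \<in> free_alg ?X. eval a p = 0} = ideal_gen (free_alg ?X) ((\<lambda>j. ext snd (v j)) ` ?J)" .
  have "ext snd (v j) \<in> free_alg_gr ?X fst (fst j)" if "j \<in> ?J" for j
  proof -
    have "keys (v j) \<subseteq> {i \<in> G.all_rels. fst i = fst j}"
      using vK[of "snd j" "fst j"] that by (simp add: kgr_def case_prod_beta)
    then have "i \<in> G.all_rels" "fst i = fst j" if "i \<in> keys (v j)" for i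
      using that by blast+
    then have "\<forall>i\<in>keys (v j). snd i \<in> free_alg_gr ?X fst (fst j)"
      using R.rel_gr by metis
    then show ?thesis
      by (auto simp: ext_def free_alg_gr_iff lookup_sum lookup_smul intro!: free_alg_sum free_alg_smul sum.neutral)
  qed
  then have "presented_algebra scale gr deg ?X fst (eval a) ?J fst (\<lambda>j. ext snd (v j))"
    by unfold_locales (rule kernel | blast)+
  moreover have "0 < deg (fst j)" if j: "j \<in> ?J" for j
  proof (cases "snd j < length (es (fst j))")
    case True
    then show ?thesis
      by (intro pos') auto
  next
    case False
    then show ?thesis
      using j s(1)[of "fst j"] by (intro pos) auto
  qed
  ultimately show ?thesis
    using homogeneous_presentation_iff[OF connected_graded_algebra_axioms] by blast
qed

end

end

theorem theoremA10:
  fixes scale :: "'k::pid \<Rightarrow> 'a::ring_1 \<Rightarrow> 'a"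
    and gr :: "'g::comm_monoid_add \<Rightarrow> 'a set"
    and deg :: "'g \<Rightarrow> int"
    and E :: "nat \<Rightarrow> 'e set"
    and ge :: "nat \<Rightarrow> 'e \<Rightarrow> 'g"
    and d :: "nat \<Rightarrow> ('e \<Rightarrow>\<^sub>0 'a) \<Rightarrow> ('e \<Rightarrow>\<^sub>0 'a)"
    and \<eta> :: "('e \<Rightarrow>\<^sub>0 'a) \<Rightarrow> 'k"
  assumes A: "connected_graded_algebra scale gr deg"
    and F: "graded_free_resolution scale gr deg E ge d \<eta>"
    and fin1: "\<And>n. fin_gen smul (Tor scale gr deg E ge d 1 n)"
    and fin2: "\<And>n. fin_gen smul (Tor scale gr deg E ge d 2 n)"
  shows
    "((\<exists>B. \<not> module.dependent scale B \<and> module.span scale B = UNIV) \<longrightarrow>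
        (\<exists>(X :: ('g \<times> nat) set) (gx :: 'g \<times> nat \<Rightarrow> 'g) (J :: ('g \<times> nat) set)
            (gj :: 'g \<times> nat \<Rightarrow> 'g) r.
           homogeneous_presentation scale gr deg X gx J gj r \<and>
           (\<forall>n. finite {x \<in> X. gx x = n} \<and>
                card {x \<in> X. gx x = n} = gen smul (Tor scale gr deg E ge d 1 n) \<and>
                finite {j \<in> J. gj j = n} \<and>
                card {j \<in> J. gj j = n} =
                  gen smul (Tor scale gr deg E ge d 2 n) + rel smul (Tor scale gr deg E ge d 1 n)))) \<and>
     (\<forall>(X :: 'x set) (gx :: 'x \<Rightarrow> 'g) (J :: 'j set) (gj :: 'j \<Rightarrow> 'g) r.
        homogeneous_presentation scale gr deg X gx J gj r \<longrightarrow>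
        (\<forall>n. (finite {x \<in> X. gx x = n} \<longrightarrow>
                card {x \<in> X. gx x = n} \<ge> gen smul (Tor scale gr deg E ge d 1 n)) \<and>
             (finite {j \<in> J. gj j = n} \<longrightarrow>
                card {j \<in> J. gj j = n} \<ge>
                  gen smul (Tor scale gr deg E ge d 2 n) + rel smul (Tor scale gr deg E ge d 1 n))))"
proof -
  interpret connected_graded_algebra scale gr deg
    by (rule A)
  let ?T = "\<lambda>i. Tor scale gr deg E ge d i"
  have ex: "\<exists>ds. invariant_factors smul (?T (Suc i) n) ds" if "fin_gen smul (?T (Suc i) n)" for i n
    using pid_module.invariant_factors_exist[OF pid_module.intro[OF module_smul] subspace_Tor[OF F, of i n]] that
    by simp
  \<comment> \<open>The same choices as in the definitions of \<open>gen\<close> and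
    \<open>rel\<close>, so that the counts become lengths by unfolding.\<close>
  define ds where "ds n = (SOME ds. invariant_factors smul (?T 1 n) ds)" for n
  define es where "es n = (SOME es. invariant_factors smul (?T 2 n) es)" for n
  have ds: "invariant_factors smul (?T 1 n) (ds n)" for n
    unfolding ds_def using ex[of 0 n] fin1[of n] by (intro someI_ex[of "invariant_factors smul (?T 1 n)"]) simp
  have es: "invariant_factors smul (?T 2 n) (es n)" for n
    unfolding es_def using ex[of 1 n] fin2[of n]
    by (intro someI_ex[of "invariant_factors smul (?T 2 n)"]) (simp add: numeral_2_eq_2)
  define s where "s n = nonzero_length (ds n)" for n
  have gen: "gen smul (?T 1 n) = length (ds n)" "gen smul (?T 2 n) = length (es n)" "rel smul (?T 1 n) = s n" for n
    by (simp_all add: gen_def rel_def ds_def es_def s_def nonzero_length_def Let_def)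
  have card: "finite {x \<in> {(n, i). i < f n}. fst x = n} \<and> card {x \<in> {(n, i). i < f n}. fst x = n} = f n"
    for f :: "'g \<Rightarrow> nat" and n
  proof -
    have "{x \<in> {(n, i). i < f n}. fst x = n} = Pair n ` {..<f n}"
      by auto
    then show ?thesis
      by (simp add: card_image inj_on_def)
  qed
  obtain r where "homogeneous_presentation scale gr deg {(n, i). i < length (ds n)} fst
      {(n, i). i < length (es n) + s n} fst r"
    using minimal_presentation[OF F ds es] unfolding s_def by blast
  then show ?thesis
    unfolding gen using presentation_bounds[OF A F ds es] card[of "\<lambda>n. length (ds n)"] card[of "\<lambda>n. length (es n) + s n"]
    by (intro conjI impI exI[of _ "{(n, i). i < length (ds n)}"] exI[of _ fst]
        exI[of _ "{(n, i). i < length (es n) + s n}"] exI[of _ r] allI) (simp_all add: s_def)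
qed

end
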